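(* Let $R$ be an associative ring with identity and let $\mathcal X$ be a class of left $R$-modules which is closed under direct sums and closed under $\aleph_1$-free modules (i.e. every $(\aleph_1,\mathcal X)$-free left $R$-module belongs to $\mathcal X$). Then the class ${}^{\perp}(\mathcal X^{\perp})$ contains all totally ordered direct limits of modules in $\mathcal X$.
   Context: $R$ is a not necessarily commutative ring with identity; "module" means left $R$-module. For a class $\mathcal X$ of modules, $\mathcal X^{\perp}=\{Y : \operatorname{Ext}^1_R(X,Y)=0 \text{ for all } X\in\mathcal X\}$ and ${}^{\perp}\mathcal X=\{Y : \operatorname{Ext}^1_R(Y,X)=0 \text{ for all } X\in\mathcal X\}$. Closure under direct sums is understood up to isomorphism, for arbitrary set-indexed families. A totally ordered direct limit of modules belonging to $\mathcal X$ is a module which is the direct limit of a direct system $(X_i,f_{ij})_{i,j\in I}$ with all $X_i\in\mathcal X$ and $I$ a totally ordered set. Let $\kappa$ be an infinite regular cardinal. A module $M$ is $(\kappa,\mathcal X)$-free if it has a $(\kappa,\mathcal X)$-dense system of submodules, that is, a family $\mathcal S$ of submodules of $M$, directed under inclusion, such that: (1) $\mathcal S\subseteq\mathcal X$; (2) $\mathcal S$ is closed under unions of well ordered ascending chains of length smaller than $\kappa$; (3) every subset of $M$ of cardinality smaller than $\kappa$ is contained in an element of $\mathcal S$. *)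

theory Defs
  imports "HOL-Algebra.Module" "HOL-Algebra.Coset" "HOL-Algebra.Elementary_Groups"
begin

unbundle cardinal_syntax

section \<open>Left modules over a ring\<close>

text \<open>
  The locale \<^locale>\<open>module\<close> of the library requires a commutative ring of scalars, so left modules
  over an arbitrary ring are introduced here, on the library's record type. The multiplicative
  fields \<^const>\<open>monoid.mult\<close> and \<^const>\<open>one\<close> of that record are meaningless for modules; they are left
  unspecified in the constructions below and nothing refers to them.
\<close>

locale left_module = R?: ring R + M?: abelian_group M
  for R :: "('r, 'm) ring_scheme" (structure) and M :: "('r, 'a, 'n) module_scheme" (structure) +
  assumes smult_closed [simp, intro]:
      "\<lbrakk>a \<in> carrier R; x \<in> carrier M\<rbrakk> \<Longrightarrow> a \<odot>\<^bsub>M\<^esub> x \<in> carrier M"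
    and smult_l_distr:
      "\<lbrakk>a \<in> carrier R; b \<in> carrier R; x \<in> carrier M\<rbrakk> \<Longrightarrow>
        (a \<oplus>\<^bsub>R\<^esub> b) \<odot>\<^bsub>M\<^esub> x = a \<odot>\<^bsub>M\<^esub> x \<oplus>\<^bsub>M\<^esub> b \<odot>\<^bsub>M\<^esub> x"
    and smult_r_distr:
      "\<lbrakk>a \<in> carrier R; x \<in> carrier M; y \<in> carrier M\<rbrakk> \<Longrightarrow>
        a \<odot>\<^bsub>M\<^esub> (x \<oplus>\<^bsub>M\<^esub> y) = a \<odot>\<^bsub>M\<^esub> x \<oplus>\<^bsub>M\<^esub> a \<odot>\<^bsub>M\<^esub> y"
    and smult_assoc:
      "\<lbrakk>a \<in> carrier R; b \<in> carrier R; x \<in> carrier M\<rbrakk> \<Longrightarrow>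
        (a \<otimes>\<^bsub>R\<^esub> b) \<odot>\<^bsub>M\<^esub> x = a \<odot>\<^bsub>M\<^esub> (b \<odot>\<^bsub>M\<^esub> x)"
    and smult_one [simp]:
      "x \<in> carrier M \<Longrightarrow> \<one>\<^bsub>R\<^esub> \<odot>\<^bsub>M\<^esub> x = x"

text \<open>Homomorphisms are extensional on the carrier, so that equality of homomorphisms is equality
  of functions.\<close>

definition mod_hom ::
    "('r, 'm) ring_scheme \<Rightarrow> ('r, 'a, 'n) module_scheme \<Rightarrow> ('r, 'b, 'k) module_scheme \<Rightarrow> ('a \<Rightarrow> 'b) set"
  where "mod_hom R M N =
    {h \<in> carrier M \<rightarrow>\<^sub>E carrier N.
       (\<forall>x\<in>carrier M. \<forall>y\<in>carrier M. h (x \<oplus>\<^bsub>M\<^esub> y) = h x \<oplus>\<^bsub>N\<^esub> h y) \<and>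
       (\<forall>a\<in>carrier R. \<forall>x\<in>carrier M. h (a \<odot>\<^bsub>M\<^esub> x) = a \<odot>\<^bsub>N\<^esub> h x)}"

definition mod_isomorphic ::
    "('r, 'm) ring_scheme \<Rightarrow> ('r, 'a, 'n) module_scheme \<Rightarrow> ('r, 'b, 'k) module_scheme \<Rightarrow> bool"
  where "mod_isomorphic R M N \<longleftrightarrow> (\<exists>h\<in>mod_hom R M N. bij_betw h (carrier M) (carrier N))"

definition direct_sum ::
    "('r, 'm) ring_scheme \<Rightarrow> 'i set \<Rightarrow> ('i \<Rightarrow> ('r, 'a, 'n) module_scheme) \<Rightarrow> ('r, 'i \<Rightarrow> 'a) module"
  where "direct_sum R I D =
    \<lparr>carrier = {x \<in> \<Pi>\<^sub>E i\<in>I. carrier (D i). finite {i \<in> I. x i \<noteq> \<zero>\<^bsub>D i\<^esub>}},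
     monoid.mult = undefined, one = undefined,
     ring.zero = (\<lambda>i\<in>I. \<zero>\<^bsub>D i\<^esub>),
     ring.add = (\<lambda>x y. \<lambda>i\<in>I. x i \<oplus>\<^bsub>D i\<^esub> y i),
     module.smult = (\<lambda>a x. \<lambda>i\<in>I. a \<odot>\<^bsub>D i\<^esub> x i)\<rparr>"

definition regular_module :: "('r, 'm) ring_scheme \<Rightarrow> ('r, 'r) module"
  where "regular_module R =
    \<lparr>carrier = carrier R, monoid.mult = undefined, one = undefined,
     ring.zero = \<zero>\<^bsub>R\<^esub>, ring.add = (\<oplus>\<^bsub>R\<^esub>), module.smult = (\<otimes>\<^bsub>R\<^esub>)\<rparr>"


section \<open>The group Ext\<close>

text \<open>
  \<open>Ext\<^sup>1(X, Y)\<close> is the first cohomology group of the complex \<open>Hom(P\<^sub>\<bullet>, Y)\<close> for a projective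
  resolution \<open>P\<^sub>\<bullet>\<close> of \<open>X\<close>. The canonical free resolution is used: \<open>P\<^sub>n\<close> is the free module on the
  underlying set of the \<open>n\<close>-th syzygy module \<open>\<Omega>\<^sup>n X\<close> (with \<open>\<Omega>\<^sup>0 X = X\<close>), mapped onto \<open>\<Omega>\<^sup>n X\<close> by
  \<open>cover_map R (\<Omega>\<^sup>n X)\<close>, and \<open>\<Omega>\<^sup>n\<^sup>+\<^sup>1 X\<close> is the kernel of that map. The differential
  \<open>P\<^sub>n\<^sub>+\<^sub>1 \<rightarrow> P\<^sub>n\<close> is this map followed by the inclusion.
\<close>

definition free_cover :: "('r, 'm) ring_scheme \<Rightarrow> ('r, 'a, 'n) module_scheme \<Rightarrow> ('r, 'a \<Rightarrow> 'r) module"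
  where "free_cover R M = direct_sum R (carrier M) (\<lambda>_. regular_module R)"

definition cover_map ::
    "('r, 'm) ring_scheme \<Rightarrow> ('r, 'a, 'n) module_scheme \<Rightarrow> ('a \<Rightarrow> 'r) \<Rightarrow> 'a"
  where "cover_map R M =
    (\<lambda>c\<in>carrier (free_cover R M). \<Oplus>\<^bsub>M\<^esub>x\<in>{x \<in> carrier M. c x \<noteq> \<zero>\<^bsub>R\<^esub>}. c x \<odot>\<^bsub>M\<^esub> x)"

definition syzygy :: "('r, 'm) ring_scheme \<Rightarrow> ('r, 'a, 'n) module_scheme \<Rightarrow> ('r, 'a \<Rightarrow> 'r) module"
  where "syzygy R M =
    (free_cover R M)\<lparr>carrier := {c \<in> carrier (free_cover R M). cover_map R M c = \<zero>\<^bsub>M\<^esub>}\<rparr>"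

definition hom_group ::
    "('r, 'm) ring_scheme \<Rightarrow> ('r, 'a, 'n) module_scheme \<Rightarrow> ('r, 'b, 'k) module_scheme \<Rightarrow> ('a \<Rightarrow> 'b) monoid"
  where "hom_group R M N =
    \<lparr>carrier = mod_hom R M N,
     monoid.mult = (\<lambda>f g. \<lambda>x\<in>carrier M. f x \<oplus>\<^bsub>N\<^esub> g x),
     one = (\<lambda>x\<in>carrier M. \<zero>\<^bsub>N\<^esub>)\<rparr>"

definition ext1_cocycles ::
    "('r, 'm) ring_scheme \<Rightarrow> ('r, 'a, 'n) module_scheme \<Rightarrow> ('r, 'b, 'k) module_scheme
      \<Rightarrow> ((('a \<Rightarrow> 'r) \<Rightarrow> 'r) \<Rightarrow> 'b) set"
  where "ext1_cocycles R X Y =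
    {f \<in> mod_hom R (free_cover R (syzygy R X)) Y.
       \<forall>c\<in>carrier (free_cover R (syzygy R (syzygy R X))).
         f (cover_map R (syzygy R (syzygy R X)) c) = \<zero>\<^bsub>Y\<^esub>}"

definition ext1_coboundaries ::
    "('r, 'm) ring_scheme \<Rightarrow> ('r, 'a, 'n) module_scheme \<Rightarrow> ('r, 'b, 'k) module_scheme
      \<Rightarrow> ((('a \<Rightarrow> 'r) \<Rightarrow> 'r) \<Rightarrow> 'b) set"
  where "ext1_coboundaries R X Y =
    (\<lambda>g. \<lambda>c\<in>carrier (free_cover R (syzygy R X)). g (cover_map R (syzygy R X) c))
      ` mod_hom R (free_cover R X) Y"

definition Ext1 ::
    "('r, 'm) ring_scheme \<Rightarrow> ('r, 'a, 'n) module_scheme \<Rightarrow> ('r, 'b, 'k) module_scheme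
      \<Rightarrow> ((('a \<Rightarrow> 'r) \<Rightarrow> 'r) \<Rightarrow> 'b) set monoid"
  where "Ext1 R X Y =
    (hom_group R (free_cover R (syzygy R X)) Y)\<lparr>carrier := ext1_cocycles R X Y\<rparr>
      Mod ext1_coboundaries R X Y"


section \<open>Classes of modules\<close>

text \<open>
  The type \<open>'v\<close> plays the role of the universe of sets. A set is small if its cardinality is less
  than that of \<open>'v\<close>; when the latter is strongly inaccessible, the small sets are, up to
  bijection, the sets of a Grothendieck universe, and every small module is isomorphic to one with
  carrier in \<open>'v\<close>. A class of modules is then a set of small modules, just as a proper class is
  an arbitrary collection of sets. In particular \<open>'v\<close> can be a type of all ZFC sets.
\<close>

definition strongly_inaccessible :: "'k rel \<Rightarrow> bool"
  where "strongly_inaccessible \<kappa> \<longleftrightarrow>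
    Card_order \<kappa> \<and> natLeq <o \<kappa> \<and> regularCard \<kappa> \<and>
    (\<forall>A\<subseteq>Field \<kappa>. |A| <o \<kappa> \<longrightarrow> |Pow A| <o \<kappa>)"

definition small :: "'v itself \<Rightarrow> 'a set \<Rightarrow> bool"
  where "small _ A \<longleftrightarrow> |A| <o |UNIV :: 'v set|"

definition Modules :: "('r, 'm) ring_scheme \<Rightarrow> ('r, 'v) module set"
  where "Modules R = {M. left_module R M \<and> small TYPE('v) (carrier M)}"

definition right_perp :: "('r, 'm) ring_scheme \<Rightarrow> ('r, 'v) module set \<Rightarrow> ('r, 'v) module set"
  where "right_perp R \<X> = {Y \<in> Modules R. \<forall>X\<in>\<X>. trivial_group (Ext1 R X Y)}"

definition left_perp :: "('r, 'm) ring_scheme \<Rightarrow> ('r, 'v) module set \<Rightarrow> ('r, 'v) module set"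
  where "left_perp R \<X> = {Y \<in> Modules R. \<forall>X\<in>\<X>. trivial_group (Ext1 R Y X)}"

text \<open>One-element families show that the next property includes closure under isomorphism.\<close>

definition closed_under_direct_sums :: "('r, 'm) ring_scheme \<Rightarrow> ('r, 'v) module set \<Rightarrow> bool"
  where "closed_under_direct_sums R \<X> \<longleftrightarrow>
    (\<forall>(I :: 'v set) D. small TYPE('v) I \<and> (\<forall>i\<in>I. D i \<in> \<X>) \<longrightarrow>
      (\<forall>M\<in>Modules R. mod_isomorphic R M (direct_sum R I D) \<longrightarrow> M \<in> \<X>))"


section \<open>Dense systems of submodules\<close>

text \<open>
  The cardinal \<open>\<kappa>\<close>, assumed infinite and regular in applications, is given as a cardinal order
  relation. An ordinal less than \<open>\<kappa>\<close> is represented by a well-order \<open>r <o \<kappa>\<close>, which can always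
  be taken on the type underlying \<open>\<kappa>\<close>; it is nonempty because the empty union is not a submodule.
\<close>

definition dense_system ::
    "'k rel \<Rightarrow> ('r, 'm) ring_scheme \<Rightarrow> ('r, 'v) module set \<Rightarrow> ('r, 'v) module \<Rightarrow> 'v set set \<Rightarrow> bool"
  where "dense_system \<kappa> R \<X> M \<S> \<longleftrightarrow>
    (\<forall>N\<in>\<S>. submodule N R M) \<and>
    \<S> \<noteq> {} \<and> (\<forall>N\<in>\<S>. \<forall>N'\<in>\<S>. \<exists>L\<in>\<S>. N \<subseteq> L \<and> N' \<subseteq> L) \<and>
    (\<forall>N\<in>\<S>. M\<lparr>carrier := N\<rparr> \<in> \<X>) \<and>
    (\<forall>(r :: 'k rel) C. Well_order r \<and> r \<noteq> {} \<and> r <o \<kappa> \<and> (\<forall>i\<in>Field r. C i \<in> \<S>) \<and> relChain r C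
      \<longrightarrow> (\<Union>i\<in>Field r. C i) \<in> \<S>) \<and>
    (\<forall>A\<subseteq>carrier M. |A| <o \<kappa> \<longrightarrow> (\<exists>N\<in>\<S>. A \<subseteq> N))"

definition kappa_free ::
    "'k rel \<Rightarrow> ('r, 'm) ring_scheme \<Rightarrow> ('r, 'v) module set \<Rightarrow> ('r, 'v) module \<Rightarrow> bool"
  where "kappa_free \<kappa> R \<X> M \<longleftrightarrow> left_module R M \<and> (\<exists>\<S>. dense_system \<kappa> R \<X> M \<S>)"

abbreviation aleph1 :: "nat set rel"
  where "aleph1 \<equiv> cardSuc natLeq"

definition closed_under_aleph1_free :: "('r, 'm) ring_scheme \<Rightarrow> ('r, 'v) module set \<Rightarrow> bool"
  where "closed_under_aleph1_free R \<X> \<longleftrightarrow>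
    (\<forall>M\<in>Modules R. kappa_free aleph1 R \<X> M \<longrightarrow> M \<in> \<X>)"


section \<open>Totally ordered direct limits\<close>

text \<open>The pair \<open>(I, r)\<close> is the index set with its order, \<open>(i, j) \<in> r\<close> meaning \<open>i \<le> j\<close>.\<close>

definition direct_system ::
    "('r, 'm) ring_scheme \<Rightarrow> 'i set \<Rightarrow> 'i rel \<Rightarrow> ('i \<Rightarrow> ('r, 'v) module)
      \<Rightarrow> ('i \<Rightarrow> 'i \<Rightarrow> 'v \<Rightarrow> 'v) \<Rightarrow> bool"
  where "direct_system R I r D f \<longleftrightarrow>
    partial_order_on I r \<and> I \<noteq> {} \<and> (\<forall>i\<in>I. \<forall>j\<in>I. \<exists>k\<in>I. (i, k) \<in> r \<and> (j, k) \<in> r) \<and>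
    (\<forall>i\<in>I. D i \<in> Modules R) \<and>
    (\<forall>i j. (i, j) \<in> r \<longrightarrow> f i j \<in> mod_hom R (D i) (D j)) \<and>
    (\<forall>i\<in>I. \<forall>x\<in>carrier (D i). f i i x = x) \<and>
    (\<forall>i j k. (i, j) \<in> r \<and> (j, k) \<in> r \<longrightarrow> (\<forall>x\<in>carrier (D i). f j k (f i j x) = f i k x))"

definition cocone ::
    "('r, 'm) ring_scheme \<Rightarrow> 'i set \<Rightarrow> 'i rel \<Rightarrow> ('i \<Rightarrow> ('r, 'v) module)
      \<Rightarrow> ('i \<Rightarrow> 'i \<Rightarrow> 'v \<Rightarrow> 'v) \<Rightarrow> ('r, 'v) module \<Rightarrow> ('i \<Rightarrow> 'v \<Rightarrow> 'v) \<Rightarrow> bool"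
  where "cocone R I r D f M \<phi> \<longleftrightarrow>
    M \<in> Modules R \<and> (\<forall>i\<in>I. \<phi> i \<in> mod_hom R (D i) M) \<and>
    (\<forall>i j. (i, j) \<in> r \<longrightarrow> (\<forall>x\<in>carrier (D i). \<phi> j (f i j x) = \<phi> i x))"

definition is_direct_limit ::
    "('r, 'm) ring_scheme \<Rightarrow> 'i set \<Rightarrow> 'i rel \<Rightarrow> ('i \<Rightarrow> ('r, 'v) module)
      \<Rightarrow> ('i \<Rightarrow> 'i \<Rightarrow> 'v \<Rightarrow> 'v) \<Rightarrow> ('r, 'v) module \<Rightarrow> bool"
  where "is_direct_limit R I r D f M \<longleftrightarrow>
    (\<exists>\<phi>. cocone R I r D f M \<phi> \<and>
      (\<forall>T \<psi>. cocone R I r D f T \<psi> \<longrightarrow>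
        (\<exists>!u. u \<in> mod_hom R M T \<and> (\<forall>i\<in>I. \<forall>x\<in>carrier (D i). u (\<phi> i x) = \<psi> i x))))"

definition tot_ord_direct_limits ::
    "('r, 'm) ring_scheme \<Rightarrow> ('r, 'v) module set \<Rightarrow> ('r, 'v) module set"
  where "tot_ord_direct_limits R \<X> =
    {M. \<exists>(I :: 'v set) r D f.
       small TYPE('v) I \<and> linear_order_on I r \<and> direct_system R I r D f \<and>
       (\<forall>i\<in>I. D i \<in> \<X>) \<and> is_direct_limit R I r D f M}"

end

theory Submission
  imports Defs "HOL-Library.Countable_Set_Type"
begin

text \<open>
  Let \<open>M\<close> be the direct limit of a totally ordered system of modules in \<open>\<X>\<close>. The system may be
  replaced by a cofinal well-ordered one, \<open>(D i)\<close> for \<open>i \<in> J\<close>. If \<open>J\<close> has a last element, \<open>M\<close> is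
  isomorphic to the last module and lies in \<open>\<X>\<close>. Otherwise let \<open>B\<close> be the direct sum of all \<open>D i\<close>;
  it belongs to \<open>\<X>\<close>, and \<open>M\<close> is the quotient of \<open>B\<close> by the submodule \<open>K\<close> of those \<open>b\<close> whose sum,
  transported to the module \<open>D k\<close>, vanishes for all sufficiently large \<open>k\<close>. As \<open>Ext\<^sup>1(B, C) = 0\<close> for
  \<open>C \<in> \<X>\<^sup>\<bottom>\<close>, it is enough to extend every homomorphism \<open>g : K \<rightarrow> C\<close> to \<open>B\<close>
  (\<open>Ext1_trivial_if_extends_from_kernel\<close>).

  The extension is found by counting in a tree module. Take an increasing family of sets \<open>U i\<close>,
  \<open>i \<in> J\<close>, whose union \<open>\<Omega>\<close> is so large that \<open>|B|\<close>, \<open>|C|\<close> and \<open>|Pow (U i)|\<close> are at most \<open>|\<Omega>|\<close>; \<open>|\<Omega>|\<close>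
  then behaves like a strong limit cardinal with the cofinality of \<open>J\<close> (\<open>tree_levels\<close>). The subsets
  \<open>\<eta>\<close> of \<open>\<Omega>\<close> are the branches of a tree whose nodes of level \<open>i\<close> are the traces \<open>\<eta> \<inter> U i\<close>. Let \<open>P\<close> be the direct sum of one copy of \<open>B\<close> for each branch. Every \<open>x \<in> D i\<close> in
  the copy with index \<open>\<eta>\<close> determines the family that has the image of \<open>x\<close> in \<open>D j\<close> at the node
  \<open>\<eta> \<inter> U j\<close> for \<open>j \<ge> i\<close> and \<open>0\<close> at all other nodes. Let \<open>N\<close> be the kernel of the resulting map from \<open>P\<close>
  to the product over all nodes and let \<open>L = P / N\<close>.

  The module \<open>L\<close> is \<open>(\<aleph>\<^sub>1, \<X>)\<close>-free, and hence in \<open>\<X>\<close> (\<open>L_in_class\<close>): the submodule spanned by countably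
  many branches is a direct sum of modules \<open>D i\<close>. Indeed, enumerate the branches and let \<open>g \<eta>\<close> be the
  first level where \<open>\<eta>\<close> has left all its predecessors. Below \<open>g \<eta>\<close> it runs along one of its finitely many
  predecessors, so that it contributes exactly its modules \<open>D i\<close> with \<open>i \<ge> g \<eta>\<close>
  (\<open>countable_span_in_class\<close>).

  Since \<open>Ext\<^sup>1(L, C) = 0\<close>, for every set \<open>T\<close> of branches the map \<open>N \<rightarrow> C\<close> which is \<open>g\<close> on the branches
  in \<open>T\<close> and \<open>0\<close> on the others extends to some \<open>\<Phi> T : P \<rightarrow> C\<close>. The difference of \<open>\<Phi> T\<close> and the original
  map factors, on the copies of \<open>K\<close>, through their image in \<open>L\<close>, and that image is generated by at most \<open>|\<Omega>|\<close>
  elements, because an element of \<open>K\<close> only sees a bounded piece of its branch (\<open>truncated_branch\<close>). So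
  there are at most \<open>|Pow \<Omega>|\<close> differences, but \<open>|Pow (Pow \<Omega>)|\<close> sets \<open>T\<close>. Hence two distinct sets \<open>T\<close> and
  \<open>T'\<close> share their difference, and on the copy of \<open>B\<close> for a branch that lies only in \<open>T\<close> the map
  \<open>\<Phi> T - \<Phi> T'\<close> extends \<open>g\<close> (\<open>extension_by_counting\<close>).
\<close>

section \<open>Submodules and linear maps\<close>

lemma (in left_module) zero_smult [simp]: "x \<in> carrier M \<Longrightarrow> \<zero>\<^bsub>R\<^esub> \<odot>\<^bsub>M\<^esub> x = \<zero>\<^bsub>M\<^esub>"
  by (metis M.add.r_cancel_one R.r_zero R.zero_closed smult_closed smult_l_distr)

lemma (in left_module) smult_zero [simp]: "a \<in> carrier R \<Longrightarrow> a \<odot>\<^bsub>M\<^esub> \<zero>\<^bsub>M\<^esub> = \<zero>\<^bsub>M\<^esub>"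
  by (metis M.add.r_cancel_one M.r_zero M.zero_closed smult_closed smult_r_distr)

lemma (in left_module) neg_one_smult:
  assumes "x \<in> carrier M" shows "(\<ominus>\<^bsub>R\<^esub> \<one>\<^bsub>R\<^esub>) \<odot>\<^bsub>M\<^esub> x = \<ominus>\<^bsub>M\<^esub> x"
  by (metis M.minus_equality R.add.inv_closed R.l_neg R.one_closed assms smult_closed smult_l_distr
      smult_one zero_smult)

lemma (in left_module) smult_neg:
  assumes "a \<in> carrier R" "x \<in> carrier M"
  shows "a \<odot>\<^bsub>M\<^esub> (\<ominus>\<^bsub>M\<^esub> x) = \<ominus>\<^bsub>M\<^esub> (a \<odot>\<^bsub>M\<^esub> x)"
  by (metis M.add.inv_closed M.l_neg M.minus_equality assms smult_closed smult_r_distr smult_zero)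

lemma (in left_module) smult_minus:
  assumes "a \<in> carrier R" "x \<in> carrier M" "y \<in> carrier M"
  shows "a \<odot>\<^bsub>M\<^esub> (x \<ominus>\<^bsub>M\<^esub> y) = a \<odot>\<^bsub>M\<^esub> x \<ominus>\<^bsub>M\<^esub> a \<odot>\<^bsub>M\<^esub> y"
  using assms by (simp add: a_minus_def smult_r_distr smult_neg)

lemma (in left_module) minus_eq_zero_iff:
  assumes "x \<in> carrier M" "y \<in> carrier M"
  shows "x \<ominus>\<^bsub>M\<^esub> y = \<zero>\<^bsub>M\<^esub> \<longleftrightarrow> x = y"
  using assms M.minus_equality[of x "\<ominus>\<^bsub>M\<^esub> y"] M.r_neg by (auto simp: a_minus_def)

lemma (in left_module) submoduleI':
  assumes "N \<subseteq> carrier M" "\<zero>\<^bsub>M\<^esub> \<in> N"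
    and "\<And>x y. \<lbrakk>x \<in> N; y \<in> N\<rbrakk> \<Longrightarrow> x \<oplus>\<^bsub>M\<^esub> y \<in> N"
    and "\<And>a x. \<lbrakk>a \<in> carrier R; x \<in> N\<rbrakk> \<Longrightarrow> a \<odot>\<^bsub>M\<^esub> x \<in> N"
  shows "submodule N R M"
proof -
  have "\<ominus>\<^bsub>M\<^esub> x \<in> N" if "x \<in> N" for x
    using neg_one_smult assms that by (metis R.add.inv_closed R.one_closed subsetD)
  then show ?thesis
    using assms unfolding submodule_def subgroup_def submodule_axioms_def by (auto simp: a_inv_def)
qed

lemma submodule_facts:
  assumes "submodule N R M"
  shows "N \<subseteq> carrier M" "\<zero>\<^bsub>M\<^esub> \<in> N"
    and "\<And>x y. \<lbrakk>x \<in> N; y \<in> N\<rbrakk> \<Longrightarrow> x \<oplus>\<^bsub>M\<^esub> y \<in> N"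
    and "\<And>a x. \<lbrakk>a \<in> carrier R; x \<in> N\<rbrakk> \<Longrightarrow> a \<odot>\<^bsub>M\<^esub> x \<in> N"
    and "\<And>x. x \<in> N \<Longrightarrow> \<ominus>\<^bsub>M\<^esub> x \<in> N"
    and "\<And>x y. \<lbrakk>x \<in> N; y \<in> N\<rbrakk> \<Longrightarrow> x \<ominus>\<^bsub>M\<^esub> y \<in> N"
  using assms unfolding submodule_def subgroup_def submodule_axioms_def
  by (auto simp: a_inv_def a_minus_def)

lemma left_moduleI:
  assumes "ring R"
    and closed: "\<And>x y. \<lbrakk>x \<in> carrier M; y \<in> carrier M\<rbrakk> \<Longrightarrow> x \<oplus>\<^bsub>M\<^esub> y \<in> carrier M"
    and zero: "\<zero>\<^bsub>M\<^esub> \<in> carrier M"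
    and assoc: "\<And>x y z. \<lbrakk>x \<in> carrier M; y \<in> carrier M; z \<in> carrier M\<rbrakk>
        \<Longrightarrow> (x \<oplus>\<^bsub>M\<^esub> y) \<oplus>\<^bsub>M\<^esub> z = x \<oplus>\<^bsub>M\<^esub> (y \<oplus>\<^bsub>M\<^esub> z)"
    and comm: "\<And>x y. \<lbrakk>x \<in> carrier M; y \<in> carrier M\<rbrakk> \<Longrightarrow> x \<oplus>\<^bsub>M\<^esub> y = y \<oplus>\<^bsub>M\<^esub> x"
    and l_zero: "\<And>x. x \<in> carrier M \<Longrightarrow> \<zero>\<^bsub>M\<^esub> \<oplus>\<^bsub>M\<^esub> x = x"
    and l_inv: "\<And>x. x \<in> carrier M \<Longrightarrow> \<exists>y\<in>carrier M. y \<oplus>\<^bsub>M\<^esub> x = \<zero>\<^bsub>M\<^esub>"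
    and "left_module_axioms R M"
  shows "left_module R M"
proof -
  have "abelian_group M"
    by (rule abelian_groupI) (use assms in auto)
  then show ?thesis using assms by (simp add: left_module_def)
qed

lemma (in left_module) left_module_submodule:
  assumes "submodule N R M"
  shows "left_module R (M\<lparr>carrier := N\<rparr>)"
proof (rule left_moduleI)
  note N = submodule_facts[OF assms] and S = subsetD[OF submodule_facts(1)[OF assms]]
  show "ring R" by (rule R.ring_axioms)
  show "\<exists>y\<in>carrier (M\<lparr>carrier := N\<rparr>). y \<oplus>\<^bsub>M\<lparr>carrier := N\<rparr>\<^esub> x = \<zero>\<^bsub>M\<lparr>carrier := N\<rparr>\<^esub>"
    if "x \<in> carrier (M\<lparr>carrier := N\<rparr>)" for x
    using that N(5) S M.l_neg by auto
  show "left_module_axioms R (M\<lparr>carrier := N\<rparr>)"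
    using N(4) S by (auto simp: left_module_axioms_def smult_l_distr smult_r_distr smult_assoc)
qed (use submodule_facts[OF assms] subsetD[OF submodule_facts(1)[OF assms]] in
      \<open>auto simp: M.add.m_assoc intro: M.a_comm\<close>)

text \<open>
  Unlike the elements of \<open>mod_hom\<close>, linear maps are arbitrary outside the carrier, so that they can be
  composed and restricted freely.
\<close>

locale linear_map = dom: left_module R M + cod: left_module R N
  for R :: "('r, 'm) ring_scheme" and M :: "('r, 'a, 'n) module_scheme"
    and N :: "('r, 'b, 'k) module_scheme" +
  fixes h :: "'a \<Rightarrow> 'b"
  assumes closed [simp, intro]: "x \<in> carrier M \<Longrightarrow> h x \<in> carrier N"
    and add: "\<lbrakk>x \<in> carrier M; y \<in> carrier M\<rbrakk> \<Longrightarrow> h (x \<oplus>\<^bsub>M\<^esub> y) = h x \<oplus>\<^bsub>N\<^esub> h y"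
    and smult: "\<lbrakk>a \<in> carrier R; x \<in> carrier M\<rbrakk> \<Longrightarrow> h (a \<odot>\<^bsub>M\<^esub> x) = a \<odot>\<^bsub>N\<^esub> h x"
begin

lemma zero [simp]: "h \<zero>\<^bsub>M\<^esub> = \<zero>\<^bsub>N\<^esub>"
  by (metis closed cod.M.add.r_cancel_one dom.M.r_zero dom.M.zero_closed add)

lemma neg: "x \<in> carrier M \<Longrightarrow> h (\<ominus>\<^bsub>M\<^esub> x) = \<ominus>\<^bsub>N\<^esub> h x"
  by (metis closed cod.neg_one_smult dom.neg_one_smult dom.R.add.inv_closed dom.R.one_closed smult)

lemma minus: "\<lbrakk>x \<in> carrier M; y \<in> carrier M\<rbrakk> \<Longrightarrow> h (x \<ominus>\<^bsub>M\<^esub> y) = h x \<ominus>\<^bsub>N\<^esub> h y"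
  by (simp add: a_minus_def add neg)

lemma finsum:
  assumes "f \<in> A \<rightarrow> carrier M"
  shows "h (\<Oplus>\<^bsub>M\<^esub>i\<in>A. f i) = (\<Oplus>\<^bsub>N\<^esub>i\<in>A. h (f i))"
  using assms
proof (induction A rule: infinite_finite_induct)
  case (insert a A)
  then have "f \<in> A \<rightarrow> carrier M" "f a \<in> carrier M" "(\<lambda>i. h (f i)) \<in> A \<rightarrow> carrier N"
    by auto
  with insert show ?case
    by (simp add: dom.M.finsum_insert cod.M.finsum_insert add)
qed auto

lemma submodule_kernel: "submodule {x \<in> carrier M. h x = \<zero>\<^bsub>N\<^esub>} R M"
  by (rule dom.submoduleI') (auto simp: add smult)

lemma submodule_image:
  assumes "submodule S R M"
  shows "submodule (h ` S) R N"
proof (rule cod.submoduleI')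
  note S = submodule_facts[OF assms]
  show "h ` S \<subseteq> carrier N" using S by auto
  show "\<zero>\<^bsub>N\<^esub> \<in> h ` S" using S(2) zero by (metis imageI)
  show "x \<oplus>\<^bsub>N\<^esub> y \<in> h ` S" if "x \<in> h ` S" "y \<in> h ` S" for x y
  proof -
    obtain x' y' where "x = h x'" "y = h y'" "x' \<in> S" "y' \<in> S" using \<open>x \<in> _\<close> \<open>y \<in> _\<close> by auto
    then have "x \<oplus>\<^bsub>N\<^esub> y = h (x' \<oplus>\<^bsub>M\<^esub> y')" using S(1) by (simp add: add subset_iff)
    then show ?thesis using S(3) \<open>x' \<in> S\<close> \<open>y' \<in> S\<close> by simp
  qed
  show "a \<odot>\<^bsub>N\<^esub> x \<in> h ` S" if "a \<in> carrier R" "x \<in> h ` S" for a x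
  proof -
    obtain x' where "x = h x'" "x' \<in> S" using \<open>x \<in> _\<close> by auto
    then have "a \<odot>\<^bsub>N\<^esub> x = h (a \<odot>\<^bsub>M\<^esub> x')" using S(1) that by (simp add: smult subset_iff)
    then show ?thesis using S(4) \<open>x' \<in> S\<close> that by simp
  qed
qed

lemma restrict_submodule:
  assumes "submodule S R M"
  shows "linear_map R (M\<lparr>carrier := S\<rparr>) N h"
proof -
  interpret S: left_module R "M\<lparr>carrier := S\<rparr>" by (rule dom.left_module_submodule[OF assms])
  show ?thesis
    by unfold_locales (use submodule_facts(1)[OF assms] in \<open>auto simp: add smult subset_iff\<close>)
qed

lemma corestrict_submodule:
  assumes "submodule S R N" "\<And>x. x \<in> carrier M \<Longrightarrow> h x \<in> S"
  shows "linear_map R M (N\<lparr>carrier := S\<rparr>) h"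
proof -
  interpret S: left_module R "N\<lparr>carrier := S\<rparr>" by (rule cod.left_module_submodule[OF assms(1)])
  show ?thesis
    by unfold_locales (use assms(2) in \<open>auto simp: add smult subset_iff\<close>)
qed

lemma inj_on_iff_kernel:
  "inj_on h (carrier M) \<longleftrightarrow> (\<forall>x\<in>carrier M. h x = \<zero>\<^bsub>N\<^esub> \<longrightarrow> x = \<zero>\<^bsub>M\<^esub>)"
proof
  assume inj: "inj_on h (carrier M)"
  show "\<forall>x\<in>carrier M. h x = \<zero>\<^bsub>N\<^esub> \<longrightarrow> x = \<zero>\<^bsub>M\<^esub>"
    using inj_onD[OF inj _ _ dom.M.zero_closed] by simp
next
  assume ker: "\<forall>x\<in>carrier M. h x = \<zero>\<^bsub>N\<^esub> \<longrightarrow> x = \<zero>\<^bsub>M\<^esub>"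
  show "inj_on h (carrier M)"
  proof (rule inj_onI)
    fix x y assume xy: "x \<in> carrier M" "y \<in> carrier M" "h x = h y"
    then have "h (x \<ominus>\<^bsub>M\<^esub> y) = \<zero>\<^bsub>N\<^esub>" by (simp add: minus cod.minus_eq_zero_iff)
    with ker xy show "x = y" using dom.M.minus_closed dom.minus_eq_zero_iff by blast
  qed
qed

lemma mod_hom_restrict: "restrict h (carrier M) \<in> mod_hom R M N"
  by (auto simp: mod_hom_def add smult)

end

lemma linear_map_mod_hom:
  assumes "left_module R M" "left_module R N" "h \<in> mod_hom R M N"
  shows "linear_map R M N h"
  using assms by (auto simp: mod_hom_def linear_map_def linear_map_axioms_def)

lemma linear_map_cong:
  assumes "linear_map R M N h" "\<And>x. x \<in> carrier M \<Longrightarrow> h' x = h x"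
  shows "linear_map R M N h'"
proof -
  interpret linear_map R M N h by fact
  show ?thesis by unfold_locales (simp_all add: assms(2) add smult)
qed

lemma linear_map_comp:
  assumes "linear_map R M N h" "linear_map R N L k"
  shows "linear_map R M L (\<lambda>x. k (h x))"
proof -
  interpret h: linear_map R M N h by fact
  interpret k: linear_map R N L k by fact
  show ?thesis by unfold_locales (simp_all add: h.add h.smult k.add k.smult)
qed

lemma linear_map_add:
  assumes "linear_map R M N h" "linear_map R M N k"
  shows "linear_map R M N (\<lambda>x. h x \<oplus>\<^bsub>N\<^esub> k x)"
proof -
  interpret h: linear_map R M N h by fact
  interpret k: linear_map R M N k by fact
  show ?thesis
    by unfold_locales
      (simp_all add: h.add h.smult k.add k.smult h.cod.smult_r_distr h.cod.M.add.m_ac)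
qed

lemma linear_map_neg:
  assumes "linear_map R M N h"
  shows "linear_map R M N (\<lambda>x. \<ominus>\<^bsub>N\<^esub> h x)"
proof -
  interpret h: linear_map R M N h by fact
  show ?thesis
    by unfold_locales (simp_all add: h.add h.smult h.cod.smult_neg h.cod.M.minus_add)
qed

lemma linear_map_minus:
  assumes "linear_map R M N h" "linear_map R M N k"
  shows "linear_map R M N (\<lambda>x. h x \<ominus>\<^bsub>N\<^esub> k x)"
  using linear_map_add[OF assms(1) linear_map_neg[OF assms(2)]] by (simp add: a_minus_def)

lemma linear_map_zero:
  assumes "left_module R M" "left_module R N"
  shows "linear_map R M N (\<lambda>x. \<zero>\<^bsub>N\<^esub>)"
proof -
  interpret M: left_module R M by fact
  interpret N: left_module R N by fact
  show ?thesis by unfold_locales simp_all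
qed

lemma linear_map_id:
  assumes "left_module R M"
  shows "linear_map R M M (\<lambda>x. x)"
proof -
  interpret M: left_module R M by fact
  show ?thesis by unfold_locales simp_all
qed

lemma linear_map_inclusion:
  assumes "left_module R M" "submodule S R M"
  shows "linear_map R (M\<lparr>carrier := S\<rparr>) M (\<lambda>x. x)"
  using linear_map.restrict_submodule[OF linear_map_id[OF assms(1)] assms(2)] .

lemma linear_map_inv_into:
  assumes "linear_map R M N h" "bij_betw h (carrier M) (carrier N)"
  shows "linear_map R N M (inv_into (carrier M) h)"
proof -
  interpret h: linear_map R M N h by fact
  let ?g = "inv_into (carrier M) h"
  have g: "?g y \<in> carrier M" "h (?g y) = y" if "y \<in> carrier N" for y
    using that assms(2) by (metis bij_betw_imp_surj_on inv_into_into f_inv_into_f)+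
  have inj: "x = y" if "x \<in> carrier M" "y \<in> carrier M" "h x = h y" for x y
    using that assms(2) by (auto simp: bij_betw_def inj_on_def)
  show ?thesis
    by unfold_locales (auto intro!: inj simp: g h.add h.smult)
qed

lemma mod_isomorphicI:
  assumes "linear_map R M N h" "bij_betw h (carrier M) (carrier N)"
  shows "mod_isomorphic R M N"
proof -
  have "bij_betw (restrict h (carrier M)) (carrier M) (carrier N)"
    using assms(2) by (simp cong: bij_betw_cong)
  then show ?thesis
    unfolding mod_isomorphic_def using linear_map.mod_hom_restrict[OF assms(1)] by blast
qed

section \<open>Direct sums and quotients\<close>

lemma (in left_module) smult_finsum:
  assumes "a \<in> carrier R" "f \<in> A \<rightarrow> carrier M"
  shows "a \<odot>\<^bsub>M\<^esub> (\<Oplus>\<^bsub>M\<^esub>i\<in>A. f i) = (\<Oplus>\<^bsub>M\<^esub>i\<in>A. a \<odot>\<^bsub>M\<^esub> f i)"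
  using assms(2)
proof (induction A rule: infinite_finite_induct)
  case (insert i A)
  then have "f \<in> A \<rightarrow> carrier M" "f i \<in> carrier M" "(\<lambda>i. a \<odot>\<^bsub>M\<^esub> f i) \<in> A \<rightarrow> carrier M"
    using assms(1) by auto
  with insert show ?case using assms(1) by (simp add: M.finsum_insert smult_r_distr)
qed (use assms(1) in auto)

lemma direct_sum_simps:
  "carrier (direct_sum R I D) =
    {x \<in> \<Pi>\<^sub>E i\<in>I. carrier (D i). finite {i \<in> I. x i \<noteq> \<zero>\<^bsub>D i\<^esub>}}"
  "\<zero>\<^bsub>direct_sum R I D\<^esub> = (\<lambda>i\<in>I. \<zero>\<^bsub>D i\<^esub>)"
  "x \<oplus>\<^bsub>direct_sum R I D\<^esub> y = (\<lambda>i\<in>I. x i \<oplus>\<^bsub>D i\<^esub> y i)"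
  "a \<odot>\<^bsub>direct_sum R I D\<^esub> x = (\<lambda>i\<in>I. a \<odot>\<^bsub>D i\<^esub> x i)"
  by (simp_all add: direct_sum_def)

lemma direct_sum_component:
  assumes "i \<in> I"
  shows "\<zero>\<^bsub>direct_sum R I D\<^esub> i = \<zero>\<^bsub>D i\<^esub>"
    "(x \<oplus>\<^bsub>direct_sum R I D\<^esub> y) i = x i \<oplus>\<^bsub>D i\<^esub> y i"
    "(a \<odot>\<^bsub>direct_sum R I D\<^esub> x) i = a \<odot>\<^bsub>D i\<^esub> x i"
  using assms by (simp_all add: direct_sum_def)

definition summand :: "'i set \<Rightarrow> ('i \<Rightarrow> ('r, 'a, 'n) module_scheme) \<Rightarrow> 'i \<Rightarrow> 'a \<Rightarrow> 'i \<Rightarrow> 'a"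
  where "summand I D i x = (\<lambda>j\<in>I. if j = i then x else \<zero>\<^bsub>D j\<^esub>)"

text \<open>
  The map out of a direct sum with given components. The formula is that of \<open>cover_map\<close>, which is thereby
  an instance (\<open>cover_map_eq_cotuple\<close>).
\<close>

definition cotuple ::
    "('r, 'm) ring_scheme \<Rightarrow> 'i set \<Rightarrow> ('i \<Rightarrow> ('r, 'a, 'n) module_scheme)
      \<Rightarrow> ('r, 'b, 'k) module_scheme \<Rightarrow> ('i \<Rightarrow> 'a \<Rightarrow> 'b) \<Rightarrow> ('i \<Rightarrow> 'a) \<Rightarrow> 'b"
  where "cotuple R I D N u =
    (\<lambda>c\<in>carrier (direct_sum R I D). \<Oplus>\<^bsub>N\<^esub>i\<in>{i \<in> I. c i \<noteq> \<zero>\<^bsub>D i\<^esub>}. u i (c i))"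

locale module_family = ring R
  for R :: "('r, 'm) ring_scheme" (structure)
    and I :: "'i set" and D :: "'i \<Rightarrow> ('r, 'a, 'n) module_scheme" +
  assumes family: "i \<in> I \<Longrightarrow> left_module R (D i)"
begin

abbreviation "S \<equiv> direct_sum R I D"

lemma in_family: "x \<in> carrier S \<Longrightarrow> i \<in> I \<Longrightarrow> x i \<in> carrier (D i)"
  by (auto simp: direct_sum_simps)

lemma finite_support: "x \<in> carrier S \<Longrightarrow> finite {i \<in> I. x i \<noteq> \<zero>\<^bsub>D i\<^esub>}"
  by (simp add: direct_sum_simps)

lemma zero_component: "i \<in> I \<Longrightarrow> \<zero>\<^bsub>D i\<^esub> \<in> carrier (D i)"
  using family left_module.axioms(2) abelian_group.axioms(1) abelian_monoid.zero_closed by blast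

lemma direct_sumI:
  assumes "x \<in> extensional I" "\<And>i. i \<in> I \<Longrightarrow> x i \<in> carrier (D i)"
    "finite F" "\<And>i. i \<in> I - F \<Longrightarrow> x i = \<zero>\<^bsub>D i\<^esub>"
  shows "x \<in> carrier S"
proof -
  have "{i \<in> I. x i \<noteq> \<zero>\<^bsub>D i\<^esub>} \<subseteq> F" using assms(4) by blast
  then show ?thesis using assms by (auto simp: direct_sum_simps PiE_def intro: finite_subset)
qed

lemma direct_sum_eqI:
  assumes "x \<in> carrier S" "y \<in> carrier S" "\<And>i. i \<in> I \<Longrightarrow> x i = y i"
  shows "x = y"
  using assms by (auto simp: direct_sum_simps PiE_def intro: extensionalityI)

lemma left_module_direct_sum: "left_module R S"
proof (rule left_moduleI)
  show "ring R" by (rule ring_axioms)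
  have sm: "left_module R (D i)" if "i \<in> I" for i using family that .
  have ag: "abelian_group (D i)" if "i \<in> I" for i using sm[OF that] by (simp add: left_module_def)
  have am: "abelian_monoid (D i)" if "i \<in> I" for i using ag[OF that] by (simp add: abelian_group_def)
  show add: "x \<oplus>\<^bsub>S\<^esub> y \<in> carrier S" if "x \<in> carrier S" "y \<in> carrier S" for x y
  proof (rule direct_sumI)
    show "x \<oplus>\<^bsub>S\<^esub> y \<in> extensional I" by (simp add: direct_sum_simps(3))
    show "finite ({i \<in> I. x i \<noteq> \<zero>\<^bsub>D i\<^esub>} \<union> {i \<in> I. y i \<noteq> \<zero>\<^bsub>D i\<^esub>})"
      using that finite_support by simp
  qed (use that in_family in \<open>auto simp: direct_sum_component abelian_monoid.a_closed[OF am]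
        abelian_monoid.l_zero[OF am] zero_component\<close>)
  show zero: "\<zero>\<^bsub>S\<^esub> \<in> carrier S"
    by (rule direct_sumI[where F = "{}"]) (auto simp: direct_sum_simps(2) zero_component)
  have smult: "a \<odot>\<^bsub>S\<^esub> x \<in> carrier S" if "a \<in> carrier R" "x \<in> carrier S" for a x
    by (rule direct_sumI[OF _ _ finite_support[OF that(2)]])
      (use that in_family in \<open>auto simp: direct_sum_simps(4) left_module.smult_closed[OF sm]
        left_module.smult_zero[OF sm]\<close>)
  show "x \<oplus>\<^bsub>S\<^esub> y \<oplus>\<^bsub>S\<^esub> z = x \<oplus>\<^bsub>S\<^esub> (y \<oplus>\<^bsub>S\<^esub> z)"
    if "x \<in> carrier S" "y \<in> carrier S" "z \<in> carrier S" for x y z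
    by (rule direct_sum_eqI) (use that in_family add in
        \<open>auto simp: direct_sum_component abelian_monoid.a_assoc[OF am]\<close>)
  show "x \<oplus>\<^bsub>S\<^esub> y = y \<oplus>\<^bsub>S\<^esub> x" if "x \<in> carrier S" "y \<in> carrier S" for x y
    by (rule direct_sum_eqI) (use that in_family add in
        \<open>auto simp: direct_sum_component abelian_monoid.a_comm[OF am]\<close>)
  show "\<zero>\<^bsub>S\<^esub> \<oplus>\<^bsub>S\<^esub> x = x" if "x \<in> carrier S" for x
    by (rule direct_sum_eqI) (use that in_family add zero in
        \<open>auto simp: direct_sum_component abelian_monoid.l_zero[OF am]\<close>)
  show "\<exists>y\<in>carrier S. y \<oplus>\<^bsub>S\<^esub> x = \<zero>\<^bsub>S\<^esub>" if "x \<in> carrier S" for x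
  proof
    let ?y = "(\<ominus> \<one>) \<odot>\<^bsub>S\<^esub> x"
    show y: "?y \<in> carrier S" using smult that by simp
    show "?y \<oplus>\<^bsub>S\<^esub> x = \<zero>\<^bsub>S\<^esub>"
      by (rule direct_sum_eqI) (use that in_family add zero y in
        \<open>auto simp: direct_sum_component left_module.neg_one_smult[OF sm] abelian_group.l_neg[OF ag]\<close>)
  qed
  show "left_module_axioms R S"
  proof
    show "a \<odot>\<^bsub>S\<^esub> x \<in> carrier S" if "a \<in> carrier R" "x \<in> carrier S" for a x
      using smult that .
    show "(a \<oplus> b) \<odot>\<^bsub>S\<^esub> x = a \<odot>\<^bsub>S\<^esub> x \<oplus>\<^bsub>S\<^esub> b \<odot>\<^bsub>S\<^esub> x"
      if "a \<in> carrier R" "b \<in> carrier R" "x \<in> carrier S" for a b x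
      by (rule direct_sum_eqI) (use that in_family add smult in
        \<open>auto simp: direct_sum_component left_module.smult_l_distr[OF sm]\<close>)
    show "a \<odot>\<^bsub>S\<^esub> (x \<oplus>\<^bsub>S\<^esub> y) = a \<odot>\<^bsub>S\<^esub> x \<oplus>\<^bsub>S\<^esub> a \<odot>\<^bsub>S\<^esub> y"
      if "a \<in> carrier R" "x \<in> carrier S" "y \<in> carrier S" for a x y
      by (rule direct_sum_eqI) (use that in_family add smult in
        \<open>auto simp: direct_sum_component left_module.smult_r_distr[OF sm]\<close>)
    show "(a \<otimes> b) \<odot>\<^bsub>S\<^esub> x = a \<odot>\<^bsub>S\<^esub> (b \<odot>\<^bsub>S\<^esub> x)"
      if "a \<in> carrier R" "b \<in> carrier R" "x \<in> carrier S" for a b x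
      by (rule direct_sum_eqI) (use that in_family add smult in
        \<open>auto simp: direct_sum_component left_module.smult_assoc[OF sm]\<close>)
    show "\<one> \<odot>\<^bsub>S\<^esub> x = x" if "x \<in> carrier S" for x
      by (rule direct_sum_eqI) (use that in_family smult in
        \<open>auto simp: direct_sum_component left_module.smult_one[OF sm]\<close>)
  qed
qed

sublocale sum: left_module R S by (rule left_module_direct_sum)

lemma summand_component: "j \<in> I \<Longrightarrow> summand I D i x j = (if j = i then x else \<zero>\<^bsub>D j\<^esub>)"
  by (simp add: summand_def)

lemma linear_map_summand:
  assumes "i \<in> I"
  shows "linear_map R (D i) S (summand I D i)"
proof -
  interpret Di: left_module R "D i" using family assms .
  have sm: "left_module R (D j)" if "j \<in> I" for j using family that .
  have am: "abelian_monoid (D j)" if "j \<in> I" for j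
    using sm[OF that] by (simp add: left_module_def abelian_group_def)
  have cl: "summand I D i x \<in> carrier S" if "x \<in> carrier (D i)" for x
    by (rule direct_sumI[where F = "{i}"]) (use that zero_component in \<open>auto simp: summand_def\<close>)
  show ?thesis
  proof
    show "summand I D i (x \<oplus>\<^bsub>D i\<^esub> y) = summand I D i x \<oplus>\<^bsub>S\<^esub> summand I D i y"
      if "x \<in> carrier (D i)" "y \<in> carrier (D i)" for x y
      by (rule direct_sum_eqI) (use that in \<open>auto intro: cl simp: summand_component direct_sum_component
          abelian_monoid.l_zero[OF am] zero_component\<close>)
    show "summand I D i (a \<odot>\<^bsub>D i\<^esub> x) = a \<odot>\<^bsub>S\<^esub> summand I D i x"
      if "a \<in> carrier R" "x \<in> carrier (D i)" for a x
      by (rule direct_sum_eqI) (use that in \<open>auto intro: cl simp: summand_component direct_sum_component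
          left_module.smult_zero[OF sm]\<close>)
  qed (use cl in auto)
qed

lemma summand_closed: "i \<in> I \<Longrightarrow> x \<in> carrier (D i) \<Longrightarrow> summand I D i x \<in> carrier S"
  using linear_map.closed[OF linear_map_summand] .

lemma direct_sum_induct [consumes 1, case_names zero summand add]:
  assumes "p \<in> carrier S"
    and zero: "Q \<zero>\<^bsub>S\<^esub>"
    and summand: "\<And>i x. \<lbrakk>i \<in> I; x \<in> carrier (D i)\<rbrakk> \<Longrightarrow> Q (summand I D i x)"
    and add: "\<And>p p'. \<lbrakk>p \<in> carrier S; p' \<in> carrier S; Q p; Q p'\<rbrakk> \<Longrightarrow> Q (p \<oplus>\<^bsub>S\<^esub> p')"
  shows "Q p"
proof -
  have sm: "left_module R (D j)" if "j \<in> I" for j using family that .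
  have am: "abelian_monoid (D j)" if "j \<in> I" for j
    using sm[OF that] by (simp add: left_module_def abelian_group_def)
  have "\<forall>p\<in>carrier S. {i \<in> I. p i \<noteq> \<zero>\<^bsub>D i\<^esub>} \<subseteq> F \<longrightarrow> Q p" if "finite F" for F
    using that
  proof (induction F)
    case empty
    have "p = \<zero>\<^bsub>S\<^esub>" if "p \<in> carrier S" "{i \<in> I. p i \<noteq> \<zero>\<^bsub>D i\<^esub>} \<subseteq> {}" for p
      by (rule direct_sum_eqI) (use that in \<open>auto simp: direct_sum_component\<close>)
    then show ?case using zero by blast
  next
    case (insert a F)
    show ?case
    proof (intro ballI impI)
      fix p assume p: "p \<in> carrier S" "{i \<in> I. p i \<noteq> \<zero>\<^bsub>D i\<^esub>} \<subseteq> insert a F"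
      define p' where "p' = (\<lambda>j\<in>I. if j = a then \<zero>\<^bsub>D j\<^esub> else p j)"
      have p': "p' \<in> carrier S"
        by (rule direct_sumI[OF _ _ finite_support[OF p(1)]])
          (use in_family p zero_component in \<open>auto simp: p'_def\<close>)
      have "{i \<in> I. p' i \<noteq> \<zero>\<^bsub>D i\<^esub>} \<subseteq> F" using p(2) by (auto simp: p'_def)
      then have Qp': "Q p'" using insert.IH p' by blast
      show "Q p"
      proof (cases "a \<in> I")
        case True
        have "p = summand I D a (p a) \<oplus>\<^bsub>S\<^esub> p'"
          by (rule direct_sum_eqI) (use True p p' in_family in
              \<open>auto simp: summand_closed summand_component p'_def direct_sum_component
                abelian_monoid.l_zero[OF am] abelian_monoid.r_zero[OF am]\<close>)
        then show ?thesis
          using add[OF _ p' _ Qp'] summand_closed True summand in_family[OF p(1)] by metis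
      next
        case False
        have "p = p'"
          by (rule direct_sum_eqI) (use False p p' in \<open>auto simp: p'_def\<close>)
        then show ?thesis using Qp' by simp
      qed
    qed
  qed
  from this[OF finite_support[OF assms(1)]] assms(1) show ?thesis by blast
qed

lemma linear_maps_eqI:
  assumes h: "linear_map R S N h" and k: "linear_map R S N k"
    and eq: "\<And>i x. \<lbrakk>i \<in> I; x \<in> carrier (D i)\<rbrakk> \<Longrightarrow> h (summand I D i x) = k (summand I D i x)"
    and p: "p \<in> carrier S"
  shows "h p = k p"
  using p
proof (induction rule: direct_sum_induct)
  case zero
  then show ?case using linear_map.zero[OF h] linear_map.zero[OF k] by simp
next
  case (add p p')
  then show ?case using linear_map.add[OF h] linear_map.add[OF k] by simp
qed (rule eq)

lemma linear_map_into_submodule: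
  assumes h: "linear_map R S N h" and T: "submodule T R N"
    and mem: "\<And>i x. \<lbrakk>i \<in> I; x \<in> carrier (D i)\<rbrakk> \<Longrightarrow> h (summand I D i x) \<in> T"
    and p: "p \<in> carrier S"
  shows "h p \<in> T"
  using p
proof (induction rule: direct_sum_induct)
  case zero
  then show ?case using linear_map.zero[OF h] submodule_facts[OF T] by simp
next
  case (add p p')
  then show ?case using linear_map.add[OF h] submodule_facts[OF T] by simp
qed (rule mem)

end

locale cotuple_family = module_family R I D + cod: left_module R N
  for R :: "('r, 'm) ring_scheme" (structure) and I :: "'i set"
    and D :: "'i \<Rightarrow> ('r, 'a, 'n) module_scheme" and N :: "('r, 'b, 'k) module_scheme" +
  fixes u :: "'i \<Rightarrow> 'a \<Rightarrow> 'b"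
  assumes linear: "i \<in> I \<Longrightarrow> linear_map R (D i) N (u i)"
begin

lemma cotuple_eq:
  assumes "c \<in> carrier S" "finite F" "F \<subseteq> I" "\<And>i. i \<in> I - F \<Longrightarrow> c i = \<zero>\<^bsub>D i\<^esub>"
  shows "cotuple R I D N u c = (\<Oplus>\<^bsub>N\<^esub>i\<in>F. u i (c i))"
proof -
  have "(\<Oplus>\<^bsub>N\<^esub>i\<in>{i \<in> I. c i \<noteq> \<zero>\<^bsub>D i\<^esub>}. u i (c i)) = (\<Oplus>\<^bsub>N\<^esub>i\<in>F. u i (c i))"
  proof (rule cod.M.add.finprod_mono_neutral_cong_left)
    show "\<And>i. i \<in> F - {i \<in> I. c i \<noteq> \<zero>\<^bsub>D i\<^esub>} \<Longrightarrow> u i (c i) = \<zero>\<^bsub>N\<^esub>"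
      using assms(3) linear_map.zero[OF linear] by auto
    show "(\<lambda>i. u i (c i)) \<in> F \<rightarrow> carrier N"
      using assms(1,3) linear_map.closed[OF linear] in_family by auto
  qed (use assms in auto)
  then show ?thesis using assms(1) by (simp add: cotuple_def)
qed

sublocale linear_map R S N "cotuple R I D N u"
proof
  have cl: "u i x \<in> carrier N" if "i \<in> I" "x \<in> carrier (D i)" for i x
    using linear_map.closed[OF linear] that by blast
  show "cotuple R I D N u x \<in> carrier N" if "x \<in> carrier S" for x
    using that by (auto simp: cotuple_def intro!: cod.M.finsum_closed cl in_family)
  show "cotuple R I D N u (x \<oplus>\<^bsub>S\<^esub> y) = cotuple R I D N u x \<oplus>\<^bsub>N\<^esub> cotuple R I D N u y"
    if xy: "x \<in> carrier S" "y \<in> carrier S" for x y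
  proof -
    define F where "F = {i \<in> I. x i \<noteq> \<zero>\<^bsub>D i\<^esub>} \<union> {i \<in> I. y i \<noteq> \<zero>\<^bsub>D i\<^esub>}"
    have F: "finite F" "F \<subseteq> I" using xy finite_support by (auto simp: F_def)
    have am: "abelian_monoid (D j)" if "j \<in> I" for j
      using family[OF that] by (simp add: left_module_def abelian_group_def)
    have z: "(x \<oplus>\<^bsub>S\<^esub> y) i = \<zero>\<^bsub>D i\<^esub>" "x i = \<zero>\<^bsub>D i\<^esub>" "y i = \<zero>\<^bsub>D i\<^esub>" if "i \<in> I - F" for i
      using that by (auto simp: F_def direct_sum_component abelian_monoid.l_zero[OF am] zero_component)
    have "cotuple R I D N u (x \<oplus>\<^bsub>S\<^esub> y) = (\<Oplus>\<^bsub>N\<^esub>i\<in>F. u i ((x \<oplus>\<^bsub>S\<^esub> y) i))"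
      using xy F z by (intro cotuple_eq) auto
    also have "\<dots> = (\<Oplus>\<^bsub>N\<^esub>i\<in>F. u i (x i) \<oplus>\<^bsub>N\<^esub> u i (y i))"
      by (rule cod.M.finsum_cong')
        (use F xy in_family cl in \<open>auto simp: direct_sum_component subset_iff linear_map.add[OF linear]
          intro!: cod.M.a_closed\<close>)
    also have "\<dots> = (\<Oplus>\<^bsub>N\<^esub>i\<in>F. u i (x i)) \<oplus>\<^bsub>N\<^esub> (\<Oplus>\<^bsub>N\<^esub>i\<in>F. u i (y i))"
      by (rule cod.M.finsum_addf) (use F xy in_family cl in auto)
    also have "\<dots> = cotuple R I D N u x \<oplus>\<^bsub>N\<^esub> cotuple R I D N u y"
      using cotuple_eq[OF xy(1) F z(2)] cotuple_eq[OF xy(2) F z(3)] by simp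
    finally show ?thesis .
  qed
  show "cotuple R I D N u (a \<odot>\<^bsub>S\<^esub> x) = a \<odot>\<^bsub>N\<^esub> cotuple R I D N u x"
    if ax: "a \<in> carrier R" "x \<in> carrier S" for a x
  proof -
    define F where "F = {i \<in> I. x i \<noteq> \<zero>\<^bsub>D i\<^esub>}"
    have F: "finite F" "F \<subseteq> I" using ax finite_support by (auto simp: F_def)
    have z: "(a \<odot>\<^bsub>S\<^esub> x) i = \<zero>\<^bsub>D i\<^esub>" "x i = \<zero>\<^bsub>D i\<^esub>" if "i \<in> I - F" for i
      using that ax by (auto simp: F_def direct_sum_component left_module.smult_zero[OF family])
    have "cotuple R I D N u (a \<odot>\<^bsub>S\<^esub> x) = (\<Oplus>\<^bsub>N\<^esub>i\<in>F. u i ((a \<odot>\<^bsub>S\<^esub> x) i))"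
      using ax F z by (intro cotuple_eq) auto
    also have "\<dots> = (\<Oplus>\<^bsub>N\<^esub>i\<in>F. a \<odot>\<^bsub>N\<^esub> u i (x i))"
      by (rule cod.M.finsum_cong')
        (use F ax in_family cl in \<open>auto simp: direct_sum_component subset_iff linear_map.smult[OF linear]\<close>)
    also have "\<dots> = a \<odot>\<^bsub>N\<^esub> (\<Oplus>\<^bsub>N\<^esub>i\<in>F. u i (x i))"
      by (rule cod.smult_finsum[symmetric]) (use F ax in_family cl in auto)
    also have "\<dots> = a \<odot>\<^bsub>N\<^esub> cotuple R I D N u x"
      using cotuple_eq[OF ax(2) F z(2)] by simp
    finally show ?thesis .
  qed
qed

lemma linear_map_cotuple: "linear_map R S N (cotuple R I D N u)"
  by (rule linear_map_axioms)

lemma cotuple_summand: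
  assumes "i \<in> I" "x \<in> carrier (D i)"
  shows "cotuple R I D N u (summand I D i x) = u i x"
proof -
  have "cotuple R I D N u (summand I D i x) = (\<Oplus>\<^bsub>N\<^esub>j\<in>{i}. u j (summand I D i x j))"
    by (rule cotuple_eq) (use assms in \<open>auto simp: summand_closed summand_component\<close>)
  also have "\<dots> = u i x"
    using assms linear_map.closed[OF linear] cod.M.finsum_insert[of "{}" i "\<lambda>j. u j (summand I D i x j)"]
    by (simp add: summand_def)
  finally show ?thesis .
qed

end

lemma left_module_regular:
  assumes "ring R" shows "left_module R (regular_module R)"
proof -
  interpret ring R by fact
  show ?thesis
    by (rule left_moduleI)
      (auto simp: regular_module_def left_module_axioms_def ring_axioms l_distr r_distr m_assoc
        intro: a_assoc a_comm l_neg)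
qed

text \<open>
  Any map whose fibres are the cosets of \<open>N\<close> carries the module structure of the quotient onto its image.
  This builds quotients on a prescribed type of elements.
\<close>

lemma (in left_module) quotient_realisation:
  fixes q :: "'a \<Rightarrow> 'v"
  assumes N: "submodule N R M"
    and q: "\<And>x y. \<lbrakk>x \<in> carrier M; y \<in> carrier M\<rbrakk> \<Longrightarrow> q x = q y \<longleftrightarrow> x \<ominus>\<^bsub>M\<^esub> y \<in> N"
  shows "\<exists>Q :: ('r, 'v) module. linear_map R M Q q \<and> carrier Q = q ` carrier M"
proof -
  define s where "s = inv_into (carrier M) q"
  define Q :: "('r, 'v) module" where
    "Q = \<lparr>carrier = q ` carrier M, monoid.mult = undefined, one = undefined,
      ring.zero = q \<zero>\<^bsub>M\<^esub>, ring.add = (\<lambda>x y. q (s x \<oplus>\<^bsub>M\<^esub> s y)),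
      module.smult = (\<lambda>a x. q (a \<odot>\<^bsub>M\<^esub> s x))\<rparr>"
  note Nf = submodule_facts[OF N]
  have s: "s (q x) \<in> carrier M" "s (q x) \<ominus>\<^bsub>M\<^esub> x \<in> N" if "x \<in> carrier M" for x
  proof -
    show "s (q x) \<in> carrier M" using that by (simp add: s_def inv_into_into)
    moreover have "q (s (q x)) = q x" using that by (simp add: s_def f_inv_into_f)
    ultimately show "s (q x) \<ominus>\<^bsub>M\<^esub> x \<in> N" using q that by blast
  qed
  have add: "q x \<oplus>\<^bsub>Q\<^esub> q y = q (x \<oplus>\<^bsub>M\<^esub> y)" if "x \<in> carrier M" "y \<in> carrier M" for x y
  proof -
    have "(s (q x) \<oplus>\<^bsub>M\<^esub> s (q y)) \<ominus>\<^bsub>M\<^esub> (x \<oplus>\<^bsub>M\<^esub> y) =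
        (s (q x) \<ominus>\<^bsub>M\<^esub> x) \<oplus>\<^bsub>M\<^esub> (s (q y) \<ominus>\<^bsub>M\<^esub> y)"
      using that s by (simp add: a_minus_def M.minus_add M.add.m_ac)
    then show ?thesis using that s Nf(3) by (simp add: Q_def q)
  qed
  have smult: "a \<odot>\<^bsub>Q\<^esub> q x = q (a \<odot>\<^bsub>M\<^esub> x)" if "a \<in> carrier R" "x \<in> carrier M" for a x
    using that s Nf(4) by (simp add: Q_def q smult_minus[symmetric])
  have Q: "left_module R Q"
  proof (rule left_moduleI)
    show "\<exists>y\<in>carrier Q. y \<oplus>\<^bsub>Q\<^esub> x = \<zero>\<^bsub>Q\<^esub>" if x: "x \<in> carrier Q" for x
    proof -
      obtain x' where x': "x = q x'" "x' \<in> carrier M" using x by (auto simp: Q_def)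
      then have "q (\<ominus>\<^bsub>M\<^esub> x') \<oplus>\<^bsub>Q\<^esub> x = \<zero>\<^bsub>Q\<^esub>" by (simp add: add M.l_neg) (simp add: Q_def)
      moreover have "q (\<ominus>\<^bsub>M\<^esub> x') \<in> carrier Q" using x' by (simp add: Q_def)
      ultimately show ?thesis by blast
    qed
    have c: "carrier Q = q ` carrier M" "\<zero>\<^bsub>Q\<^esub> = q \<zero>\<^bsub>M\<^esub>" by (simp_all add: Q_def)
    show "left_module_axioms R Q"
      by standard (auto simp: c add smult smult_l_distr smult_r_distr smult_assoc)
    show "x \<oplus>\<^bsub>Q\<^esub> y = y \<oplus>\<^bsub>Q\<^esub> x" if "x \<in> carrier Q" "y \<in> carrier Q" for x y
      using that by (auto simp: c add M.a_comm)
    show "x \<oplus>\<^bsub>Q\<^esub> y \<oplus>\<^bsub>Q\<^esub> z = x \<oplus>\<^bsub>Q\<^esub> (y \<oplus>\<^bsub>Q\<^esub> z)"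
      if "x \<in> carrier Q" "y \<in> carrier Q" "z \<in> carrier Q" for x y z
      using that by (auto simp: c add M.a_assoc)
    show "x \<oplus>\<^bsub>Q\<^esub> y \<in> carrier Q" if "x \<in> carrier Q" "y \<in> carrier Q" for x y
      using that by (auto simp: c add)
    show "\<zero>\<^bsub>Q\<^esub> \<in> carrier Q" by (simp add: c)
    show "\<zero>\<^bsub>Q\<^esub> \<oplus>\<^bsub>Q\<^esub> x = x" if "x \<in> carrier Q" for x
      using that by (auto simp: c add)
    show "ring R" by (rule R.ring_axioms)
  qed
  have "linear_map R M Q q"
    by (intro linear_map.intro Q left_module_axioms linear_map_axioms.intro)
      (simp_all add: add smult, simp add: Q_def)
  then show ?thesis by (intro exI[of _ Q]) (simp add: Q_def)
qed

section \<open>Vanishing of Ext as an extension property\<close>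

lemma linear_map_descend:
  assumes t: "linear_map R Q B t" "t ` carrier Q = carrier B"
    and w: "linear_map R Q Y w"
    and ker: "\<And>x. \<lbrakk>x \<in> carrier Q; t x = \<zero>\<^bsub>B\<^esub>\<rbrakk> \<Longrightarrow> w x = \<zero>\<^bsub>Y\<^esub>"
  obtains v where "linear_map R B Y v" "\<And>x. x \<in> carrier Q \<Longrightarrow> v (t x) = w x"
proof -
  interpret t: linear_map R Q B t by fact
  interpret w: linear_map R Q Y w by fact
  define s where "s = inv_into (carrier Q) t"
  have s: "s b \<in> carrier Q" "t (s b) = b" if "b \<in> carrier B" for b
    using that t(2) by (simp_all add: s_def inv_into_into f_inv_into_f)
  have eq: "w x = w y" if "x \<in> carrier Q" "y \<in> carrier Q" "t x = t y" for x y
  proof -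
    have "w (x \<ominus>\<^bsub>Q\<^esub> y) = \<zero>\<^bsub>Y\<^esub>"
      using that by (intro ker) (simp_all add: t.minus t.cod.minus_eq_zero_iff)
    then show ?thesis using that by (simp add: w.minus w.cod.minus_eq_zero_iff)
  qed
  have ws: "w (s (t x)) = w x" if "x \<in> carrier Q" for x
    using that s by (intro eq) auto
  have ws': "w (s b) = w x" if "x \<in> carrier Q" "t x = b" for x b
    using ws that by blast
  show ?thesis
  proof
    show "linear_map R B Y (\<lambda>b. w (s b))"
    proof
      show "w (s (x \<oplus>\<^bsub>B\<^esub> y)) = w (s x) \<oplus>\<^bsub>Y\<^esub> w (s y)" if "x \<in> carrier B" "y \<in> carrier B" for x y
        using that s ws'[of "s x \<oplus>\<^bsub>Q\<^esub> s y"] by (simp add: t.add w.add)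
      show "w (s (a \<odot>\<^bsub>B\<^esub> x)) = a \<odot>\<^bsub>Y\<^esub> w (s x)" if "a \<in> carrier R" "x \<in> carrier B" for a x
        using that s ws'[of "a \<odot>\<^bsub>Q\<^esub> s x"] by (simp add: t.smult w.smult)
    qed (use s in auto)
  qed (rule ws)
qed

definition prod_module ::
    "('r, 'm) ring_scheme \<Rightarrow> ('r, 'a, 'n) module_scheme \<Rightarrow> ('r, 'b, 'k) module_scheme \<Rightarrow> ('r, 'a \<times> 'b) module"
  where "prod_module R A B =
    \<lparr>carrier = carrier A \<times> carrier B, monoid.mult = undefined, one = undefined,
     ring.zero = (\<zero>\<^bsub>A\<^esub>, \<zero>\<^bsub>B\<^esub>),
     ring.add = (\<lambda>x y. (fst x \<oplus>\<^bsub>A\<^esub> fst y, snd x \<oplus>\<^bsub>B\<^esub> snd y)),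
     module.smult = (\<lambda>a x. (a \<odot>\<^bsub>A\<^esub> fst x, a \<odot>\<^bsub>B\<^esub> snd x))\<rparr>"

lemma prod_module_simps [simp]:
  "carrier (prod_module R A B) = carrier A \<times> carrier B"
  "\<zero>\<^bsub>prod_module R A B\<^esub> = (\<zero>\<^bsub>A\<^esub>, \<zero>\<^bsub>B\<^esub>)"
  "x \<oplus>\<^bsub>prod_module R A B\<^esub> y = (fst x \<oplus>\<^bsub>A\<^esub> fst y, snd x \<oplus>\<^bsub>B\<^esub> snd y)"
  "a \<odot>\<^bsub>prod_module R A B\<^esub> x = (a \<odot>\<^bsub>A\<^esub> fst x, a \<odot>\<^bsub>B\<^esub> snd x)"
  by (simp_all add: prod_module_def)

lemma left_module_prod:
  assumes "left_module R A" "left_module R B"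
  shows "left_module R (prod_module R A B)"
proof -
  interpret A: left_module R A by fact
  interpret B: left_module R B by fact
  show ?thesis
  proof (rule left_moduleI)
    show "ring R" by (rule A.R.ring_axioms)
    show "left_module_axioms R (prod_module R A B)"
      by standard (auto simp: A.smult_l_distr B.smult_l_distr A.smult_r_distr B.smult_r_distr
          A.smult_assoc B.smult_assoc)
    show "\<exists>y\<in>carrier (prod_module R A B). y \<oplus>\<^bsub>prod_module R A B\<^esub> x = \<zero>\<^bsub>prod_module R A B\<^esub>"
      if "x \<in> carrier (prod_module R A B)" for x
      using that by (intro bexI[of _ "(\<ominus>\<^bsub>A\<^esub> fst x, \<ominus>\<^bsub>B\<^esub> snd x)"]) (auto simp: A.M.l_neg B.M.l_neg)
  qed (auto simp: A.M.a_assoc B.M.a_assoc intro: A.M.a_comm B.M.a_comm)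
qed

lemma linear_map_fst:
  assumes "left_module R A" "left_module R B" shows "linear_map R (prod_module R A B) A fst"
proof -
  interpret A: left_module R A by fact
  interpret P: left_module R "prod_module R A B" using left_module_prod assms .
  show ?thesis by unfold_locales auto
qed

lemma linear_map_snd:
  assumes "left_module R A" "left_module R B" shows "linear_map R (prod_module R A B) B snd"
proof -
  interpret B: left_module R B by fact
  interpret P: left_module R "prod_module R A B" using left_module_prod assms .
  show ?thesis by unfold_locales auto
qed

lemma linear_map_Pair:
  assumes "linear_map R M A h" "linear_map R M B k"
  shows "linear_map R M (prod_module R A B) (\<lambda>x. (h x, k x))"
proof -
  interpret h: linear_map R M A h by fact
  interpret k: linear_map R M B k by fact
  interpret P: left_module R "prod_module R A B"
    by (rule left_module_prod) unfold_locales
  show ?thesis by unfold_locales (auto simp: h.add h.smult k.add k.smult)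
qed

context left_module
begin

lemma module_family_regular: "module_family R I (\<lambda>_. regular_module R)"
  by (intro module_family.intro module_family_axioms.intro R.ring_axioms
      left_module_regular[OF R.ring_axioms])

lemma linear_map_orbit:
  assumes "x \<in> carrier M" shows "linear_map R (regular_module R) M (\<lambda>r. r \<odot>\<^bsub>M\<^esub> x)"
proof -
  interpret reg: left_module R "regular_module R" by (rule left_module_regular[OF R.ring_axioms])
  show ?thesis
    by unfold_locales (use assms in \<open>auto simp: regular_module_def smult_l_distr smult_assoc\<close>)
qed

text \<open>The universal property of the free module on \<open>A\<close>.\<close>

lemma free_extension:
  assumes "\<And>x. x \<in> A \<Longrightarrow> e x \<in> carrier M"
  defines "p \<equiv> cotuple R A (\<lambda>_. regular_module R) M (\<lambda>x r. r \<odot>\<^bsub>M\<^esub> e x)"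
  shows "linear_map R (direct_sum R A (\<lambda>_. regular_module R)) M p"
    and "\<And>x r. \<lbrakk>x \<in> A; r \<in> carrier R\<rbrakk> \<Longrightarrow> p (summand A (\<lambda>_. regular_module R) x r) = r \<odot>\<^bsub>M\<^esub> e x"
proof -
  interpret cotuple_family R A "\<lambda>_. regular_module R" M "\<lambda>x r. r \<odot>\<^bsub>M\<^esub> e x"
    by (intro cotuple_family.intro module_family_regular left_module_axioms cotuple_family_axioms.intro
        linear_map_orbit assms)
  show "linear_map R (direct_sum R A (\<lambda>_. regular_module R)) M p"
    unfolding p_def by (rule linear_map_axioms)
  show "p (summand A (\<lambda>_. regular_module R) x r) = r \<odot>\<^bsub>M\<^esub> e x" if "x \<in> A" "r \<in> carrier R" for x r
    unfolding p_def using that by (intro cotuple_summand) (auto simp: regular_module_def)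
qed

lemma cover_map_eq_cotuple:
  "cover_map R M = cotuple R (carrier M) (\<lambda>_. regular_module R) M (\<lambda>x r. r \<odot>\<^bsub>M\<^esub> x)"
  by (simp add: cover_map_def cotuple_def free_cover_def regular_module_def)

lemma left_module_free_cover: "left_module R (free_cover R M)"
  unfolding free_cover_def using module_family.left_module_direct_sum[OF module_family_regular] .

lemma linear_map_cover: "linear_map R (free_cover R M) M (cover_map R M)"
  unfolding cover_map_eq_cotuple free_cover_def by (rule free_extension(1)) simp

lemma cover_map_surj: "cover_map R M ` carrier (free_cover R M) = carrier M"
proof
  show "cover_map R M ` carrier (free_cover R M) \<subseteq> carrier M"
    using linear_map.closed[OF linear_map_cover] by auto
  have "x \<in> cover_map R M ` carrier (free_cover R M)" if x: "x \<in> carrier M" for x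
  proof (rule image_eqI)
    let ?b = "summand (carrier M) (\<lambda>_. regular_module R) x \<one>\<^bsub>R\<^esub>"
    show "x = cover_map R M ?b"
      unfolding cover_map_eq_cotuple using free_extension(2)[of "carrier M" "\<lambda>x. x" x "\<one>\<^bsub>R\<^esub>"] x by simp
    show "?b \<in> carrier (free_cover R M)"
      unfolding free_cover_def
      by (rule module_family.summand_closed[OF module_family_regular x]) (simp add: regular_module_def)
  qed
  then show "carrier M \<subseteq> cover_map R M ` carrier (free_cover R M)" by blast
qed

lemma submodule_syzygy: "submodule (carrier (syzygy R M)) R (free_cover R M)"
  using linear_map.submodule_kernel[OF linear_map_cover] by (simp add: syzygy_def)

lemma left_module_syzygy: "left_module R (syzygy R M)"
  using left_module.left_module_submodule[OF left_module_free_cover submodule_syzygy]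
  by (simp add: syzygy_def)

lemma carrier_syzygy:
  "carrier (syzygy R M) = {c \<in> carrier (free_cover R M). cover_map R M c = \<zero>\<^bsub>M\<^esub>}"
  by (simp add: syzygy_def)

lemma zero_syzygy: "\<zero>\<^bsub>syzygy R M\<^esub> = \<zero>\<^bsub>free_cover R M\<^esub>"
  by (simp add: syzygy_def)

lemma linear_map_syzygy_inclusion: "linear_map R (syzygy R M) (free_cover R M) (\<lambda>c. c)"
  using linear_map_inclusion[OF left_module_free_cover submodule_syzygy] by (simp add: syzygy_def)

end

lemma comm_group_hom_group:
  assumes "left_module R A" "left_module R Y"
  shows "comm_group (hom_group R A Y)"
proof (rule comm_groupI)
  interpret A: left_module R A by fact
  interpret Y: left_module R Y by fact
  have lin: "linear_map R A Y h" if "h \<in> mod_hom R A Y" for h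
    using linear_map_mod_hom[OF assms that] .
  have ext: "h \<in> extensional (carrier A)" if "h \<in> mod_hom R A Y" for h
    using that by (auto simp: mod_hom_def PiE_def)
  have cl: "h x \<in> carrier Y" if "h \<in> mod_hom R A Y" "x \<in> carrier A" for h x
    using linear_map.closed[OF lin] that by blast
  let ?G = "hom_group R A Y"
  have car: "carrier ?G = mod_hom R A Y" by (simp add: hom_group_def)
  show "f \<otimes>\<^bsub>?G\<^esub> g \<in> carrier ?G" if "f \<in> carrier ?G" "g \<in> carrier ?G" for f g
    using linear_map.mod_hom_restrict[OF linear_map_add[OF lin lin]] that
    by (simp add: hom_group_def)
  show "f \<otimes>\<^bsub>?G\<^esub> g \<otimes>\<^bsub>?G\<^esub> h = f \<otimes>\<^bsub>?G\<^esub> (g \<otimes>\<^bsub>?G\<^esub> h)"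
    if "f \<in> carrier ?G" "g \<in> carrier ?G" "h \<in> carrier ?G" for f g h
    using cl that unfolding car by (auto simp: hom_group_def Y.M.a_assoc intro!: restrict_ext)
  show "f \<otimes>\<^bsub>?G\<^esub> g = g \<otimes>\<^bsub>?G\<^esub> f" if "f \<in> carrier ?G" "g \<in> carrier ?G" for f g
    using cl that unfolding car by (auto simp: hom_group_def intro!: restrict_ext Y.M.a_comm)
  show "\<one>\<^bsub>?G\<^esub> \<in> carrier ?G"
    using linear_map.mod_hom_restrict[OF linear_map_zero[OF assms]] by (simp add: hom_group_def)
  show "\<one>\<^bsub>?G\<^esub> \<otimes>\<^bsub>?G\<^esub> f = f" if "f \<in> carrier ?G" for f
    using cl ext that unfolding car
    by (intro extensionalityI[where A = "carrier A"]) (auto simp: hom_group_def)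
  show "\<exists>g\<in>carrier ?G. g \<otimes>\<^bsub>?G\<^esub> f = \<one>\<^bsub>?G\<^esub>" if "f \<in> carrier ?G" for f
    using linear_map.mod_hom_restrict[OF linear_map_neg[OF lin]] cl that unfolding car
    by (intro bexI[of _ "\<lambda>x\<in>carrier A. \<ominus>\<^bsub>Y\<^esub> f x"])
      (auto simp: hom_group_def Y.M.l_neg intro!: restrict_ext)
qed

lemma trivial_Mod_iff:
  assumes G: "comm_group G" and H: "H \<subseteq> Z" "subgroup Z G" "subgroup H G"
  shows "trivial_group (G\<lparr>carrier := Z\<rparr> Mod H) \<longleftrightarrow> Z \<subseteq> H"
proof -
  interpret G: comm_group G by fact
  interpret Z: comm_group "G\<lparr>carrier := Z\<rparr>"
  proof (rule group.group_comm_groupI)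
    show "group (G\<lparr>carrier := Z\<rparr>)" using subgroup.subgroup_is_group[OF H(2) G.is_group] .
  qed (use subgroup.mem_carrier[OF H(2)] in \<open>auto intro: G.m_comm\<close>)
  have sub: "subgroup H (G\<lparr>carrier := Z\<rparr>)"
    using G.subgroup_incl[OF H(3,2,1)] .
  then have norm: "H \<lhd> G\<lparr>carrier := Z\<rparr>" by (rule Z.subgroup_imp_normal)
  have grp: "group (G\<lparr>carrier := Z\<rparr> Mod H)" by (rule normal.factorgroup_is_group[OF norm])
  show ?thesis
  proof
    assume triv: "trivial_group (G\<lparr>carrier := Z\<rparr> Mod H)"
    show "Z \<subseteq> H"
    proof
      fix z assume z: "z \<in> Z"
      have "H #>\<^bsub>G\<lparr>carrier := Z\<rparr>\<^esub> z \<in> carrier (G\<lparr>carrier := Z\<rparr> Mod H)"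
        using z by (auto simp: FactGroup_def RCOSETS_def)
      then have "H #>\<^bsub>G\<lparr>carrier := Z\<rparr>\<^esub> z = H"
        using triv by (auto simp: trivial_group_def FactGroup_def)
      then show "z \<in> H" using Z.coset_join1[OF _ _ sub, of z] z sub
        by (simp add: subgroup.subset)
    qed
  next
    assume "Z \<subseteq> H"
    then have "carrier (G\<lparr>carrier := Z\<rparr> Mod H) \<subseteq> {\<one>\<^bsub>G\<lparr>carrier := Z\<rparr> Mod H\<^esub>}"
      using Z.coset_join2[OF _ sub] by (auto simp: FactGroup_def RCOSETS_def)
    then show "trivial_group (G\<lparr>carrier := Z\<rparr> Mod H)"
      using group.trivial_group_subset[OF grp] by simp
  qed
qed

context left_module
begin

text \<open>
  With \<open>F\<close> the free cover of \<open>M\<close> and \<open>K\<close> the syzygy, a cocycle vanishes on the kernel of the cover of \<open>K\<close>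
  and so is the same thing as a homomorphism \<open>K \<rightarrow> Y\<close>, while the coboundaries correspond to the
  homomorphisms that extend to \<open>F\<close>.
\<close>

lemma Ext1_trivial_iff:
  assumes Y: "left_module R Y"
  shows "trivial_group (Ext1 R M Y) \<longleftrightarrow>
    (\<forall>g. linear_map R (syzygy R M) Y g \<longrightarrow>
      (\<exists>g'. linear_map R (free_cover R M) Y g' \<and> (\<forall>k\<in>carrier (syzygy R M). g' k = g k)))"
proof -
  let ?F = "free_cover R M" and ?K = "syzygy R M"
  let ?FK = "free_cover R (syzygy R M)" and ?KK = "syzygy R (syzygy R M)"
  let ?Z = "ext1_cocycles R M Y" and ?B = "ext1_coboundaries R M Y"
  interpret Y: left_module R Y by (rule Y)
  interpret K: left_module R ?K by (rule left_module_syzygy)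
  interpret KK: left_module R ?KK by (rule K.left_module_syzygy)
  interpret G: comm_group "hom_group R ?FK Y"
    by (rule comm_group_hom_group[OF K.left_module_free_cover Y])
  have cov: "linear_map R ?FK ?K (cover_map R ?K)" by (rule K.linear_map_cover)
  have cov': "linear_map R ?FK ?F (cover_map R ?K)"
    using linear_map_comp[OF cov linear_map_syzygy_inclusion] .
  have Z_iff: "f \<in> ?Z \<longleftrightarrow> f \<in> mod_hom R ?FK Y \<and>
      (\<forall>c\<in>carrier ?FK. cover_map R ?K c = \<zero>\<^bsub>?K\<^esub> \<longrightarrow> f c = \<zero>\<^bsub>Y\<^esub>)" for f
  proof -
    have "(\<forall>c\<in>carrier (free_cover R ?KK). f (cover_map R ?KK c) = \<zero>\<^bsub>Y\<^esub>) \<longleftrightarrow>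
        (\<forall>c\<in>cover_map R ?KK ` carrier (free_cover R ?KK). f c = \<zero>\<^bsub>Y\<^esub>)"
      by blast
    then show ?thesis
      unfolding ext1_cocycles_def KK.cover_map_surj by (auto simp: K.carrier_syzygy)
  qed
  have B_iff: "f \<in> ?B \<longleftrightarrow> f \<in> extensional (carrier ?FK) \<and>
      (\<exists>g. linear_map R ?F Y g \<and> (\<forall>c\<in>carrier ?FK. f c = g (cover_map R ?K c)))" for f
  proof
    assume "f \<in> ?B"
    then show "f \<in> extensional (carrier ?FK) \<and>
        (\<exists>g. linear_map R ?F Y g \<and> (\<forall>c\<in>carrier ?FK. f c = g (cover_map R ?K c)))"
      unfolding ext1_coboundaries_def using linear_map_mod_hom[OF left_module_free_cover Y] by fastforce
  next
    assume "f \<in> extensional (carrier ?FK) \<and>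
        (\<exists>g. linear_map R ?F Y g \<and> (\<forall>c\<in>carrier ?FK. f c = g (cover_map R ?K c)))"
    then obtain g where f: "f \<in> extensional (carrier ?FK)" and g: "linear_map R ?F Y g"
      and fg: "\<And>c. c \<in> carrier ?FK \<Longrightarrow> f c = g (cover_map R ?K c)" by blast
    have "f = (\<lambda>c\<in>carrier ?FK. restrict g (carrier ?F) (cover_map R ?K c))"
      using linear_map.closed[OF cov'] by (intro extensionalityI[OF f]) (auto simp: fg)
    then show "f \<in> ?B"
      unfolding ext1_coboundaries_def using linear_map.mod_hom_restrict[OF g] by blast
  qed
  have mh: "f \<in> mod_hom R ?FK Y \<longleftrightarrow> f \<in> extensional (carrier ?FK) \<and> linear_map R ?FK Y f" for f
    using linear_map_mod_hom[OF K.left_module_free_cover Y, of f] linear_map.mod_hom_restrict[of R ?FK Y f]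
    by (auto simp: extensional_restrict) (auto simp: mod_hom_def PiE_def)
  have BZ: "?B \<subseteq> ?Z"
  proof
    fix f assume "f \<in> ?B"
    then obtain g where f: "f \<in> extensional (carrier ?FK)" and g: "linear_map R ?F Y g"
      and fg: "\<And>c. c \<in> carrier ?FK \<Longrightarrow> f c = g (cover_map R ?K c)" using B_iff by blast
    have "linear_map R ?FK Y f"
      using linear_map_cong[OF linear_map_comp[OF cov' g]] fg by blast
    then show "f \<in> ?Z"
      using f fg linear_map.zero[OF g] by (auto simp: Z_iff mh zero_syzygy)
  qed
  have inv: "inv\<^bsub>hom_group R ?FK Y\<^esub> f = (\<lambda>x\<in>carrier ?FK. \<ominus>\<^bsub>Y\<^esub> f x)" if "f \<in> mod_hom R ?FK Y" for f
  proof (rule G.inv_equality)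
    have f: "linear_map R ?FK Y f" using that by (simp add: mh)
    show "(\<lambda>x\<in>carrier ?FK. \<ominus>\<^bsub>Y\<^esub> f x) \<in> carrier (hom_group R ?FK Y)"
      using linear_map.mod_hom_restrict[OF linear_map_neg[OF f]] by (simp add: hom_group_def)
    show "(\<lambda>x\<in>carrier ?FK. \<ominus>\<^bsub>Y\<^esub> f x) \<otimes>\<^bsub>hom_group R ?FK Y\<^esub> f = \<one>\<^bsub>hom_group R ?FK Y\<^esub>"
      using linear_map.closed[OF f] by (auto simp: hom_group_def Y.M.l_neg intro!: restrict_ext)
    show "f \<in> carrier (hom_group R ?FK Y)" using that by (simp add: hom_group_def)
  qed
  have subZ: "subgroup ?Z (hom_group R ?FK Y)"
  proof (rule G.subgroupI)
    show "?Z \<subseteq> carrier (hom_group R ?FK Y)" by (auto simp: Z_iff hom_group_def)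
    have "(\<lambda>x\<in>carrier ?FK. \<zero>\<^bsub>Y\<^esub>) \<in> ?Z"
      using linear_map.mod_hom_restrict[OF linear_map_zero[OF K.left_module_free_cover Y]]
      by (auto simp: Z_iff)
    then show "?Z \<noteq> {}" by blast
    show "inv\<^bsub>hom_group R ?FK Y\<^esub> f \<in> ?Z" if "f \<in> ?Z" for f
      using that linear_map.mod_hom_restrict[OF linear_map_neg, of R ?FK Y f]
      by (auto simp: Z_iff inv mh)
    show "f \<otimes>\<^bsub>hom_group R ?FK Y\<^esub> g \<in> ?Z" if "f \<in> ?Z" "g \<in> ?Z" for f g
      using that linear_map.mod_hom_restrict[OF linear_map_add, of R ?FK Y f g]
      by (auto simp: Z_iff mh hom_group_def)
  qed
  have subB: "subgroup ?B (hom_group R ?FK Y)"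
  proof (rule G.subgroupI)
    show "?B \<subseteq> carrier (hom_group R ?FK Y)" using BZ by (auto simp: Z_iff hom_group_def)
    show "?B \<noteq> {}"
      using linear_map.mod_hom_restrict[OF linear_map_zero[OF left_module_free_cover Y]]
      unfolding ext1_coboundaries_def by blast
    show "inv\<^bsub>hom_group R ?FK Y\<^esub> f \<in> ?B" if f: "f \<in> ?B" for f
    proof -
      obtain g where g: "linear_map R ?F Y g"
        and fg: "\<And>c. c \<in> carrier ?FK \<Longrightarrow> f c = g (cover_map R ?K c)" using f B_iff by blast
      have "f \<in> mod_hom R ?FK Y" using f BZ Z_iff by blast
      then show ?thesis
        using linear_map_neg[OF g] fg by (auto simp: B_iff inv intro!: exI[of _ "\<lambda>x. \<ominus>\<^bsub>Y\<^esub> g x"])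
    qed
    show "f1 \<otimes>\<^bsub>hom_group R ?FK Y\<^esub> f2 \<in> ?B" if f: "f1 \<in> ?B" "f2 \<in> ?B" for f1 f2
    proof -
      obtain g1 g2 where g: "linear_map R ?F Y g1" "linear_map R ?F Y g2"
        and fg: "\<And>c. c \<in> carrier ?FK \<Longrightarrow> f1 c = g1 (cover_map R ?K c)"
          "\<And>c. c \<in> carrier ?FK \<Longrightarrow> f2 c = g2 (cover_map R ?K c)" using f B_iff by blast
      then show ?thesis
        using linear_map_add[OF g]
        by (auto simp: B_iff hom_group_def intro!: exI[of _ "\<lambda>x. g1 x \<oplus>\<^bsub>Y\<^esub> g2 x"])
    qed
  qed
  have "trivial_group (Ext1 R M Y) \<longleftrightarrow> ?Z \<subseteq> ?B"
    unfolding Ext1_def using trivial_Mod_iff[OF G.comm_group_axioms BZ subZ subB] .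
  also have "\<dots> \<longleftrightarrow> (\<forall>g. linear_map R ?K Y g \<longrightarrow>
      (\<exists>g'. linear_map R ?F Y g' \<and> (\<forall>k\<in>carrier ?K. g' k = g k)))"
  proof
    assume *: "?Z \<subseteq> ?B"
    show "\<forall>g. linear_map R ?K Y g \<longrightarrow>
      (\<exists>g'. linear_map R ?F Y g' \<and> (\<forall>k\<in>carrier ?K. g' k = g k))"
    proof (intro allI impI)
      fix g assume g: "linear_map R ?K Y g"
      define f where "f = (\<lambda>c\<in>carrier ?FK. g (cover_map R ?K c))"
      have "f \<in> ?Z"
        using linear_map.mod_hom_restrict[OF linear_map_comp[OF cov g]] linear_map.zero[OF g]
        by (auto simp: Z_iff f_def)
      with * obtain g' where g': "linear_map R ?F Y g'"
        and eq: "\<And>c. c \<in> carrier ?FK \<Longrightarrow> f c = g' (cover_map R ?K c)" using B_iff by blast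
      have "g' k = g k" if "k \<in> carrier ?K" for k
      proof -
        have "k \<in> cover_map R ?K ` carrier ?FK" using that by (simp add: K.cover_map_surj)
        then obtain c where "c \<in> carrier ?FK" "k = cover_map R ?K c" by (rule imageE)
        then show ?thesis using eq[of c] by (simp add: f_def)
      qed
      with g' show "\<exists>g'. linear_map R ?F Y g' \<and> (\<forall>k\<in>carrier ?K. g' k = g k)" by blast
    qed
  next
    assume *: "\<forall>g. linear_map R ?K Y g \<longrightarrow>
      (\<exists>g'. linear_map R ?F Y g' \<and> (\<forall>k\<in>carrier ?K. g' k = g k))"
    show "?Z \<subseteq> ?B"
    proof
      fix f assume "f \<in> ?Z"
      then have f: "f \<in> extensional (carrier ?FK)" "linear_map R ?FK Y f"
        and f0: "\<And>c. \<lbrakk>c \<in> carrier ?FK; cover_map R ?K c = \<zero>\<^bsub>?K\<^esub>\<rbrakk> \<Longrightarrow> f c = \<zero>\<^bsub>Y\<^esub>"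
        by (auto simp: Z_iff mh)
      obtain g where g: "linear_map R ?K Y g" "\<And>c. c \<in> carrier ?FK \<Longrightarrow> g (cover_map R ?K c) = f c"
        using linear_map_descend[OF cov K.cover_map_surj f(2) f0] by blast
      with * obtain g' where "linear_map R ?F Y g'" "\<forall>k\<in>carrier ?K. g' k = g k" by blast
      then show "f \<in> ?B" using f(1) g(2) linear_map.closed[OF cov] by (auto simp: B_iff)
    qed
  qed
  finally show ?thesis .
qed

text \<open>
  Lift the free cover of \<open>M\<close> along \<open>h\<close> to a map \<open>p : F \<rightarrow> B\<close>. It sends the syzygy into the kernel of \<open>h\<close>,
  and \<open>B\<close> is the quotient of \<open>ker h \<times> F\<close> by \<open>(k, c) \<mapsto> k + p c\<close>. If \<open>q : F \<rightarrow> Y\<close> extends \<open>g \<circ> p\<close>, then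
  \<open>(k, c) \<mapsto> g k + q c\<close> descends to \<open>B\<close>.
\<close>

lemma extend_from_kernel:
  assumes triv: "trivial_group (Ext1 R M Y)" and h: "linear_map R B M h" "h ` carrier B = carrier M"
    and g: "linear_map R (B\<lparr>carrier := {b \<in> carrier B. h b = \<zero>\<^bsub>M\<^esub>}\<rparr>) Y g"
  obtains g' where "linear_map R B Y g'" "\<And>b. \<lbrakk>b \<in> carrier B; h b = \<zero>\<^bsub>M\<^esub>\<rbrakk> \<Longrightarrow> g' b = g b"
proof -
  let ?K = "{b \<in> carrier B. h b = \<zero>\<^bsub>M\<^esub>}" and ?F = "free_cover R M"
  let ?BK = "B\<lparr>carrier := ?K\<rparr>"
  interpret h: linear_map R B M h by (rule h)
  interpret g: linear_map R ?BK Y g by (rule g)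
  have subK: "submodule ?K R B" by (rule h.submodule_kernel)
  define s where "s = inv_into (carrier B) h"
  have s: "s x \<in> carrier B" "h (s x) = x" if "x \<in> carrier M" for x
    using that h(2) by (simp_all add: s_def inv_into_into f_inv_into_f)
  define p where "p = cotuple R (carrier M) (\<lambda>_. regular_module R) B (\<lambda>x r. r \<odot>\<^bsub>B\<^esub> s x)"
  have p: "linear_map R ?F B p"
    unfolding p_def free_cover_def by (rule h.dom.free_extension(1)) (rule s)
  have hp: "h (p c) = cover_map R M c" if "c \<in> carrier ?F" for c
  proof (rule module_family.linear_maps_eqI[OF module_family_regular, where I = "carrier M"])
    show "linear_map R (direct_sum R (carrier M) (\<lambda>_. regular_module R)) M (\<lambda>c. h (p c))"
      using linear_map_comp[OF p h(1)] by (simp add: free_cover_def)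
    show "linear_map R (direct_sum R (carrier M) (\<lambda>_. regular_module R)) M (cover_map R M)"
      using linear_map_cover by (simp add: free_cover_def)
    show "c \<in> carrier (direct_sum R (carrier M) (\<lambda>_. regular_module R))"
      using that by (simp add: free_cover_def)
    show "h (p (summand (carrier M) (\<lambda>_. regular_module R) x r)) =
        cover_map R M (summand (carrier M) (\<lambda>_. regular_module R) x r)"
      if "x \<in> carrier M" "r \<in> carrier (regular_module R)" for x r
      using that h.dom.free_extension(2)[of "carrier M" s x r] free_extension(2)[of "carrier M" "\<lambda>x. x" x r] s
      by (simp add: p_def cover_map_eq_cotuple regular_module_def h.smult)
  qed
  interpret p: linear_map R ?F B p by (rule p)
  have p_syz: "linear_map R (syzygy R M) ?BK p"
  proof (rule linear_map.corestrict_submodule[OF _ subK])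
    show "linear_map R (syzygy R M) B p"
      using linear_map_comp[OF linear_map_syzygy_inclusion p] .
    show "p x \<in> ?K" if "x \<in> carrier (syzygy R M)" for x
      using that hp by (auto simp: carrier_syzygy)
  qed
  obtain q where q: "linear_map R ?F Y q" and qg: "\<And>k. k \<in> carrier (syzygy R M) \<Longrightarrow> q k = g (p k)"
    using triv linear_map_comp[OF p_syz g]
    unfolding Ext1_trivial_iff[OF g.cod.left_module_axioms] by blast
  interpret q: linear_map R ?F Y q by (rule q)
  let ?Q = "prod_module R ?BK ?F"
  have fstQ: "linear_map R ?Q ?BK fst" and sndQ: "linear_map R ?Q ?F snd"
    using linear_map_fst linear_map_snd g.dom.left_module_axioms left_module_free_cover by blast+
  have t: "linear_map R ?Q B (\<lambda>x. fst x \<oplus>\<^bsub>B\<^esub> p (snd x))"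
    using linear_map_add[OF linear_map_comp[OF fstQ linear_map_inclusion[OF h.dom.left_module_axioms subK]]
        linear_map_comp[OF sndQ p]] .
  have w: "linear_map R ?Q Y (\<lambda>x. g (fst x) \<oplus>\<^bsub>Y\<^esub> q (snd x))"
    using linear_map_add[OF linear_map_comp[OF fstQ g] linear_map_comp[OF sndQ q]] .
  have surj: "(\<lambda>x. fst x \<oplus>\<^bsub>B\<^esub> p (snd x)) ` carrier ?Q = carrier B"
  proof
    show "(\<lambda>x. fst x \<oplus>\<^bsub>B\<^esub> p (snd x)) ` carrier ?Q \<subseteq> carrier B"
      using linear_map.closed[OF t] by blast
    show "carrier B \<subseteq> (\<lambda>x. fst x \<oplus>\<^bsub>B\<^esub> p (snd x)) ` carrier ?Q"
    proof
      fix b assume b: "b \<in> carrier B"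
      then obtain c where c: "c \<in> carrier ?F" "cover_map R M c = h b"
        using cover_map_surj h.closed by (metis imageE)
      have "h (b \<ominus>\<^bsub>B\<^esub> p c) = \<zero>\<^bsub>M\<^esub>" using b c hp by (simp add: h.minus minus_eq_zero_iff)
      then have "(b \<ominus>\<^bsub>B\<^esub> p c, c) \<in> carrier ?Q" using b c by simp
      moreover have "b = (b \<ominus>\<^bsub>B\<^esub> p c) \<oplus>\<^bsub>B\<^esub> p c"
        using b c by (simp add: a_minus_def h.dom.M.a_assoc h.dom.M.l_neg)
      ultimately show "b \<in> (\<lambda>x. fst x \<oplus>\<^bsub>B\<^esub> p (snd x)) ` carrier ?Q"
        by (metis (no_types, lifting) fst_conv imageI snd_conv)
    qed
  qed
  have ker: "g (fst x) \<oplus>\<^bsub>Y\<^esub> q (snd x) = \<zero>\<^bsub>Y\<^esub>"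
    if x: "x \<in> carrier ?Q" "fst x \<oplus>\<^bsub>B\<^esub> p (snd x) = \<zero>\<^bsub>B\<^esub>" for x
  proof -
    obtain k c where xkc: "x = (k, c)" "k \<in> ?K" "c \<in> carrier ?F" using x(1) by auto
    then have "h (k \<oplus>\<^bsub>B\<^esub> p c) = cover_map R M c" 
      using linear_map.closed[OF linear_map_cover] by (simp add: h.add hp)
    then have c: "c \<in> carrier (syzygy R M)" using x(2) xkc by (simp add: carrier_syzygy)
    have pc: "p c \<in> ?K" using linear_map.closed[OF p_syz c] by simp
    have "g k \<oplus>\<^bsub>Y\<^esub> q c = g (k \<oplus>\<^bsub>B\<^esub> p c)" using qg[OF c] g.add[of k "p c"] xkc pc by simp
    also have "\<dots> = \<zero>\<^bsub>Y\<^esub>" using x(2) xkc g.zero by simp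
    finally show ?thesis by (simp add: xkc)
  qed
  obtain v where v: "linear_map R B Y v"
    and vt: "\<And>x. x \<in> carrier ?Q \<Longrightarrow> v (fst x \<oplus>\<^bsub>B\<^esub> p (snd x)) = g (fst x) \<oplus>\<^bsub>Y\<^esub> q (snd x)"
    using linear_map_descend[OF t surj w ker] by blast
  show thesis
  proof
    show "linear_map R B Y v" by (rule v)
    show "v b = g b" if "b \<in> carrier B" "h b = \<zero>\<^bsub>M\<^esub>" for b
      using vt[of "(b, \<zero>\<^bsub>?F\<^esub>)"] that g.closed[of b] p.dom.M.zero_closed by simp
  qed
qed

text \<open>
  A part of the long exact sequence: if \<open>Ext\<^sup>1(B, Y) = 0\<close>, then \<open>Ext\<^sup>1(M, Y)\<close> is the cokernel of
  \<open>Hom(B, Y) \<rightarrow> Hom(ker h, Y)\<close>. The isomorphic copy \<open>Z\<close> of \<open>B\<close> allows \<open>B\<close> to live on another type than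
  the modules of the class. The proof works in the pullback \<open>PB\<close> of \<open>h\<close> and the free cover of \<open>M\<close>.
\<close>

lemma Ext1_trivial_if_extends_from_kernel:
  assumes Y: "left_module R Y" and h: "linear_map R B M h" "h ` carrier B = carrier M"
    and t: "linear_map R B Z t" "bij_betw t (carrier B) (carrier Z)"
    and triv: "trivial_group (Ext1 R Z Y)"
    and ext: "\<And>g. linear_map R (B\<lparr>carrier := {b \<in> carrier B. h b = \<zero>\<^bsub>M\<^esub>}\<rparr>) Y g \<Longrightarrow>
      \<exists>g'. linear_map R B Y g' \<and> (\<forall>b\<in>carrier B. h b = \<zero>\<^bsub>M\<^esub> \<longrightarrow> g' b = g b)"
  shows "trivial_group (Ext1 R M Y)"
  unfolding Ext1_trivial_iff[OF Y]
proof (intro allI impI)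
  let ?F = "free_cover R M" and ?cov = "cover_map R M" and ?K = "{b \<in> carrier B. h b = \<zero>\<^bsub>M\<^esub>}"
  fix g assume g: "linear_map R (syzygy R M) Y g"
  interpret h: linear_map R B M h by (rule h)
  interpret t: linear_map R B Z t by (rule t)
  interpret g: linear_map R "syzygy R M" Y g by (rule g)
  interpret cov: linear_map R ?F M ?cov by (rule linear_map_cover)
  let ?P = "prod_module R B ?F"
  have modP: "left_module R ?P"
    using left_module_prod h.dom.left_module_axioms left_module_free_cover by blast
  have fstP: "linear_map R ?P B fst" and sndP: "linear_map R ?P ?F snd"
    using linear_map_fst linear_map_snd h.dom.left_module_axioms left_module_free_cover by blast+
  define PB where "PB = {x \<in> carrier ?P. h (fst x) \<ominus>\<^bsub>M\<^esub> ?cov (snd x) = \<zero>\<^bsub>M\<^esub>}"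
  have PB_iff: "x \<in> PB \<longleftrightarrow> fst x \<in> carrier B \<and> snd x \<in> carrier ?F \<and> h (fst x) = ?cov (snd x)" for x
    by (cases x) (auto simp: PB_def minus_eq_zero_iff)
  let ?Q = "?P\<lparr>carrier := PB\<rparr>"
  have subPB: "submodule PB R ?P"
    unfolding PB_def
    by (rule linear_map.submodule_kernel[OF linear_map_minus[OF linear_map_comp[OF fstP h(1)]
          linear_map_comp[OF sndP linear_map_cover]]])
  have inclQ: "linear_map R ?Q ?P (\<lambda>x. x)" by (rule linear_map_inclusion[OF modP subPB])
  interpret Q: left_module R ?Q by (rule left_module.left_module_submodule[OF modP subPB])
  have fstQ: "linear_map R ?Q B fst" using linear_map_comp[OF inclQ fstP] .
  have sndQ: "linear_map R ?Q ?F snd" using linear_map_comp[OF inclQ sndP] .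
  \<comment> \<open>The kernel of the projection of the pullback to \<open>Z\<close> is the syzygy, so \<open>g\<close> extends to a map \<open>\<Phi>\<close> on the
    pullback.\<close>
  have \<tau>: "linear_map R ?Q Z (\<lambda>x. t (fst x))" using linear_map_comp[OF fstQ t(1)] .
  have surj_\<tau>: "(\<lambda>x. t (fst x)) ` carrier ?Q = carrier Z"
  proof
    show "(\<lambda>x. t (fst x)) ` carrier ?Q \<subseteq> carrier Z" using linear_map.closed[OF \<tau>] by blast
    show "carrier Z \<subseteq> (\<lambda>x. t (fst x)) ` carrier ?Q"
    proof
      fix z assume "z \<in> carrier Z"
      then obtain b where b: "b \<in> carrier B" "t b = z"
        using t(2) by (metis bij_betw_imp_surj_on imageE)
      then obtain c where "c \<in> carrier ?F" "?cov c = h b"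
        using cover_map_surj h.closed by (metis imageE)
      with b show "z \<in> (\<lambda>x. t (fst x)) ` carrier ?Q"
        by (intro image_eqI[of _ _ "(b, c)"]) (auto simp: PB_iff)
    qed
  qed
  have t0: "t b = \<zero>\<^bsub>Z\<^esub> \<longleftrightarrow> b = \<zero>\<^bsub>B\<^esub>" if "b \<in> carrier B" for b
    using t(2) t.inj_on_iff_kernel that by (auto simp: bij_betw_def)
  let ?QK = "?Q\<lparr>carrier := {x \<in> carrier ?Q. t (fst x) = \<zero>\<^bsub>Z\<^esub>}\<rparr>"
  have sndQK: "linear_map R ?QK (syzygy R M) snd"
  proof -
    have "linear_map R ?QK ?F snd"
      using linear_map.restrict_submodule[OF sndQ linear_map.submodule_kernel[OF \<tau>]] by simp
    then have "linear_map R ?QK (?F\<lparr>carrier := carrier (syzygy R M)\<rparr>) snd"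
      by (rule linear_map.corestrict_submodule[OF _ submodule_syzygy])
        (auto simp: carrier_syzygy PB_iff t0)
    then show ?thesis by (simp add: syzygy_def)
  qed
  have "linear_map R ?QK Y (\<lambda>x. g (snd x))" using linear_map_comp[OF sndQK g] .
  then obtain \<Phi> where \<Phi>: "linear_map R ?Q Y \<Phi>"
    and \<Phi>g: "\<And>x. \<lbrakk>x \<in> carrier ?Q; t (fst x) = \<zero>\<^bsub>Z\<^esub>\<rbrakk> \<Longrightarrow> \<Phi> x = g (snd x)"
    using left_module.extend_from_kernel[OF t.cod.left_module_axioms triv \<tau> surj_\<tau>] by blast
  \<comment> \<open>The kernel of the other projection is \<open>ker h\<close>. Subtracting an extension \<open>\<kappa>\<close> of \<open>\<Phi>\<close> restricted to it
    makes \<open>\<Phi>\<close> descend to the free cover.\<close>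
  have subK: "submodule ?K R B" by (rule h.submodule_kernel)
  let ?BK = "B\<lparr>carrier := ?K\<rparr>"
  have "linear_map R ?BK ?P (\<lambda>b. (b, \<zero>\<^bsub>?F\<^esub>))"
    using linear_map_Pair[OF linear_map_inclusion[OF h.dom.left_module_axioms subK]
        linear_map_zero[OF h.dom.left_module_submodule[OF subK] left_module_free_cover]] .
  then have "linear_map R ?BK ?Q (\<lambda>b. (b, \<zero>\<^bsub>?F\<^esub>))"
    by (rule linear_map.corestrict_submodule[OF _ subPB]) (auto simp: PB_iff)
  from linear_map_comp[OF this \<Phi>] obtain \<kappa> where \<kappa>: "linear_map R B Y \<kappa>"
    and \<kappa>\<Phi>: "\<And>b. \<lbrakk>b \<in> carrier B; h b = \<zero>\<^bsub>M\<^esub>\<rbrakk> \<Longrightarrow> \<kappa> b = \<Phi> (b, \<zero>\<^bsub>?F\<^esub>)"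
    using ext by blast
  interpret \<kappa>: linear_map R B Y \<kappa> by (rule \<kappa>)
  interpret \<Phi>: linear_map R ?Q Y \<Phi> by (rule \<Phi>)
  have w: "linear_map R ?Q Y (\<lambda>x. \<Phi> x \<ominus>\<^bsub>Y\<^esub> \<kappa> (fst x))"
    using linear_map_minus[OF \<Phi> linear_map_comp[OF fstQ \<kappa>]] .
  have surj_snd: "snd ` carrier ?Q = carrier ?F"
  proof
    show "carrier ?F \<subseteq> snd ` carrier ?Q"
    proof
      fix c assume c: "c \<in> carrier ?F"
      then obtain b where "b \<in> carrier B" "h b = ?cov c" using h(2) cov.closed by (metis imageE)
      with c show "c \<in> snd ` carrier ?Q" by (intro image_eqI[of _ _ "(b, c)"]) (auto simp: PB_iff)
    qed
  qed (auto simp: PB_iff)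
  have ker: "\<Phi> x \<ominus>\<^bsub>Y\<^esub> \<kappa> (fst x) = \<zero>\<^bsub>Y\<^esub>"
    if xQ: "x \<in> carrier ?Q" "snd x = \<zero>\<^bsub>?F\<^esub>" for x
  proof -
    obtain b where x: "x = (b, \<zero>\<^bsub>?F\<^esub>)" using xQ(2) by (cases x) simp
    then have b: "b \<in> carrier B" "h b = \<zero>\<^bsub>M\<^esub>" using xQ(1) by (auto simp: PB_iff)
    have "\<Phi> x \<in> carrier Y" by (rule \<Phi>.closed[OF xQ(1)])
    then show ?thesis using b x by (simp add: \<kappa>\<Phi> g.cod.minus_eq_zero_iff)
  qed
  obtain v where v: "linear_map R ?F Y v"
    and vw: "\<And>x. x \<in> carrier ?Q \<Longrightarrow> v (snd x) = \<Phi> x \<ominus>\<^bsub>Y\<^esub> \<kappa> (fst x)"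
    using linear_map_descend[OF sndQ surj_snd w ker] by blast
  have "v k = g k" if k: "k \<in> carrier (syzygy R M)" for k
  proof -
    have "(\<zero>\<^bsub>B\<^esub>, k) \<in> carrier ?Q" using k by (auto simp: PB_iff carrier_syzygy)
    then have "v k = g k \<ominus>\<^bsub>Y\<^esub> \<zero>\<^bsub>Y\<^esub>" using vw[of "(\<zero>\<^bsub>B\<^esub>, k)"] \<Phi>g[of "(\<zero>\<^bsub>B\<^esub>, k)"] by simp
    then show ?thesis using g.closed[OF k] by (simp add: a_minus_def)
  qed
  with v show "\<exists>g'. linear_map R ?F Y g' \<and> (\<forall>k\<in>carrier (syzygy R M). g' k = g k)" by blast
qed

end

section \<open>Small sets and quotients inside the universe\<close>

lemma countable_if_less_aleph1:
  "|A| <o aleph1 \<Longrightarrow> countable A"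
  using cardSuc_ordLeq_ordLess[OF natLeq_Card_order card_of_Card_order] countable_card_le_natLeq by blast

locale inaccessible_universe =
  fixes v :: "'v itself"
  assumes inaccessible: "strongly_inaccessible |UNIV :: 'v set|"
begin

lemma stable_universe: "stable |UNIV :: 'v set|"
  and infinite_universe: "infinite (UNIV :: 'v set)"
proof -
  have inf: "natLeq <o |UNIV :: 'v set|" and reg: "regularCard |UNIV :: 'v set|"
    using inaccessible by (auto simp: strongly_inaccessible_def)
  show "infinite (UNIV :: 'v set)"
    using inf infinite_iff_natLeq_ordLeq ordLess_imp_ordLeq by blast
  then show "stable |UNIV :: 'v set|"
    by (intro regularCard_stable[OF card_of_Card_order _ reg]) (simp add: Field_card_of)
qed

lemma small_ordLeq: "|A| \<le>o |B| \<Longrightarrow> small TYPE('v) B \<Longrightarrow> small TYPE('v) A"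
  by (auto simp: small_def intro: ordLeq_ordLess_trans)

lemma small_subset: "A \<subseteq> B \<Longrightarrow> small TYPE('v) B \<Longrightarrow> small TYPE('v) A"
  using small_ordLeq card_of_mono1 by blast

lemma small_image: "small TYPE('v) A \<Longrightarrow> small TYPE('v) (h ` A)"
  using small_ordLeq card_of_image by blast

lemma small_inj_on_image: "inj_on h A \<Longrightarrow> small TYPE('v) (h ` A) \<Longrightarrow> small TYPE('v) A"
  using small_ordLeq card_of_ordLeq by (metis order_refl)

lemma small_countable: "countable A \<Longrightarrow> small TYPE('v) A"
proof -
  assume "countable A"
  then obtain h :: "'a \<Rightarrow> nat" where "inj_on h A" by (auto simp: countable_def)
  moreover have "small TYPE('v) (UNIV :: nat set)"
    using inaccessible card_of_nat ordIso_ordLess_trans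
    by (auto simp: small_def strongly_inaccessible_def)
  ultimately show ?thesis using small_inj_on_image small_subset subset_UNIV by blast
qed

lemma small_Sigma:
  "small TYPE('v) A \<Longrightarrow> (\<And>a. a \<in> A \<Longrightarrow> small TYPE('v) (B a)) \<Longrightarrow> small TYPE('v) (SIGMA a:A. B a)"
  unfolding small_def by (rule stable_elim[OF stable_universe])

lemma small_UN:
  "small TYPE('v) A \<Longrightarrow> (\<And>a. a \<in> A \<Longrightarrow> small TYPE('v) (B a)) \<Longrightarrow> small TYPE('v) (\<Union>a\<in>A. B a)"
  unfolding small_def by (rule stable_UNION[OF stable_universe])

lemma small_Plus: "small TYPE('v) A \<Longrightarrow> small TYPE('v) B \<Longrightarrow> small TYPE('v) (A <+> B)"
  unfolding small_def by (rule card_of_Plus_ordLess_infinite[OF infinite_universe])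

lemma small_Un: "small TYPE('v) A \<Longrightarrow> small TYPE('v) B \<Longrightarrow> small TYPE('v) (A \<union> B)"
  unfolding small_def by (rule card_of_Un_ordLess_infinite[OF infinite_universe])

lemma small_injection:
  assumes "small TYPE('v) A" obtains e :: "'a \<Rightarrow> 'v" where "inj_on e A"
proof -
  have "|A| \<le>o |UNIV :: 'v set|" using assms ordLess_imp_ordLeq unfolding small_def by blast
  then show thesis using that card_of_ordLeq by (metis (no_types))
qed

lemma small_Pow:
  assumes "small TYPE('v) A" shows "small TYPE('v) (Pow A)"
proof -
  obtain e :: "'a \<Rightarrow> 'v" where e: "inj_on e A" using small_injection[OF assms] by blast
  have "small TYPE('v) (e ` A)" by (rule small_image[OF assms])
  then have "small TYPE('v) (Pow (e ` A))"
    using inaccessible by (simp add: small_def strongly_inaccessible_def Field_card_of)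
  then show ?thesis
    using small_inj_on_image[OF inj_on_image_Pow[OF e]] image_Pow_surj[of e A "e ` A"] by simp
qed

text \<open>Elements of the direct sum are determined by their graphs.\<close>

lemma small_direct_sum:
  assumes "small TYPE('v) I" "\<And>i. i \<in> I \<Longrightarrow> small TYPE('v) (carrier (D i))"
  shows "small TYPE('v) (carrier (direct_sum R I D))"
proof -
  let ?graph = "\<lambda>x. {(i, x i) | i. i \<in> I}"
  have "?graph ` carrier (direct_sum R I D) \<subseteq> Pow (SIGMA i:I. carrier (D i))"
    by (auto simp: direct_sum_simps)
  then have "small TYPE('v) (?graph ` carrier (direct_sum R I D))"
    by (rule small_subset[OF _ small_Pow[OF small_Sigma]]) (use assms in auto)
  moreover have "inj_on ?graph (carrier (direct_sum R I D))"
  proof (rule inj_onI)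
    fix x y assume xy: "x \<in> carrier (direct_sum R I D)" "y \<in> carrier (direct_sum R I D)"
      "?graph x = ?graph y"
    have "x i = y i" if "i \<in> I" for i
    proof -
      have "(i, x i) \<in> ?graph y" using xy(3) that by blast
      then show ?thesis by blast
    qed
    with xy(1,2) show "x = y"
      by (auto simp: direct_sum_simps PiE_def intro: extensionalityI)
  qed
  ultimately show ?thesis using small_inj_on_image by blast
qed

lemma quotient_in_universe:
  assumes "left_module R P" "submodule N R P" "small TYPE('v) (carrier P)"
  shows "\<exists>(Q :: ('r, 'v) module) q. Q \<in> Modules R \<and> linear_map R P Q q \<and>
    q ` carrier P = carrier Q \<and> (\<forall>x\<in>carrier P. q x = \<zero>\<^bsub>Q\<^esub> \<longleftrightarrow> x \<in> N)"
proof -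
  interpret P: left_module R P by fact
  note N = submodule_facts[OF assms(2)]
  define coset where "coset x = {y \<in> carrier P. x \<ominus>\<^bsub>P\<^esub> y \<in> N}" for x
  have coset: "coset x = coset y \<longleftrightarrow> x \<ominus>\<^bsub>P\<^esub> y \<in> N" if "x \<in> carrier P" "y \<in> carrier P" for x y
  proof
    assume "coset x = coset y"
    moreover have "y \<in> coset y" using that N(2) by (simp add: coset_def a_minus_def P.M.r_neg)
    ultimately show "x \<ominus>\<^bsub>P\<^esub> y \<in> N" by (auto simp: coset_def)
  next
    assume xy: "x \<ominus>\<^bsub>P\<^esub> y \<in> N"
    have "x \<ominus>\<^bsub>P\<^esub> z = (x \<ominus>\<^bsub>P\<^esub> y) \<oplus>\<^bsub>P\<^esub> (y \<ominus>\<^bsub>P\<^esub> z)"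
      "y \<ominus>\<^bsub>P\<^esub> z = (x \<ominus>\<^bsub>P\<^esub> z) \<oplus>\<^bsub>P\<^esub> \<ominus>\<^bsub>P\<^esub> (x \<ominus>\<^bsub>P\<^esub> y)" if "z \<in> carrier P" for z
      using that \<open>x \<in> carrier P\<close> \<open>y \<in> carrier P\<close>
      by (simp_all add: a_minus_def P.M.minus_add P.M.add.m_ac P.M.r_neg1 P.M.r_neg2 P.M.r_neg P.M.l_neg)
    then show "coset x = coset y"
      using xy N(3,5) unfolding coset_def by (metis (no_types, lifting))
  qed
  obtain e :: "'b set \<Rightarrow> 'v" where e: "inj_on e (coset ` carrier P)"
    using small_injection[OF small_image[OF assms(3)]] by blast
  have q: "e (coset x) = e (coset y) \<longleftrightarrow> x \<ominus>\<^bsub>P\<^esub> y \<in> N" if "x \<in> carrier P" "y \<in> carrier P" for x y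
    using e coset[OF that] that by (auto simp: inj_on_def)
  obtain Q :: "('r, 'v) module" where Q: "linear_map R P Q (\<lambda>x. e (coset x))"
    "carrier Q = (\<lambda>x. e (coset x)) ` carrier P"
    using P.quotient_realisation[OF assms(2) q] by blast
  interpret Q: linear_map R P Q "\<lambda>x. e (coset x)" by (rule Q(1))
  show ?thesis
  proof (intro exI conjI ballI)
    show "Q \<in> Modules R"
      using Q.cod.left_module_axioms Q(2) small_image[OF assms(3)] by (simp add: Modules_def)
    show "linear_map R P Q (\<lambda>x. e (coset x))" by (rule Q(1))
    show "(\<lambda>x. e (coset x)) ` carrier P = carrier Q" using Q(2) by simp
    show "e (coset x) = \<zero>\<^bsub>Q\<^esub> \<longleftrightarrow> x \<in> N" if "x \<in> carrier P" for x
      using q[OF that P.M.zero_closed] Q.zero that P.M.minus_equality[of "\<zero>\<^bsub>P\<^esub>" "\<zero>\<^bsub>P\<^esub>"]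
      by (simp add: a_minus_def)
  qed
qed

end

section \<open>Totally ordered direct limits as limits of well-ordered chains\<close>

text \<open>
  Well-order \<open>I\<close> by an auxiliary order \<open>s\<close> and keep the elements that are larger, in the given order, than
  all their \<open>s\<close>-predecessors. On these the two orders agree.
\<close>

lemma cofinal_well_order:
  assumes "linear_order_on I r"
  obtains J where "J \<subseteq> I" "well_order_on J (Restr r J)" "\<And>i. i \<in> I \<Longrightarrow> \<exists>j\<in>J. (i, j) \<in> r"
proof -
  have r: "refl_on I r" "trans r" "antisym r" "r \<subseteq> I \<times> I" "total_on I r"
    using assms by (auto simp: order_on_defs)
  obtain s where "well_order_on I s" using well_order_on by blast
  then have s: "wf (s - Id)" "total_on I s" by (auto simp: order_on_defs)
  define J where "J = {i \<in> I. \<forall>j\<in>I. (j, i) \<in> s - Id \<longrightarrow> (j, i) \<in> r}"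
  have "Restr r J - Id \<subseteq> s - Id"
  proof
    fix p assume "p \<in> Restr r J - Id"
    then obtain a b where p: "p = (a, b)" "(a, b) \<in> r" "a \<in> J" "b \<in> J" "a \<noteq> b" by auto
    then have "(b, a) \<notin> s" using r(3) by (auto simp: J_def antisym_def)
    then show "p \<in> s - Id" using p s(2) by (auto simp: J_def total_on_def)
  qed
  then have "wf (Restr r J - Id)" using s(1) wf_subset by blast
  moreover have "linear_order_on J (Restr r J)"
    using r by (auto simp: order_on_defs refl_on_def trans_def antisym_def total_on_def J_def)
  ultimately have "well_order_on J (Restr r J)" by (simp add: well_order_on_def)
  \<comment> \<open>Above \<open>i\<close> the \<open>s\<close>-least element has been kept.\<close>
  moreover have "\<exists>j\<in>J. (i, j) \<in> r" if i: "i \<in> I" for i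
  proof -
    have "i \<in> {k \<in> I. (i, k) \<in> r}" using i r(1) by (simp add: refl_on_def)
    then obtain k where k: "k \<in> I" "(i, k) \<in> r"
      and min: "\<And>j. (j, k) \<in> s - Id \<Longrightarrow> \<not> (j \<in> I \<and> (i, j) \<in> r)"
      using wfE_min[OF s(1)] by (metis (no_types, lifting) mem_Collect_eq)
    have "(j, k) \<in> r" if "j \<in> I" "(j, k) \<in> s - Id" for j
      using min[OF that(2)] that(1) i k r by (metis refl_on_def total_on_def transD)
    then show ?thesis using k by (auto simp: J_def)
  qed
  moreover have "J \<subseteq> I" by (auto simp: J_def)
  ultimately show thesis using that by blast
qed

locale chain = ring R
  for R :: "('r, 'm) ring_scheme" (structure)
    and J :: "'i set" and r :: "'i rel" and D :: "'i \<Rightarrow> ('r, 'a, 'n) module_scheme"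
    and f :: "'i \<Rightarrow> 'i \<Rightarrow> 'a \<Rightarrow> 'a" +
  assumes well_order: "well_order_on J r" and nonempty: "J \<noteq> {}"
    and modules: "i \<in> J \<Longrightarrow> left_module R (D i)"
    and f_linear: "(i, j) \<in> r \<Longrightarrow> linear_map R (D i) (D j) (f i j)"
    and f_id: "\<lbrakk>i \<in> J; x \<in> carrier (D i)\<rbrakk> \<Longrightarrow> f i i x = x"
    and f_comp: "\<lbrakk>(i, j) \<in> r; (j, k) \<in> r; x \<in> carrier (D i)\<rbrakk> \<Longrightarrow> f j k (f i j x) = f i k x"
begin

lemma r_refl: "i \<in> J \<Longrightarrow> (i, i) \<in> r"
  and r_trans: "(i, j) \<in> r \<Longrightarrow> (j, k) \<in> r \<Longrightarrow> (i, k) \<in> r"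
  and r_antisym: "(i, j) \<in> r \<Longrightarrow> (j, i) \<in> r \<Longrightarrow> i = j"
  and r_total: "i \<in> J \<Longrightarrow> j \<in> J \<Longrightarrow> (i, j) \<in> r \<or> (j, i) \<in> r"
  and r_snd: "(i, j) \<in> r \<Longrightarrow> j \<in> J"
proof -
  have *: "refl_on J r" "trans r" "antisym r" "r \<subseteq> J \<times> J" "total_on J r"
    using well_order by (auto simp: order_on_defs)
  show "i \<in> J \<Longrightarrow> (i, i) \<in> r" using * by (simp add: refl_on_def)
  show "(i, j) \<in> r \<Longrightarrow> (j, k) \<in> r \<Longrightarrow> (i, k) \<in> r" using * by (blast dest: transD)
  show "(i, j) \<in> r \<Longrightarrow> (j, i) \<in> r \<Longrightarrow> i = j" using * by (blast dest: antisymD)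
  show "i \<in> J \<Longrightarrow> j \<in> J \<Longrightarrow> (i, j) \<in> r \<or> (j, i) \<in> r"
    using * by (metis refl_on_def total_on_def)
  show "(i, j) \<in> r \<Longrightarrow> j \<in> J" using * by auto
qed

lemma least:
  assumes "S \<subseteq> J" "S \<noteq> {}" obtains m where "m \<in> S" "\<And>s. s \<in> S \<Longrightarrow> (m, s) \<in> r"
proof -
  have "wf (r - Id)" using well_order by (simp add: well_order_on_def)
  then obtain m where m: "m \<in> S" "\<And>s. (s, m) \<in> r - Id \<Longrightarrow> s \<notin> S"
    using wfE_min assms(2) by (metis ex_in_conv)
  have "(m, s) \<in> r" if "s \<in> S" for s
    using m(2)[of s] that m(1) assms(1) r_total[of m s] r_refl by blast
  with m(1) show thesis by (rule that)
qed

lemma finite_max: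
  assumes "finite F" "F \<noteq> {}" "F \<subseteq> J" obtains m where "m \<in> F" "\<And>i. i \<in> F \<Longrightarrow> (i, m) \<in> r"
proof -
  have "\<exists>m\<in>F. \<forall>i\<in>F. (i, m) \<in> r"
    using assms
  proof (induction F rule: finite_ne_induct)
    case (insert a F)
    then obtain m where m: "m \<in> F" "\<forall>i\<in>F. (i, m) \<in> r" "a \<in> J" "m \<in> J" by auto
    then show ?case using r_total[of a m] r_refl r_trans by (metis insert_iff)
  qed (auto simp: r_refl)
  then show thesis using that by blast
qed

lemma finite_bounded:
  assumes "finite F" "F \<subseteq> J" obtains m where "m \<in> J" "\<And>i. i \<in> F \<Longrightarrow> (i, m) \<in> r"
proof (cases "F = {}")
  case True
  then show thesis using nonempty that by blast
next
  case False
  then show thesis using finite_max[OF assms(1) _ assms(2)] assms(2) that by blast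
qed

abbreviation B :: "('r, 'i \<Rightarrow> 'a) module" where "B \<equiv> direct_sum R J D"

sublocale B: module_family R J D
  by (intro module_family.intro module_family_axioms.intro ring_axioms modules)

definition transition :: "'i \<Rightarrow> 'i \<Rightarrow> 'a \<Rightarrow> 'a"
  where "transition i j = (if (i, j) \<in> r then f i j else (\<lambda>_. \<zero>\<^bsub>D j\<^esub>))"

text \<open>
  The partial sum of a family in \<open>B\<close> over the indices up to \<open>j\<close>, computed in \<open>D j\<close>: later indices contribute
  \<open>0\<close>.
\<close>

definition level :: "'i \<Rightarrow> ('i \<Rightarrow> 'a) \<Rightarrow> 'a"
  where "level j = cotuple R J D (D j) (\<lambda>i. transition i j)"

lemma linear_map_transition:
  "i \<in> J \<Longrightarrow> j \<in> J \<Longrightarrow> linear_map R (D i) (D j) (transition i j)"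
  by (cases "(i, j) \<in> r") (simp_all add: transition_def f_linear linear_map_zero modules)

lemma cotuple_family_level:
  assumes "j \<in> J" shows "cotuple_family R J D (D j) (\<lambda>i. transition i j)"
  by (intro cotuple_family.intro cotuple_family_axioms.intro B.module_family_axioms modules assms
      linear_map_transition)

lemma linear_map_level: "j \<in> J \<Longrightarrow> linear_map R B (D j) (level j)"
  unfolding level_def by (rule cotuple_family.linear_map_cotuple[OF cotuple_family_level])

lemma level_summand:
  "\<lbrakk>i \<in> J; j \<in> J; x \<in> carrier (D i)\<rbrakk> \<Longrightarrow> level j (summand J D i x) = transition i j x"
  unfolding level_def by (rule cotuple_family.cotuple_summand[OF cotuple_family_level])

end

text \<open>Past its support, the partial sums of a family represent its image in every cocone.\<close>

lemma (in chain) level_beyond_support: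
  assumes b: "b \<in> carrier B" and bound: "\<And>i. \<lbrakk>i \<in> J; b i \<noteq> \<zero>\<^bsub>D i\<^esub>\<rbrakk> \<Longrightarrow> (i, k) \<in> r" and k: "k \<in> J"
    and N: "left_module R N" and \<phi>: "\<And>i. i \<in> J \<Longrightarrow> linear_map R (D i) N (\<phi> i)"
    and compat: "\<And>i x. \<lbrakk>(i, k) \<in> r; x \<in> carrier (D i)\<rbrakk> \<Longrightarrow> \<phi> k (f i k x) = \<phi> i x"
  shows "\<phi> k (level k b) = cotuple R J D N \<phi> b"
proof -
  interpret N: left_module R N by (rule N)
  interpret \<phi>k: linear_map R "D k" N "\<phi> k" by (rule \<phi>[OF k])
  let ?F = "{i \<in> J. b i \<noteq> \<zero>\<^bsub>D i\<^esub>}"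
  have bi: "b i \<in> carrier (D i)" if "i \<in> J" for i using B.in_family[OF b that] .
  have "\<phi> k (level k b) = \<phi> k (\<Oplus>\<^bsub>D k\<^esub>i\<in>?F. transition i k (b i))"
    using b by (simp add: level_def cotuple_def)
  also have "\<dots> = (\<Oplus>\<^bsub>N\<^esub>i\<in>?F. \<phi> k (transition i k (b i)))"
    by (rule \<phi>k.finsum) (use bi k linear_map.closed[OF linear_map_transition] in auto)
  also have "\<dots> = (\<Oplus>\<^bsub>N\<^esub>i\<in>?F. \<phi> i (b i))"
  proof (rule N.M.finsum_cong')
    show "(\<lambda>i. \<phi> i (b i)) \<in> ?F \<rightarrow> carrier N" using bi linear_map.closed[OF \<phi>] by auto
    show "\<phi> k (transition i k (b i)) = \<phi> i (b i)" if "i \<in> ?F" for i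
      using that bound bi compat by (simp add: transition_def)
  qed simp
  also have "\<dots> = cotuple R J D N \<phi> b" using b by (simp add: cotuple_def)
  finally show ?thesis .
qed

lemma (in chain) bounded_support:
  assumes "b \<in> carrier B"
  obtains k where "k \<in> J" "\<And>i. \<lbrakk>i \<in> J; b i \<noteq> \<zero>\<^bsub>D i\<^esub>\<rbrakk> \<Longrightarrow> (i, k) \<in> r"
proof -
  obtain k where "k \<in> J" "\<And>i. i \<in> {i \<in> J. b i \<noteq> \<zero>\<^bsub>D i\<^esub>} \<Longrightarrow> (i, k) \<in> r"
    by (rule finite_bounded[OF B.finite_support[OF assms]]) auto
  then show thesis using that by simp
qed

text \<open>
  The direct limit in elementary terms. The kernel condition speaks of all partial sums from \<open>j\<close> on because
  this is what makes \<open>b\<close> disappear from all nodes of level at least \<open>j\<close> in \<open>truncated_branch\<close>.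
\<close>

locale chain_limit = chain R J r D f + limit: left_module R M
  for R :: "('r, 'm) ring_scheme" (structure)
    and J :: "'i set" and r :: "'i rel" and D :: "'i \<Rightarrow> ('r, 'a, 'n) module_scheme"
    and f :: "'i \<Rightarrow> 'i \<Rightarrow> 'a \<Rightarrow> 'a" and M :: "('r, 'b, 'k) module_scheme" +
  fixes \<phi> :: "'i \<Rightarrow> 'a \<Rightarrow> 'b"
  assumes \<phi>_linear: "i \<in> J \<Longrightarrow> linear_map R (D i) M (\<phi> i)"
    and \<phi>_compat: "\<lbrakk>(i, j) \<in> r; x \<in> carrier (D i)\<rbrakk> \<Longrightarrow> \<phi> j (f i j x) = \<phi> i x"
    and \<phi>_surj: "cotuple R J D M \<phi> ` carrier B = carrier M"
    and \<phi>_kernel: "\<lbrakk>b \<in> carrier B; cotuple R J D M \<phi> b = \<zero>\<^bsub>M\<^esub>\<rbrakk>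
      \<Longrightarrow> \<exists>j\<in>J. \<forall>k. (j, k) \<in> r \<longrightarrow> level k b = \<zero>\<^bsub>D k\<^esub>"
begin

definition h :: "('i \<Rightarrow> 'a) \<Rightarrow> 'b" where "h = cotuple R J D M \<phi>"

sublocale h: cotuple_family R J D M \<phi>
  by (intro cotuple_family.intro cotuple_family_axioms.intro B.module_family_axioms
      limit.left_module_axioms \<phi>_linear)

lemma linear_map_h: "linear_map R B M h"
  unfolding h_def by (rule h.linear_map_cotuple)

lemma h_surj: "h ` carrier B = carrier M"
  unfolding h_def by (rule \<phi>_surj)

lemma h_kernel:
  assumes "b \<in> carrier B" "h b = \<zero>\<^bsub>M\<^esub>"
  obtains j where "j \<in> J" "\<And>k. (j, k) \<in> r \<Longrightarrow> level k b = \<zero>\<^bsub>D k\<^esub>"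
  using \<phi>_kernel[of b] assms unfolding h_def by blast

lemma bijective_last:
  assumes m: "m \<in> J" "\<And>i. i \<in> J \<Longrightarrow> (i, m) \<in> r"
  shows "bij_betw (\<phi> m) (carrier (D m)) (carrier M)"
proof -
  interpret \<phi>m: linear_map R "D m" M "\<phi> m" using \<phi>_linear m(1) .
  have "inj_on (\<phi> m) (carrier (D m))"
    unfolding \<phi>m.inj_on_iff_kernel
  proof (intro ballI impI)
    fix x assume x: "x \<in> carrier (D m)" "\<phi> m x = \<zero>\<^bsub>M\<^esub>"
    have "summand J D m x \<in> carrier B" using B.summand_closed m(1) x(1) .
    moreover have "h (summand J D m x) = \<zero>\<^bsub>M\<^esub>"
      using h.cotuple_summand[OF m(1) x(1)] x(2) by (simp add: h_def)
    ultimately obtain j where "j \<in> J" "\<And>k. (j, k) \<in> r \<Longrightarrow> level k (summand J D m x) = \<zero>\<^bsub>D k\<^esub>"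
      using h_kernel by blast
    then have "transition m m x = \<zero>\<^bsub>D m\<^esub>"
      using m level_summand[OF m(1) m(1) x(1)] by metis
    then show "x = \<zero>\<^bsub>D m\<^esub>" using m x(1) f_id by (simp add: transition_def r_refl)
  qed
  moreover have "\<phi> m ` carrier (D m) = carrier M"
  proof
    show "\<phi> m ` carrier (D m) \<subseteq> carrier M" by auto
    have "submodule (carrier (D m)) R (D m)" by (rule \<phi>m.dom.submoduleI') auto
    then have "h b \<in> \<phi> m ` carrier (D m)" if "b \<in> carrier B" for b
    proof (rule B.linear_map_into_submodule[OF linear_map_h \<phi>m.submodule_image _ that])
      fix i x assume ix: "i \<in> J" "x \<in> carrier (D i)"
      have "h (summand J D i x) = \<phi> m (f i m x)"
        using h.cotuple_summand[OF ix] \<phi>_compat[OF m(2)[OF ix(1)] ix(2)] by (simp add: h_def)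
      then show "h (summand J D i x) \<in> \<phi> m ` carrier (D m)"
        using linear_map.closed[OF f_linear[OF m(2)[OF ix(1)]] ix(2)] by blast
    qed
    then show "carrier M \<subseteq> \<phi> m ` carrier (D m)"
      unfolding h_surj[symmetric] by (rule image_subsetI)
  qed
  ultimately show ?thesis by (simp add: bij_betw_def)
qed

end

text \<open>
  The elementary description follows from the universal property. The image of \<open>B\<close> in \<open>M\<close> is itself a
  cocone, which gives surjectivity. For the kernel, the families in \<open>B\<close> whose partial sums vanish
  eventually form a submodule \<open>N\<close>, and the map from \<open>M\<close> to the cocone \<open>B / N\<close> shows that whatever dies in \<open>M\<close> lies in \<open>N\<close>.
  The quotient is realised in the universe, since the universal property only speaks of modules there.
\<close>

lemma (in inaccessible_universe) direct_limit_chain: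
  fixes D :: "'i \<Rightarrow> ('r, 'v) module"
  assumes R: "ring R" and I: "small TYPE('v) I" "linear_order_on I r" "direct_system R I r D f"
    and M: "is_direct_limit R I r D f M"
  obtains J \<phi> where "J \<subseteq> I" "chain_limit R J (Restr r J) D f M \<phi>" "M \<in> Modules R"
proof -
  obtain J where J: "J \<subseteq> I" "well_order_on J (Restr r J)" and cof: "\<And>i. i \<in> I \<Longrightarrow> \<exists>j\<in>J. (i, j) \<in> r"
    using cofinal_well_order[OF I(2)] by blast
  have I_ne: "I \<noteq> {}" and D: "\<And>i. i \<in> I \<Longrightarrow> D i \<in> Modules R"
    and f_hom: "\<And>i j. (i, j) \<in> r \<Longrightarrow> f i j \<in> mod_hom R (D i) (D j)"
    and sys_id: "\<And>i x. \<lbrakk>i \<in> I; x \<in> carrier (D i)\<rbrakk> \<Longrightarrow> f i i x = x"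
    and sys_comp: "\<And>i j k x. \<lbrakk>(i, j) \<in> r; (j, k) \<in> r; x \<in> carrier (D i)\<rbrakk> \<Longrightarrow> f j k (f i j x) = f i k x"
    using I(3) unfolding direct_system_def by blast+
  have rI: "i \<in> I" "j \<in> I" if "(i, j) \<in> r" for i j
    using I(2) that by (auto simp: order_on_defs)
  have trans: "(i, k) \<in> r" if "(i, j) \<in> r" "(j, k) \<in> r" for i j k
    using I(2) that by (auto simp: order_on_defs dest: transD)
  have total: "(i, j) \<in> r \<or> (j, i) \<in> r" if "i \<in> I" "j \<in> I" for i j
    using I(2) that unfolding order_on_defs refl_on_def total_on_def by metis
  have modD: "left_module R (D i)" if "i \<in> I" for i using D[OF that] by (simp add: Modules_def)
  have f_lin: "linear_map R (D i) (D j) (f i j)" if "(i, j) \<in> r" for i j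
    using linear_map_mod_hom modD rI[OF that] f_hom[OF that] by blast
  interpret chain R J "Restr r J" D f
    by (intro chain.intro R chain_axioms.intro J(2)) (use I_ne cof J modD f_lin sys_id sys_comp in auto)
  obtain \<phi> where \<phi>: "cocone R I r D f M \<phi>"
    and univ: "\<And>T \<psi>. cocone R I r D f T \<psi> \<Longrightarrow>
      \<exists>!u. u \<in> mod_hom R M T \<and> (\<forall>i\<in>I. \<forall>x\<in>carrier (D i). u (\<phi> i x) = \<psi> i x)"
    using M unfolding is_direct_limit_def by blast
  have M: "M \<in> Modules R" "left_module R M" and \<phi>_hom: "\<And>i. i \<in> I \<Longrightarrow> \<phi> i \<in> mod_hom R (D i) M"
    and \<phi>_compat: "\<And>i j x. \<lbrakk>(i, j) \<in> r; x \<in> carrier (D i)\<rbrakk> \<Longrightarrow> \<phi> j (f i j x) = \<phi> i x"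
    using \<phi> by (auto simp: cocone_def Modules_def)
  interpret M: left_module R M by (rule M(2))
  have \<phi>_lin: "linear_map R (D i) M (\<phi> i)" if "i \<in> I" for i
    using linear_map_mod_hom modD[OF that] M(2) \<phi>_hom[OF that] by blast
  interpret h: cotuple_family R J D M \<phi>
    by (intro cotuple_family.intro cotuple_family_axioms.intro B.module_family_axioms M(2) \<phi>_lin)
      (use J(1) in blast)
  let ?h = "cotuple R J D M \<phi>"

  have surj: "?h ` carrier B = carrier M"
  proof -
    let ?T = "?h ` carrier B"
    have "submodule (carrier B) R B" by (rule B.sum.submoduleI') auto
    then have sub: "submodule ?T R M" by (rule h.submodule_image)
    note T = submodule_facts[OF sub]
    have \<phi>T: "\<phi> i x \<in> ?T" if "i \<in> I" "x \<in> carrier (D i)" for i x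
    proof -
      obtain j where j: "j \<in> J" "(i, j) \<in> r" using cof \<open>i \<in> I\<close> by blast
      have fx: "f i j x \<in> carrier (D j)" using linear_map.closed[OF f_lin[OF j(2)]] that(2) .
      have "\<phi> i x = ?h (summand J D j (f i j x))"
        using h.cotuple_summand[OF j(1) fx] \<phi>_compat[OF j(2) that(2)] by simp
      then show ?thesis using B.summand_closed[OF j(1) fx] by blast
    qed
    let ?MT = "M\<lparr>carrier := ?T\<rparr>"
    have "cocone R I r D f ?MT \<phi>"
      unfolding cocone_def
    proof (intro conjI ballI allI impI)
      show "?MT \<in> Modules R"
        using M.left_module_submodule[OF sub] M(1) small_subset[OF T(1)] by (simp add: Modules_def)
      show "\<phi> i \<in> mod_hom R (D i) ?MT" if "i \<in> I" for i
        using \<phi>_hom[OF that] \<phi>T[OF that] by (auto simp: mod_hom_def PiE_def)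
    qed (use \<phi>_compat in auto)
    then obtain u where u: "u \<in> mod_hom R M ?MT" "\<And>i x. \<lbrakk>i \<in> I; x \<in> carrier (D i)\<rbrakk> \<Longrightarrow> u (\<phi> i x) = \<phi> i x"
      using univ by blast
    have uT: "u x \<in> ?T" if "x \<in> carrier M" for x
      using u(1) that by (simp add: mod_hom_def PiE_def Pi_def)
    have "u x \<in> carrier M" if "x \<in> carrier M" for x by (rule subsetD[OF T(1) uT[OF that]])
    then have uM: "u \<in> mod_hom R M M" using u(1) by (simp add: mod_hom_def PiE_def Pi_def)
    have idM: "restrict (\<lambda>x. x) (carrier M) \<in> mod_hom R M M"
      by (rule linear_map.mod_hom_restrict[OF linear_map_id[OF M(2)]])
    \<comment> \<open>Followed by the inclusion, \<open>u\<close> is an endomorphism of the limit cocone, hence the identity.\<close>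
    have "u = restrict (\<lambda>x. x) (carrier M)"
      using univ[OF \<phi>] uM u(2) idM linear_map.closed[OF \<phi>_lin] by (metis restrict_apply')
    then have "x \<in> ?T" if "x \<in> carrier M" for x
      using uT[OF that] that by simp
    then show ?thesis using T(1) by blast
  qed

  define N where "N = {b \<in> carrier B. \<exists>j\<in>J. \<forall>k. (j, k) \<in> Restr r J \<longrightarrow> level k b = \<zero>\<^bsub>D k\<^esub>}"
  have N_iff: "b \<in> N \<longleftrightarrow> b \<in> carrier B \<and> (\<exists>j\<in>J. \<forall>k\<in>J. (j, k) \<in> r \<longrightarrow> level k b = \<zero>\<^bsub>D k\<^esub>)" for b
    by (auto simp: N_def)
  have mon: "abelian_monoid (D k)" if "k \<in> J" for k
    using modules[OF that] by (simp add: left_module_def abelian_group_def)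
  have subN: "submodule N R B"
  proof (rule B.sum.submoduleI')
    show "N \<subseteq> carrier B" by (auto simp: N_def)
    show "\<zero>\<^bsub>B\<^esub> \<in> N" using nonempty linear_map.zero[OF linear_map_level] by (auto simp: N_iff)
    show "a \<odot>\<^bsub>B\<^esub> x \<in> N" if ax: "a \<in> carrier R" "x \<in> N" for a x
    proof -
      obtain j where j: "j \<in> J" "\<forall>k\<in>J. (j, k) \<in> r \<longrightarrow> level k x = \<zero>\<^bsub>D k\<^esub>" "x \<in> carrier B"
        using ax(2) N_iff by blast
      have "\<forall>k\<in>J. (j, k) \<in> r \<longrightarrow> level k (a \<odot>\<^bsub>B\<^esub> x) = \<zero>\<^bsub>D k\<^esub>"
        using j ax(1) by (simp add: linear_map.smult[OF linear_map_level] left_module.smult_zero[OF modules])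
      then show ?thesis using j ax(1) by (auto simp: N_iff)
    qed
    show "x \<oplus>\<^bsub>B\<^esub> y \<in> N" if xy: "x \<in> N" "y \<in> N" for x y
    proof -
      obtain j j' where j: "j \<in> J" "\<forall>k\<in>J. (j, k) \<in> r \<longrightarrow> level k x = \<zero>\<^bsub>D k\<^esub>" "x \<in> carrier B"
        and j': "j' \<in> J" "\<forall>k\<in>J. (j', k) \<in> r \<longrightarrow> level k y = \<zero>\<^bsub>D k\<^esub>" "y \<in> carrier B"
        using xy N_iff by metis
      obtain m where m: "m \<in> J" "(j, m) \<in> Restr r J" "(j', m) \<in> Restr r J"
        by (rule finite_bounded[of "{j, j'}"]) (use j(1) j'(1) in auto)
      have "level k (x \<oplus>\<^bsub>B\<^esub> y) = \<zero>\<^bsub>D k\<^esub>" if "k \<in> J" "(m, k) \<in> r" for k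
      proof -
        have "(j, k) \<in> r" "(j', k) \<in> r" using m that trans by blast+
        then show ?thesis
          using j j' that(1) by (simp add: linear_map.add[OF linear_map_level]
              abelian_monoid.l_zero[OF mon] B.zero_component)
      qed
      then show ?thesis using m(1) j j' by (auto simp: N_iff)
    qed
  qed
  have smallB: "small TYPE('v) (carrier B)"
    using small_direct_sum[OF small_subset[OF J(1) I(1)], of D R] D J(1) by (auto simp: Modules_def)
  obtain T :: "('r, 'v) module" and q where T: "T \<in> Modules R" and q: "linear_map R B T q"
    and q0: "\<And>b. b \<in> carrier B \<Longrightarrow> q b = \<zero>\<^bsub>T\<^esub> \<longleftrightarrow> b \<in> N"
    using quotient_in_universe[OF B.sum.left_module_axioms subN smallB] by auto
  interpret q: linear_map R B T q by (rule q)
  have q_step: "q (summand J D j x) = q (summand J D k (f j k x))"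
    if jk: "j \<in> J" "k \<in> J" "(j, k) \<in> r" and x: "x \<in> carrier (D j)" for j k x
  proof -
    have fx: "f j k x \<in> carrier (D k)" using linear_map.closed[OF f_lin[OF jk(3)] x] .
    have s: "summand J D j x \<in> carrier B" "summand J D k (f j k x) \<in> carrier B"
      using B.summand_closed jk fx x by auto
    have "level l (summand J D j x \<ominus>\<^bsub>B\<^esub> summand J D k (f j k x)) = \<zero>\<^bsub>D l\<^esub>"
      if l: "l \<in> J" "(k, l) \<in> r" for l
    proof -
      have "(j, l) \<in> r" using jk(3) l(2) trans by blast
      then have eq: "level l (summand J D j x) = level l (summand J D k (f j k x))"
        using jk l x fx sys_comp[OF jk(3) l(2) x] by (simp add: level_summand transition_def)
      interpret Dl: left_module R "D l" using modules l(1) .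
      show ?thesis
        using eq s linear_map.closed[OF linear_map_level[OF l(1)]]
        by (simp add: linear_map.minus[OF linear_map_level[OF l(1)]] Dl.minus_eq_zero_iff)
    qed
    then have "summand J D j x \<ominus>\<^bsub>B\<^esub> summand J D k (f j k x) \<in> N"
      using jk(2) s by (auto simp: N_iff)
    then have "q (summand J D j x \<ominus>\<^bsub>B\<^esub> summand J D k (f j k x)) = \<zero>\<^bsub>T\<^esub>"
      using s by (simp add: q0)
    then show ?thesis using s by (simp add: q.minus q.cod.minus_eq_zero_iff)
  qed
  have q_eq: "q (summand J D j (f i j x)) = q (summand J D k (f i k x))"
    if "j \<in> J" "k \<in> J" "(i, j) \<in> r" "(i, k) \<in> r" "x \<in> carrier (D i)" for i j k x
  proof -
    have le: "q (summand J D j (f i j x)) = q (summand J D k (f i k x))"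
      if "j \<in> J" "k \<in> J" "(i, j) \<in> r" "(j, k) \<in> r" "x \<in> carrier (D i)" for j k
      using q_step[OF that(1,2,4) linear_map.closed[OF f_lin[OF that(3)] that(5)]] sys_comp[OF that(3-5)]
      by simp
    have "j \<in> I" "k \<in> I" using that J(1) by auto
    then show ?thesis using total[of j k] le[of j k] le[of k j] that by auto
  qed
  \<comment> \<open>A module of the original system maps to the quotient through any later member of the cofinal
    subsystem.\<close>
  obtain t where t: "\<And>i. i \<in> I \<Longrightarrow> t i \<in> J \<and> (i, t i) \<in> r" using cof by metis
  define \<psi> where "\<psi> i = (\<lambda>x\<in>carrier (D i). q (summand J D (t i) (f i (t i) x)))" for i
  have "cocone R I r D f T \<psi>"
    unfolding cocone_def
  proof (intro conjI ballI allI impI T)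
    show "\<psi> i \<in> mod_hom R (D i) T" if "i \<in> I" for i
      unfolding \<psi>_def
      using linear_map.mod_hom_restrict[OF linear_map_comp[OF linear_map_comp[OF f_lin
            B.linear_map_summand] q]] t[OF that] by blast
    show "\<psi> j (f i j x) = \<psi> i x" if ij: "(i, j) \<in> r" "x \<in> carrier (D i)" for i j x
    proof -
      have ti: "t i \<in> J" "(i, t i) \<in> r" and tj: "t j \<in> J" "(j, t j) \<in> r" using t rI[OF ij(1)] by auto
      have "\<psi> j (f i j x) = q (summand J D (t j) (f i (t j) x))"
        using linear_map.closed[OF f_lin[OF ij(1)] ij(2)] sys_comp[OF ij(1) tj(2) ij(2)] by (simp add: \<psi>_def)
      also have "\<dots> = \<psi> i x"
        using q_eq[OF tj(1) ti(1) _ ti(2) ij(2)] trans[OF ij(1) tj(2)] ij(2) by (simp add: \<psi>_def)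
      finally show ?thesis .
    qed
  qed
  then obtain u where u: "u \<in> mod_hom R M T" "\<And>i x. \<lbrakk>i \<in> I; x \<in> carrier (D i)\<rbrakk> \<Longrightarrow> u (\<phi> i x) = \<psi> i x"
    using univ by blast
  have u_lin: "linear_map R M T u" using linear_map_mod_hom[OF M(2) q.cod.left_module_axioms u(1)] .
  have uh: "u (?h b) = q b" if "b \<in> carrier B" for b
  proof (rule B.linear_maps_eqI[OF linear_map_comp[OF h.linear_map_cotuple u_lin] q _ that])
    fix j x assume jx: "j \<in> J" "x \<in> carrier (D j)"
    have j: "j \<in> I" using jx(1) J(1) by blast
    have "u (?h (summand J D j x)) = \<psi> j x" using h.cotuple_summand[OF jx] u(2)[OF j jx(2)] by simp
    also have "\<dots> = q (summand J D j x)"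
      using q_step[OF jx(1) _ _ jx(2), of "t j"] t[OF j] jx(2) by (simp add: \<psi>_def)
    finally show "u (?h (summand J D j x)) = q (summand J D j x)" .
  qed
  have "chain_limit R J (Restr r J) D f M \<phi>"
  proof (intro chain_limit.intro chain_limit_axioms.intro chain_axioms M(2) surj)
    show "linear_map R (D i) M (\<phi> i)" if "i \<in> J" for i using \<phi>_lin that J(1) by blast
    show "\<phi> j (f i j x) = \<phi> i x" if "(i, j) \<in> Restr r J" "x \<in> carrier (D i)" for i j x
      using \<phi>_compat that by blast
    show "\<exists>j\<in>J. \<forall>k. (j, k) \<in> Restr r J \<longrightarrow> level k b = \<zero>\<^bsub>D k\<^esub>"
      if "b \<in> carrier B" "?h b = \<zero>\<^bsub>M\<^esub>" for b
      using uh[OF that(1)] that linear_map.zero[OF u_lin] q0[OF that(1)] by (simp add: N_def)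
  qed
  then show thesis using that J(1) M(1) by blast
qed

section \<open>Classes closed under direct sums and free modules\<close>

locale closed_class = inaccessible_universe "TYPE('v)" + ring R
  for R :: "('r, 'm) ring_scheme" (structure) and \<X> :: "('r, 'v) module set" +
  assumes class_modules: "\<X> \<subseteq> Modules R"
    and sums: "closed_under_direct_sums R \<X>"
    and free: "closed_under_aleph1_free R \<X>"
begin

lemma modules_class: "X \<in> \<X> \<Longrightarrow> left_module R X"
  and small_class: "X \<in> \<X> \<Longrightarrow> small TYPE('v) (carrier X)"
  using class_modules by (auto simp: Modules_def)

text \<open>The index set is injected into the universe, where the closure property applies.\<close>

lemma direct_sum_in_class:
  fixes I :: "'i set"
  assumes I: "small TYPE('v) I" and D: "\<And>i. i \<in> I \<Longrightarrow> D i \<in> \<X>" and M: "M \<in> Modules R"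
    and t: "linear_map R (direct_sum R I D) M t" "bij_betw t (carrier (direct_sum R I D)) (carrier M)"
  shows "M \<in> \<X>"
proof -
  obtain e :: "'i \<Rightarrow> 'v" where e: "inj_on e I" using small_injection[OF I] by blast
  let ?I = "e ` I" and ?D = "\<lambda>i. D (inv_into I e i)"
  have inv: "inv_into I e (e i) = i" if "i \<in> I" for i using inv_into_f_f[OF e that] .
  have modD: "left_module R (D i)" if "i \<in> I" for i using D[OF that] modules_class by blast
  interpret S: module_family R I D
    by (intro module_family.intro module_family_axioms.intro ring_axioms modD)
  interpret S': module_family R ?I ?D
    by (intro module_family.intro module_family_axioms.intro ring_axioms) (use modD inv in auto)
  define reindex where "reindex p = (\<lambda>i\<in>?I. p (inv_into I e i))" for p :: "'i \<Rightarrow> 'v"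
  have closed: "reindex p \<in> carrier S'.S" if p: "p \<in> carrier S.S" for p
  proof (rule S'.direct_sumI)
    show "finite (e ` {i \<in> I. p i \<noteq> \<zero>\<^bsub>D i\<^esub>})" using S.finite_support[OF p] by simp
  qed (use p S.in_family inv in \<open>auto simp: reindex_def\<close>)
  have lin: "linear_map R S.S S'.S reindex"
  proof
    show "reindex (p \<oplus>\<^bsub>S.S\<^esub> p') = reindex p \<oplus>\<^bsub>S'.S\<^esub> reindex p'"
      if "p \<in> carrier S.S" "p' \<in> carrier S.S" for p p'
      by (rule S'.direct_sum_eqI)
        (use that closed inv in \<open>auto, auto simp: reindex_def direct_sum_component\<close>)
    show "reindex (a \<odot>\<^bsub>S.S\<^esub> p) = a \<odot>\<^bsub>S'.S\<^esub> reindex p" if "a \<in> carrier R" "p \<in> carrier S.S" for a p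
      by (rule S'.direct_sum_eqI)
        (use that closed inv in \<open>auto, auto simp: reindex_def direct_sum_component\<close>)
  qed (rule closed)
  have bij: "bij_betw reindex (carrier S.S) (carrier S'.S)"
  proof (rule bij_betwI[where g = "\<lambda>p'. \<lambda>i\<in>I. p' (e i)"])
    show "reindex \<in> carrier S.S \<rightarrow> carrier S'.S" using closed by blast
    show "(\<lambda>p'. \<lambda>i\<in>I. p' (e i)) \<in> carrier S'.S \<rightarrow> carrier S.S"
    proof
      fix p' assume p': "p' \<in> carrier S'.S"
      show "(\<lambda>i\<in>I. p' (e i)) \<in> carrier S.S"
      proof (rule S.direct_sumI)
        show "finite (inv_into I e ` {i \<in> ?I. p' i \<noteq> \<zero>\<^bsub>?D i\<^esub>})" using S'.finite_support[OF p'] by simp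
        show "(\<lambda>i\<in>I. p' (e i)) i = \<zero>\<^bsub>D i\<^esub>"
          if "i \<in> I - inv_into I e ` {i \<in> ?I. p' i \<noteq> \<zero>\<^bsub>?D i\<^esub>}" for i
        proof (rule ccontr)
          assume "(\<lambda>i\<in>I. p' (e i)) i \<noteq> \<zero>\<^bsub>D i\<^esub>"
          then have "e i \<in> {i \<in> ?I. p' i \<noteq> \<zero>\<^bsub>?D i\<^esub>}" using that inv by auto
          then have "inv_into I e (e i) \<in> inv_into I e ` {i \<in> ?I. p' i \<noteq> \<zero>\<^bsub>?D i\<^esub>}" by (rule imageI)
          then show False using that inv by auto
        qed
        show "(\<lambda>i\<in>I. p' (e i)) i \<in> carrier (D i)" if "i \<in> I" for i
          using S'.in_family[OF p', of "e i"] inv[OF that] that by simp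
      qed simp
    qed
    show "(\<lambda>i\<in>I. reindex p (e i)) = p" if "p \<in> carrier S.S" for p
      using that inv by (auto simp: reindex_def direct_sum_simps PiE_def intro!: extensionalityI[where A = I])
    show "reindex (\<lambda>i\<in>I. p' (e i)) = p'" if "p' \<in> carrier S'.S" for p'
      using that inv by (auto simp: reindex_def direct_sum_simps PiE_def intro!: extensionalityI[where A = ?I])
  qed
  have "mod_isomorphic R M S'.S"
  proof (rule mod_isomorphicI)
    show "linear_map R M S'.S (\<lambda>x. reindex (inv_into (carrier S.S) t x))"
      using linear_map_comp[OF linear_map_inv_into[OF t] lin] .
    show "bij_betw (\<lambda>x. reindex (inv_into (carrier S.S) t x)) (carrier M) (carrier S'.S)"
      using bij_betw_trans[OF bij_betw_inv_into[OF t(2)] bij] by (simp add: comp_def)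
  qed
  moreover have "?D i \<in> \<X>" if "i \<in> ?I" for i using that D inv by auto
  ultimately show ?thesis
    using sums[unfolded closed_under_direct_sums_def, rule_format, of ?I ?D M] M small_image[OF I, of e]
    by simp
qed

lemma isomorphic_in_class:
  assumes X: "X \<in> \<X>" and M: "M \<in> Modules R" and t: "linear_map R X M t" "bij_betw t (carrier X) (carrier M)"
  shows "M \<in> \<X>"
proof (rule direct_sum_in_class)
  interpret S: module_family R "{()}" "\<lambda>_. X"
    by (intro module_family.intro module_family_axioms.intro ring_axioms modules_class X)
  have ev: "linear_map R S.S X (\<lambda>p. p ())"
    by (intro linear_map.intro linear_map_axioms.intro S.left_module_direct_sum modules_class X)
      (auto simp: S.in_family direct_sum_component)
  show "small TYPE('v) {()}" by (simp add: small_countable)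
  show "linear_map R S.S M (\<lambda>p. t (p ()))" by (rule linear_map_comp[OF ev t(1)])
  have "bij_betw (\<lambda>p. p ()) (carrier S.S) (carrier X)"
  proof (rule bij_betwI[where g = "summand {()} (\<lambda>_. X) ()"])
    show "(\<lambda>p. p ()) \<in> carrier S.S \<rightarrow> carrier X" by (simp add: S.in_family)
    show "summand {()} (\<lambda>_. X) () \<in> carrier X \<rightarrow> carrier S.S" by (simp add: S.summand_closed)
    show "summand {()} (\<lambda>_. X) () (p ()) = p" if "p \<in> carrier S.S" for p
      by (rule S.direct_sum_eqI) (use that in \<open>simp_all add: S.summand_closed S.in_family S.summand_component\<close>)
    show "summand {()} (\<lambda>_. X) () x () = x" if "x \<in> carrier X" for x by (simp add: summand_def)
  qed
  from bij_betw_trans[OF this t(2)]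
  show "bij_betw (\<lambda>p. t (p ())) (carrier S.S) (carrier M)" by (simp add: comp_def)
qed (use X M in auto)

end

section \<open>The tree module\<close>

text \<open>
  Monotonicity of \<open>U\<close> makes the traces of a branch form a path: branches that agree at a level agree
  below it.
\<close>

locale tree = chain R J r D f
  for R :: "('r, 'm) ring_scheme" (structure)
    and J :: "'i set" and r :: "'i rel" and D :: "'i \<Rightarrow> ('r, 'a, 'n) module_scheme"
    and f :: "'i \<Rightarrow> 'i \<Rightarrow> 'a \<Rightarrow> 'a" +
  fixes U :: "'i \<Rightarrow> 'u set"
  assumes U_mono: "(i, j) \<in> r \<Longrightarrow> U i \<subseteq> U j"
begin

definition branches :: "'u set set" where "branches = Pow (\<Union>i\<in>J. U i)"

abbreviation P :: "('r, 'u set \<Rightarrow> 'i \<Rightarrow> 'a) module" where "P \<equiv> direct_sum R branches (\<lambda>_. B)"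

sublocale P: module_family R branches "\<lambda>_. B"
  by (intro module_family.intro module_family_axioms.intro ring_axioms B.left_module_direct_sum)

abbreviation branch :: "'u set \<Rightarrow> ('i \<Rightarrow> 'a) \<Rightarrow> 'u set \<Rightarrow> 'i \<Rightarrow> 'a"
  where "branch \<equiv> summand branches (\<lambda>_. B)"

definition gen :: "'u set \<Rightarrow> 'i \<Rightarrow> 'a \<Rightarrow> 'u set \<Rightarrow> 'i \<Rightarrow> 'a"
  where "gen \<eta> i x = branch \<eta> (summand J D i x)"

text \<open>
  The value of an element of \<open>P\<close> at the node \<open>s\<close> of level \<open>j\<close>, to which all branches through that node
  contribute.
\<close>

definition node :: "'i \<Rightarrow> 'u set \<Rightarrow> ('u set \<Rightarrow> 'i \<Rightarrow> 'a) \<Rightarrow> 'a"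
  where "node j s = cotuple R branches (\<lambda>_. B) (D j)
    (\<lambda>\<eta>. if \<eta> \<inter> U j = s then level j else (\<lambda>_. \<zero>\<^bsub>D j\<^esub>))"

definition N :: "('u set \<Rightarrow> 'i \<Rightarrow> 'a) set"
  where "N = {p \<in> carrier P. \<forall>j\<in>J. \<forall>s. node j s p = \<zero>\<^bsub>D j\<^esub>}"

lemma cotuple_family_node:
  assumes "j \<in> J"
  shows "cotuple_family R branches (\<lambda>_. B) (D j) (\<lambda>\<eta>. if \<eta> \<inter> U j = s then level j else (\<lambda>_. \<zero>\<^bsub>D j\<^esub>))"
  by (intro cotuple_family.intro cotuple_family_axioms.intro P.module_family_axioms modules assms)
    (simp add: linear_map_level assms linear_map_zero modules B.left_module_direct_sum)

lemma linear_map_node: "j \<in> J \<Longrightarrow> linear_map R P (D j) (node j s)"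
  unfolding node_def by (rule cotuple_family.linear_map_cotuple[OF cotuple_family_node])

lemma node_branch:
  "\<lbrakk>\<eta> \<in> branches; j \<in> J; b \<in> carrier B\<rbrakk> \<Longrightarrow>
    node j s (branch \<eta> b) = (if \<eta> \<inter> U j = s then level j b else \<zero>\<^bsub>D j\<^esub>)"
  unfolding node_def by (subst cotuple_family.cotuple_summand[OF cotuple_family_node]) auto

lemma linear_map_gen: "\<lbrakk>\<eta> \<in> branches; i \<in> J\<rbrakk> \<Longrightarrow> linear_map R (D i) P (gen \<eta> i)"
  unfolding gen_def by (rule linear_map_comp[OF B.linear_map_summand P.linear_map_summand])

lemma gen_closed: "\<lbrakk>\<eta> \<in> branches; i \<in> J; x \<in> carrier (D i)\<rbrakk> \<Longrightarrow> gen \<eta> i x \<in> carrier P"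
  using linear_map.closed[OF linear_map_gen] .

lemma node_gen:
  "\<lbrakk>\<eta> \<in> branches; i \<in> J; j \<in> J; x \<in> carrier (D i)\<rbrakk> \<Longrightarrow>
    node j s (gen \<eta> i x) = (if \<eta> \<inter> U j = s then transition i j x else \<zero>\<^bsub>D j\<^esub>)"
  unfolding gen_def by (simp add: node_branch B.summand_closed level_summand)

lemma submodule_N: "submodule N R P"
proof (rule P.sum.submoduleI')
  have mon: "abelian_monoid (D k)" if "k \<in> J" for k
    using modules[OF that] by (simp add: left_module_def abelian_group_def)
  show "\<zero>\<^bsub>P\<^esub> \<in> N" by (simp add: N_def linear_map.zero[OF linear_map_node])
  show "x \<oplus>\<^bsub>P\<^esub> y \<in> N" if "x \<in> N" "y \<in> N" for x y
    using that by (simp add: N_def linear_map.add[OF linear_map_node] abelian_monoid.l_zero[OF mon]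
        B.zero_component)
  show "a \<odot>\<^bsub>P\<^esub> x \<in> N" if "a \<in> carrier R" "x \<in> N" for a x
    using that by (simp add: N_def linear_map.smult[OF linear_map_node] left_module.smult_zero[OF modules])
qed (auto simp: N_def)

lemma agree_below: "\<lbrakk>\<eta> \<inter> U j = \<eta>' \<inter> U j; (i, j) \<in> r\<rbrakk> \<Longrightarrow> \<eta> \<inter> U i = \<eta>' \<inter> U i"
  using U_mono by blast

lemma separated:
  assumes "\<eta> \<in> branches" "\<eta>' \<in> branches" "\<eta> \<noteq> \<eta>'"
  obtains j where "j \<in> J" "\<eta> \<inter> U j \<noteq> \<eta>' \<inter> U j"
proof -
  obtain u where u: "u \<in> \<eta> \<and> u \<notin> \<eta>' \<or> u \<notin> \<eta> \<and> u \<in> \<eta>'" using assms(3) by blast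
  then obtain j where "j \<in> J" "u \<in> U j" using assms(1,2) by (auto simp: branches_def)
  with u show thesis using that[of j] by blast
qed

text \<open>
  At the least level \<open>j\<close> where \<open>\<eta>\<close> is separated from all of \<open>E\<close>, the part of \<open>\<eta>\<close> below \<open>j\<close> coincides with
  that of a single member of \<open>E\<close>: otherwise each member is separated from \<open>\<eta>\<close> at some level below \<open>j\<close>,
  and the largest of these finitely many levels contradicts the choice of \<open>j\<close>.
\<close>

lemma separation_level:
  assumes E: "finite E" "E \<subseteq> branches" and \<eta>: "\<eta> \<in> branches" "\<eta> \<notin> E"
  shows "\<exists>j\<in>J. (\<forall>\<eta>'\<in>E. \<eta> \<inter> U j \<noteq> \<eta>' \<inter> U j) \<and>
    (\<forall>i\<in>J. (j, i) \<notin> r \<longrightarrow> (\<exists>\<eta>'\<in>E. \<forall>l\<in>J. (j, l) \<notin> r \<longrightarrow> \<eta> \<inter> U l = \<eta>' \<inter> U l))"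
proof -
  define S where "S = {j \<in> J. \<forall>\<eta>'\<in>E. \<eta> \<inter> U j \<noteq> \<eta>' \<inter> U j}"
  have "\<exists>j\<in>J. \<eta> \<inter> U j \<noteq> \<eta>' \<inter> U j" if "\<eta>' \<in> E" for \<eta>'
    using separated[of \<eta> \<eta>'] \<eta> E(2) that by blast
  then obtain d where d: "\<And>\<eta>'. \<eta>' \<in> E \<Longrightarrow> d \<eta>' \<in> J \<and> \<eta> \<inter> U (d \<eta>') \<noteq> \<eta>' \<inter> U (d \<eta>')" by metis
  obtain m where m: "m \<in> J" "\<And>i. i \<in> d ` E \<Longrightarrow> (i, m) \<in> r"
    by (rule finite_bounded[of "d ` E"]) (use E(1) d in auto)
  have "\<eta> \<inter> U m \<noteq> \<eta>' \<inter> U m" if "\<eta>' \<in> E" for \<eta>'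
    using d[OF that] agree_below[of \<eta> m \<eta>' "d \<eta>'"] m(2) that by auto
  then have "S \<noteq> {}" "S \<subseteq> J" using m(1) by (auto simp: S_def)
  then obtain j where j: "j \<in> S" "\<And>s. s \<in> S \<Longrightarrow> (j, s) \<in> r" using least by blast
  show ?thesis
  proof (intro bexI[of _ j] conjI ballI impI)
    show "j \<in> J" "\<And>\<eta>'. \<eta>' \<in> E \<Longrightarrow> \<eta> \<inter> U j \<noteq> \<eta>' \<inter> U j" using j(1) by (auto simp: S_def)
    fix i assume i: "i \<in> J" "(j, i) \<notin> r"
    show "\<exists>\<eta>'\<in>E. \<forall>l\<in>J. (j, l) \<notin> r \<longrightarrow> \<eta> \<inter> U l = \<eta>' \<inter> U l"
    proof (rule ccontr)
      assume "\<not> ?thesis"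
      then obtain c where c: "\<And>\<eta>'. \<eta>' \<in> E \<Longrightarrow> c \<eta>' \<in> J \<and> (j, c \<eta>') \<notin> r \<and> \<eta> \<inter> U (c \<eta>') \<noteq> \<eta>' \<inter> U (c \<eta>')"
        by metis
      obtain k where k: "k \<in> insert i (c ` E)" "\<And>l. l \<in> insert i (c ` E) \<Longrightarrow> (l, k) \<in> r"
        by (rule finite_max[of "insert i (c ` E)"]) (use E(1) c i(1) in auto)
      have "(j, k) \<notin> r" "k \<in> J" using k(1) i c by auto
      moreover have "\<eta> \<inter> U k \<noteq> \<eta>' \<inter> U k" if "\<eta>' \<in> E" for \<eta>'
        using c[OF that] agree_below[of \<eta> k \<eta>' "c \<eta>'"] k(2) that by auto
      then have "k \<in> S" using \<open>k \<in> J\<close> by (simp add: S_def)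
      ultimately show False using j(2) by blast
    qed
  qed
qed

lemma separating_level:
  assumes "finite E" "E \<subseteq> branches" "\<eta> \<in> branches" "\<eta> \<notin> E"
  obtains j where "j \<in> J" "\<forall>\<eta>'\<in>E. \<eta> \<inter> U j \<noteq> \<eta>' \<inter> U j"
  using separation_level[OF assms] by (elim bexE conjE)

end

text \<open>The tree module \<open>L\<close> is an incarnation of \<open>P / N\<close> inside the universe.\<close>

locale tree_module = tree R J r D f U + closed_class R \<X>
  for R :: "('r, 'm) ring_scheme" (structure)
    and J :: "'i set" and r :: "'i rel" and D :: "'i \<Rightarrow> ('r, 'v) module"
    and f :: "'i \<Rightarrow> 'i \<Rightarrow> 'v \<Rightarrow> 'v" and U :: "'i \<Rightarrow> 'u set" and \<X> :: "('r, 'v) module set" +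
  fixes L :: "('r, 'v) module" and q :: "('u set \<Rightarrow> 'i \<Rightarrow> 'v) \<Rightarrow> 'v"
  assumes J_small: "small TYPE('v) J" and D_class: "j \<in> J \<Longrightarrow> D j \<in> \<X>"
    and L_module: "L \<in> Modules R" and q_linear: "linear_map R P L q"
    and q_surj: "q ` carrier P = carrier L"
    and q_kernel: "p \<in> carrier P \<Longrightarrow> q p = \<zero>\<^bsub>L\<^esub> \<longleftrightarrow> p \<in> N"
begin

sublocale q: linear_map R P L q by (rule q_linear)

definition spread :: "'u set set \<Rightarrow> ('u set \<Rightarrow> 'i \<Rightarrow> 'v) \<Rightarrow> 'v"
  where "spread A = cotuple R A (\<lambda>_. B) L (\<lambda>\<eta> b. q (branch \<eta> b))"

text \<open>The submodule of \<open>L\<close> generated by the branches in \<open>A\<close>.\<close>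

definition span :: "'u set set \<Rightarrow> 'v set"
  where "span A = spread A ` carrier (direct_sum R A (\<lambda>_. B))"

lemma cotuple_family_spread:
  assumes "A \<subseteq> branches"
  shows "cotuple_family R A (\<lambda>_. B) L (\<lambda>\<eta> b. q (branch \<eta> b))"
  by (intro cotuple_family.intro cotuple_family_axioms.intro module_family.intro
      module_family_axioms.intro ring_axioms B.left_module_direct_sum q.cod.left_module_axioms
      linear_map_comp[OF P.linear_map_summand q_linear]) (use assms in blast)

lemma submodule_span:
  assumes "A \<subseteq> branches" shows "submodule (span A) R L"
proof -
  interpret A: cotuple_family R A "\<lambda>_. B" L "\<lambda>\<eta> b. q (branch \<eta> b)" by (rule cotuple_family_spread[OF assms])
  have "submodule (carrier (direct_sum R A (\<lambda>_. B))) R (direct_sum R A (\<lambda>_. B))"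
    by (rule A.sum.submoduleI') auto
  then show ?thesis unfolding span_def spread_def by (rule A.submodule_image)
qed

lemma branch_in_span:
  assumes "A \<subseteq> branches" "\<eta> \<in> A" "b \<in> carrier B"
  shows "q (branch \<eta> b) \<in> span A"
proof -
  interpret A: cotuple_family R A "\<lambda>_. B" L "\<lambda>\<eta> b. q (branch \<eta> b)" by (rule cotuple_family_spread[OF assms(1)])
  have "q (branch \<eta> b) = spread A (summand A (\<lambda>_. B) \<eta> b)"
    unfolding spread_def using A.cotuple_summand[OF assms(2,3)] by simp
  then show ?thesis unfolding span_def using A.summand_closed[OF assms(2,3)] by blast
qed

lemma gen_in_span:
  assumes "A \<subseteq> branches" "\<eta> \<in> A" "i \<in> J" "x \<in> carrier (D i)"
  shows "q (gen \<eta> i x) \<in> span A"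
  unfolding gen_def using branch_in_span[OF assms(1,2) B.summand_closed] assms(3,4) .

lemma span_least:
  assumes A: "A \<subseteq> branches" and T: "submodule T R L"
    and gen: "\<And>\<eta> i x. \<lbrakk>\<eta> \<in> A; i \<in> J; x \<in> carrier (D i)\<rbrakk> \<Longrightarrow> q (gen \<eta> i x) \<in> T"
  shows "span A \<subseteq> T"
proof -
  interpret A: cotuple_family R A "\<lambda>_. B" L "\<lambda>\<eta> b. q (branch \<eta> b)" by (rule cotuple_family_spread[OF A])
  have br: "q (branch \<eta> b) \<in> T" if \<eta>: "\<eta> \<in> A" and b: "b \<in> carrier B" for \<eta> b
  proof (rule B.linear_map_into_submodule[OF linear_map_comp[OF P.linear_map_summand q_linear] T _ b])
    show "\<eta> \<in> branches" using \<eta> A by blast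
    show "q (branch \<eta> (summand J D i x)) \<in> T" if "i \<in> J" "x \<in> carrier (D i)" for i x
      using gen[OF \<eta> that] by (simp add: gen_def)
  qed
  have "spread A p \<in> T" if "p \<in> carrier (direct_sum R A (\<lambda>_. B))" for p
    unfolding spread_def
    by (rule A.linear_map_into_submodule[OF A.linear_map_cotuple T _ that]) (simp add: A.cotuple_summand br)
  then show ?thesis by (auto simp: span_def)
qed

lemma span_mono: "A \<subseteq> A' \<Longrightarrow> A' \<subseteq> branches \<Longrightarrow> span A \<subseteq> span A'"
  by (rule span_least) (auto intro: submodule_span gen_in_span)

lemma in_finite_span:
  assumes "x \<in> carrier L"
  obtains A where "finite A" "A \<subseteq> branches" "x \<in> span A"
proof -
  have "\<exists>A. finite A \<and> A \<subseteq> branches \<and> q p \<in> span A" if "p \<in> carrier P" for p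
    using that
  proof (induction rule: P.direct_sum_induct)
    case zero
    then show ?case using submodule_facts(2)[OF submodule_span[of "{}"]] by auto
  next
    case (summand \<eta> b)
    then show ?case using branch_in_span[of "{\<eta>}" \<eta> b] by (intro exI[of _ "{\<eta>}"]) simp
  next
    case (add p p')
    then obtain A A' where A: "finite A" "A \<subseteq> branches" "q p \<in> span A"
      and A': "finite A'" "A' \<subseteq> branches" "q p' \<in> span A'" by blast
    have AA': "A \<union> A' \<subseteq> branches" using A A' by blast
    have "q p \<in> span (A \<union> A')" "q p' \<in> span (A \<union> A')"
      using A(3) A'(3) span_mono[OF _ AA'] by blast+
    then have "q (p \<oplus>\<^bsub>P\<^esub> p') \<in> span (A \<union> A')"
      using add.hyps submodule_facts(3)[OF submodule_span[OF AA']] by (simp add: q.add)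
    then show ?case using A(1) A'(1) AA' by (intro exI[of _ "A \<union> A'"]) simp
  qed
  moreover have "x \<in> q ` carrier P" using assms by (simp add: q_surj)
  then obtain p where "p \<in> carrier P" "x = q p" by blast
  ultimately show thesis using that by blast
qed

text \<open>
  The union of a chain of submodules is a submodule, and this one contains all generators of the right-hand
  side.
\<close>

lemma span_UN_chain:
  assumes ne: "K \<noteq> {}" and A: "\<And>k. k \<in> K \<Longrightarrow> A k \<subseteq> branches"
    and chain: "\<And>k l. \<lbrakk>k \<in> K; l \<in> K\<rbrakk> \<Longrightarrow> span (A k) \<subseteq> span (A l) \<or> span (A l) \<subseteq> span (A k)"
  shows "(\<Union>k\<in>K. span (A k)) = span (\<Union>k\<in>K. A k)"
proof
  have UA: "(\<Union>k\<in>K. A k) \<subseteq> branches" using A by blast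
  show "(\<Union>k\<in>K. span (A k)) \<subseteq> span (\<Union>k\<in>K. A k)"
    using span_mono[OF _ UA] by blast
  show "span (\<Union>k\<in>K. A k) \<subseteq> (\<Union>k\<in>K. span (A k))"
  proof (rule span_least[OF UA])
    note S = submodule_facts[OF submodule_span[OF A]]
    show "submodule (\<Union>k\<in>K. span (A k)) R L"
    proof (rule q.cod.submoduleI')
      show "(\<Union>k\<in>K. span (A k)) \<subseteq> carrier L" using S(1) by blast
      show "\<zero>\<^bsub>L\<^esub> \<in> (\<Union>k\<in>K. span (A k))" using S(2) ne by blast
      show "a \<odot>\<^bsub>L\<^esub> x \<in> (\<Union>k\<in>K. span (A k))" if "a \<in> carrier R" "x \<in> (\<Union>k\<in>K. span (A k))" for a x
        using S(4) that by blast
      show "x \<oplus>\<^bsub>L\<^esub> y \<in> (\<Union>k\<in>K. span (A k))"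
        if xy: "x \<in> (\<Union>k\<in>K. span (A k))" "y \<in> (\<Union>k\<in>K. span (A k))" for x y
      proof -
        obtain k l where kl: "k \<in> K" "x \<in> span (A k)" "l \<in> K" "y \<in> span (A l)"
          using xy by blast
        then have "(x \<in> span (A l) \<and> y \<in> span (A l)) \<or> (x \<in> span (A k) \<and> y \<in> span (A k))"
          using chain[of k l] by blast
        then show ?thesis using S(3) kl by blast
      qed
    qed
    show "q (gen \<eta> i x) \<in> (\<Union>k\<in>K. span (A k))"
      if "\<eta> \<in> (\<Union>k\<in>K. A k)" "i \<in> J" "x \<in> carrier (D i)" for \<eta> i x
    proof -
      obtain k where "k \<in> K" "\<eta> \<in> A k" using \<open>\<eta> \<in> _\<close> by blast
      then show ?thesis using gen_in_span[OF A _ that(2,3)] by blast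
    qed
  qed
qed

text \<open>
  Enumerate \<open>A\<close> by \<open>k\<close> and let \<open>g \<eta>\<close> be the first level where \<open>\<eta>\<close> is separated from all branches that
  come earlier. The span of \<open>A\<close> is the direct sum of the modules \<open>D i\<close> placed on \<open>\<eta>\<close> for \<open>i \<ge> g \<eta>\<close>, which
  are indexed by \<open>Idx\<close>. The generators with \<open>i < g \<eta>\<close> are redundant because there \<open>\<eta>\<close> runs along an
  earlier branch.
\<close>

lemma countable_span_in_class:
  assumes A: "A \<subseteq> branches" "countable A"
  shows "L\<lparr>carrier := span A\<rparr> \<in> \<X>"
proof -
  obtain k :: "'u set \<Rightarrow> nat" where k: "inj_on k A" using A(2) by (auto simp: countable_def)
  let ?E = "\<lambda>\<eta>. {\<eta>' \<in> A. k \<eta>' < k \<eta>}"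
  have fin: "finite (?E \<eta>)" for \<eta>
  proof (rule finite_imageD[where f = k])
    show "finite (k ` ?E \<eta>)" by (rule finite_subset[of _ "{..<k \<eta>}"]) auto
    show "inj_on k (?E \<eta>)" using k by (rule inj_on_subset) auto
  qed
  define sep where "sep \<eta> j \<longleftrightarrow> (\<forall>\<eta>'\<in>?E \<eta>. \<eta> \<inter> U j \<noteq> \<eta>' \<inter> U j) \<and>
      (\<forall>i\<in>J. (j, i) \<notin> r \<longrightarrow> (\<exists>\<eta>'\<in>?E \<eta>. \<forall>l\<in>J. (j, l) \<notin> r \<longrightarrow> \<eta> \<inter> U l = \<eta>' \<inter> U l))" for \<eta> j
  have "\<exists>j\<in>J. sep \<eta> j" if "\<eta> \<in> A" for \<eta>
    unfolding sep_def by (rule separation_level[OF fin]) (use A(1) that in auto)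
  then obtain g where g_sep': "\<And>\<eta>. \<eta> \<in> A \<Longrightarrow> g \<eta> \<in> J \<and> sep \<eta> (g \<eta>)" by metis
  have g: "g \<eta> \<in> J" if "\<eta> \<in> A" for \<eta> using g_sep'[OF that] by blast
  have g_sep: "\<eta> \<inter> U (g \<eta>) \<noteq> \<eta>' \<inter> U (g \<eta>)" if "\<eta> \<in> A" "\<eta>' \<in> A" "k \<eta>' < k \<eta>" for \<eta> \<eta>'
    using g_sep'[OF that(1)] that(2,3) by (simp add: sep_def)
  have g_agree: "\<exists>\<eta>'\<in>A. k \<eta>' < k \<eta> \<and> (\<forall>l\<in>J. (g \<eta>, l) \<notin> r \<longrightarrow> \<eta> \<inter> U l = \<eta>' \<inter> U l)"
    if "\<eta> \<in> A" "i \<in> J" "(g \<eta>, i) \<notin> r" for \<eta> i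
  proof -
    have "\<exists>\<eta>'\<in>?E \<eta>. \<forall>l\<in>J. (g \<eta>, l) \<notin> r \<longrightarrow> \<eta> \<inter> U l = \<eta>' \<inter> U l"
      using g_sep'[OF that(1)] that(2,3) unfolding sep_def by meson
    then obtain \<eta>' where "\<eta>' \<in> ?E \<eta>" "\<forall>l\<in>J. (g \<eta>, l) \<notin> r \<longrightarrow> \<eta> \<inter> U l = \<eta>' \<inter> U l" ..
    then show ?thesis by (intro bexI[of _ \<eta>']) simp_all
  qed
  define Idx where "Idx = {(\<eta>, i). \<eta> \<in> A \<and> (g \<eta>, i) \<in> r}"
  let ?D = "\<lambda>p :: 'u set \<times> 'i. D (snd p)"
  have Idx: "fst p \<in> A" "snd p \<in> J" "(g (fst p), snd p) \<in> r" "fst p \<in> branches" if "p \<in> Idx" for p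
    using that A(1) r_snd by (auto simp: Idx_def)
  interpret S: module_family R Idx ?D
    by (intro module_family.intro module_family_axioms.intro ring_axioms modules Idx(2))
  define G where "G p x = gen (fst p) (snd p) x" for p x
  define \<theta> where "\<theta> = cotuple R Idx ?D P G"
  interpret \<theta>: cotuple_family R Idx ?D P G
    unfolding G_def
    by (intro cotuple_family.intro cotuple_family_axioms.intro S.module_family_axioms
        P.left_module_direct_sum linear_map_gen Idx(2,4))
  have \<theta>_lin: "linear_map R S.S P \<theta>" unfolding \<theta>_def by (rule \<theta>.linear_map_cotuple)
  have q\<theta>: "linear_map R S.S L (\<lambda>p. q (\<theta> p))" by (rule linear_map_comp[OF \<theta>_lin q_linear])
  have \<theta>_gen: "\<theta> (summand Idx ?D (\<eta>, i) x) = gen \<eta> i x" if "(\<eta>, i) \<in> Idx" "x \<in> carrier (D i)" for \<eta> i x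
    unfolding \<theta>_def using \<theta>.cotuple_summand[OF that(1)] that(2) by (simp add: G_def)
  let ?T = "(\<lambda>p. q (\<theta> p)) ` carrier S.S"

  have node_\<theta>: "node j s (\<theta> p) = cotuple R Idx ?D (D j)
      (\<lambda>p. if fst p \<inter> U j = s then transition (snd p) j else (\<lambda>_. \<zero>\<^bsub>D j\<^esub>)) p"
    if j: "j \<in> J" and p: "p \<in> carrier S.S" for j s p
  proof -
    have c: "cotuple_family R Idx ?D (D j)
      (\<lambda>p. if fst p \<inter> U j = s then transition (snd p) j else (\<lambda>_. \<zero>\<^bsub>D j\<^esub>))"
      by (intro cotuple_family.intro cotuple_family_axioms.intro S.module_family_axioms modules j)
        (simp add: linear_map_transition linear_map_zero modules Idx j)
    show ?thesis
    proof (rule S.linear_maps_eqI[OF linear_map_comp[OF \<theta>_lin linear_map_node[OF j]]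
          cotuple_family.linear_map_cotuple[OF c] _ p])
      fix p x assume px: "p \<in> Idx" "x \<in> carrier (D (snd p))"
      obtain \<eta> i where "p = (\<eta>, i)" by (cases p)
      with px show "node j s (\<theta> (summand Idx ?D p x)) = cotuple R Idx ?D (D j)
          (\<lambda>p. if fst p \<inter> U j = s then transition (snd p) j else (\<lambda>_. \<zero>\<^bsub>D j\<^esub>)) (summand Idx ?D p x)"
        using Idx[OF px(1)] j by (simp add: cotuple_family.cotuple_summand[OF c] \<theta>_gen node_gen)
    qed
  qed

  \<comment> \<open>Among the nonzero components of \<open>p\<close> choose one on the last branch \<open>\<eta>\<close> and there at the least level \<open>i\<close>.
    At the node \<open>\<eta> \<inter> U i\<close> the earlier branches are absent, as \<open>i \<ge> g \<eta>\<close>, and the other components on \<open>\<eta>\<close>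
    start later, so only the chosen component is seen.\<close>
  have inj: "p = \<zero>\<^bsub>S.S\<^esub>" if p: "p \<in> carrier S.S" and "q (\<theta> p) = \<zero>\<^bsub>L\<^esub>" for p
  proof (rule ccontr)
    assume "p \<noteq> \<zero>\<^bsub>S.S\<^esub>"
    let ?F = "{x \<in> Idx. p x \<noteq> \<zero>\<^bsub>?D x\<^esub>}"
    have fin: "finite ?F" by (rule S.finite_support[OF p])
    have "?F \<noteq> {}"
      using S.direct_sum_eqI[OF p S.sum.M.zero_closed] \<open>p \<noteq> _\<close> by (auto simp: direct_sum_component)
    then have ne: "k ` fst ` ?F \<noteq> {}" and fin': "finite (k ` fst ` ?F)" using fin by auto
    obtain \<eta> where \<eta>: "\<eta> \<in> fst ` ?F" "Max (k ` fst ` ?F) = k \<eta>"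
      using Max_in[OF fin' ne] by (rule imageE)
    have \<eta>_max: "k \<eta>' \<le> k \<eta>" if "\<eta>' \<in> fst ` ?F" for \<eta>'
      using Max_ge[OF fin' imageI[OF that]] \<eta>(2) by simp
    let ?S = "{i. (\<eta>, i) \<in> ?F}"
    have "?S \<subseteq> J" "?S \<noteq> {}" using \<eta>(1) Idx(2) by auto
    then obtain i where i: "i \<in> ?S" "\<And>i'. i' \<in> ?S \<Longrightarrow> (i, i') \<in> r" using least[of ?S] by blast
    have \<eta>i: "(\<eta>, i) \<in> Idx" "\<eta> \<in> A" "i \<in> J" "(g \<eta>, i) \<in> r" using i(1) Idx[of "(\<eta>, i)"] by auto
    interpret Di: left_module R "D i" by (rule modules[OF \<eta>i(3)])
    let ?u = "\<lambda>x. (if fst x \<inter> U i = \<eta> \<inter> U i then transition (snd x) i else (\<lambda>_. \<zero>\<^bsub>D i\<^esub>)) (p x)"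
    have "?u x = (if x = (\<eta>, i) then p (\<eta>, i) else \<zero>\<^bsub>D i\<^esub>)" if x: "x \<in> ?F" for x
    proof (cases "x = (\<eta>, i)")
      case True
      then show ?thesis
        using \<eta>i S.in_family[OF p \<eta>i(1)] by (simp add: transition_def r_refl f_id)
    next
      case False
      obtain \<eta>' i' where x': "x = (\<eta>', i')" by (cases x)
      have \<eta>': "\<eta>' \<in> A" "i' \<in> J" using x x' Idx[of x] by auto
      have "k \<eta>' \<le> k \<eta>" using \<eta>_max[of \<eta>'] x x' by force
      show ?thesis
      proof (cases "\<eta>' = \<eta>")
        case True
        then have "(i, i') \<in> r" and ne: "i \<noteq> i'" using i(2) x x' False by auto
        then have "(i', i) \<notin> r" using r_antisym by blast
        then show ?thesis using ne x' by (simp add: transition_def)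
      next
        case False
        then have "k \<eta>' \<noteq> k \<eta>" using k \<eta>' \<eta>i(2) by (auto simp: inj_on_def)
        then have "\<eta> \<inter> U (g \<eta>) \<noteq> \<eta>' \<inter> U (g \<eta>)" using g_sep[OF \<eta>i(2) \<eta>'(1)] \<open>k \<eta>' \<le> k \<eta>\<close> by simp
        then have "\<eta>' \<inter> U i \<noteq> \<eta> \<inter> U i" using agree_below[of \<eta> i \<eta>' "g \<eta>"] \<eta>i(4) by metis
        then show ?thesis using False x' by simp
      qed
    qed
    note u = this
    have "node i (\<eta> \<inter> U i) (\<theta> p) = (\<Oplus>\<^bsub>D i\<^esub>x\<in>?F. ?u x)"
      using node_\<theta>[OF \<eta>i(3) p] p by (simp add: cotuple_def)
    also have "\<dots> = (\<Oplus>\<^bsub>D i\<^esub>x\<in>?F. if x = (\<eta>, i) then p (\<eta>, i) else \<zero>\<^bsub>D i\<^esub>)"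
      by (rule Di.M.finsum_cong') (use u S.in_family[OF p \<eta>i(1)] in auto)
    also have "\<dots> = p (\<eta>, i)"
      using Di.M.add.finprod_singleton_swap[OF _ fin, of "(\<eta>, i)" "\<lambda>_. p (\<eta>, i)"] i(1) S.in_family[OF p \<eta>i(1)]
      by simp
    finally have "node i (\<eta> \<inter> U i) (\<theta> p) \<noteq> \<zero>\<^bsub>D i\<^esub>" using i(1) by simp
    moreover have "\<theta> p \<in> N" using q_kernel[OF linear_map.closed[OF \<theta>_lin p]] that(2) by simp
    ultimately show False using \<eta>i(3) by (simp add: N_def)
  qed

  have subT: "submodule ?T R L"
    by (rule linear_map.submodule_image[OF q\<theta>], rule S.sum.submoduleI') auto
  \<comment> \<open>If \<open>i < g \<eta>\<close>, replace the part of \<open>\<eta>\<close> between \<open>i\<close> and \<open>g \<eta>\<close> by the same part of an earlier branch \<open>\<eta>'\<close>: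
    the differences \<open>a\<close> and \<open>a'\<close> are supported there and agree modulo \<open>N\<close>.\<close>
  have genT: "q (gen \<eta> i x) \<in> ?T" if "\<eta> \<in> A" "i \<in> J" "x \<in> carrier (D i)" for \<eta> i x
    using that
  proof (induction "k \<eta>" arbitrary: \<eta> i x rule: less_induct)
    case less
    show ?case
    proof (cases "(g \<eta>, i) \<in> r")
      case True
      then have Idx: "(\<eta>, i) \<in> Idx" using less.prems by (simp add: Idx_def)
      then have "gen \<eta> i x = \<theta> (summand Idx ?D (\<eta>, i) x)" using \<theta>_gen less.prems by simp
      then show ?thesis using S.summand_closed[OF Idx] less.prems by simp
    next
      case False
      let ?j = "g \<eta>"
      have j: "?j \<in> J" "(i, ?j) \<in> r" using g r_total[of i ?j] less.prems False by auto
      obtain \<eta>' where \<eta>': "\<eta>' \<in> A" "k \<eta>' < k \<eta>" "\<And>l. \<lbrakk>l \<in> J; (?j, l) \<notin> r\<rbrakk> \<Longrightarrow> \<eta> \<inter> U l = \<eta>' \<inter> U l"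
        using g_agree[OF less.prems(1,2) False] by blast
      have br: "\<eta> \<in> branches" "\<eta>' \<in> branches" using less.prems(1) \<eta>'(1) A(1) by auto
      define y where "y = f i ?j x"
      have y: "y \<in> carrier (D ?j)" using linear_map.closed[OF f_linear[OF j(2)] less.prems(3)] by (simp add: y_def)
      have cl: "gen \<eta> i x \<in> carrier P" "gen \<eta> ?j y \<in> carrier P" "gen \<eta>' i x \<in> carrier P" "gen \<eta>' ?j y \<in> carrier P"
        using gen_closed br less.prems(2,3) j(1) y by auto
      define a where "a = gen \<eta> i x \<ominus>\<^bsub>P\<^esub> gen \<eta> ?j y"
      define a' where "a' = gen \<eta>' i x \<ominus>\<^bsub>P\<^esub> gen \<eta>' ?j y"
      have a: "a \<in> carrier P" "a' \<in> carrier P" using cl by (simp_all add: a_def a'_def)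
      have "node l s a = node l s a'" if l: "l \<in> J" for l s
      proof -
        interpret nd: linear_map R P "D l" "node l s" by (rule linear_map_node[OF l])
        show ?thesis
        proof (cases "(?j, l) \<in> r")
          case True
          then have "(i, l) \<in> r" using j(2) r_trans by blast
          then have eq: "transition i l x = transition ?j l y" "transition ?j l y \<in> carrier (D l)"
            using True f_comp[OF j(2) True less.prems(3)] linear_map.closed[OF f_linear[OF True] y]
            by (simp_all add: transition_def y_def)
          have "z \<ominus>\<^bsub>D l\<^esub> z = \<zero>\<^bsub>D l\<^esub>" if "z \<in> carrier (D l)" for z
            using nd.cod.minus_eq_zero_iff that by blast
          then show ?thesis
            using cl br less.prems(2,3) j(1) y l eq
            by (simp add: a_def a'_def nd.minus node_gen)
        next
          case False
          then show ?thesis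
            using cl br less.prems(2,3) j(1) y l \<eta>'(3)[OF l False]
            by (simp add: a_def a'_def nd.minus node_gen)
        qed
      qed
      then have "a \<ominus>\<^bsub>P\<^esub> a' \<in> N"
        using a by (simp add: N_def linear_map.minus[OF linear_map_node]
            left_module.minus_eq_zero_iff[OF modules] linear_map.closed[OF linear_map_node])
      then have "q (a \<ominus>\<^bsub>P\<^esub> a') = \<zero>\<^bsub>L\<^esub>" using q_kernel a by simp
      then have qa: "q a = q a'" using a by (simp add: q.minus q.cod.minus_eq_zero_iff)
      have "gen \<eta> i x = a \<oplus>\<^bsub>P\<^esub> gen \<eta> ?j y"
        using cl by (simp add: a_def a_minus_def P.sum.M.a_assoc P.sum.M.l_neg)
      then have "q (gen \<eta> i x) = (q (gen \<eta>' i x) \<ominus>\<^bsub>L\<^esub> q (gen \<eta>' ?j y)) \<oplus>\<^bsub>L\<^esub> q (gen \<eta> ?j y)"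
        using qa a cl by (simp add: q.add a'_def q.minus)
      moreover have "q (gen \<eta>' i x) \<in> ?T" "q (gen \<eta>' ?j y) \<in> ?T"
        using less.hyps[OF \<eta>'(2,1)] less.prems(2,3) j(1) y by auto
      moreover have "q (gen \<eta> ?j y) \<in> ?T"
      proof -
        have Idx: "(\<eta>, ?j) \<in> Idx" using less.prems(1) j(1) r_refl by (simp add: Idx_def)
        then have "gen \<eta> ?j y = \<theta> (summand Idx ?D (\<eta>, ?j) y)" using \<theta>_gen y by simp
        then show ?thesis using S.summand_closed[OF Idx] y by simp
      qed
      ultimately show ?thesis using submodule_facts(3,6)[OF subT] by simp
    qed
  qed
  have "?T = span A"
  proof
    show "span A \<subseteq> ?T" by (rule span_least[OF A(1) subT genT])
    have "q (\<theta> p) \<in> span A" if "p \<in> carrier S.S" for p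
    proof (rule S.linear_map_into_submodule[OF q\<theta> submodule_span[OF A(1)] _ that])
      show "q (\<theta> (summand Idx ?D p x)) \<in> span A" if "p \<in> Idx" "x \<in> carrier (D (snd p))" for p x
        using that Idx[OF that(1)] \<theta>_gen[of "fst p" "snd p" x] gen_in_span[OF A(1)] by simp
    qed
    then show "?T \<subseteq> span A" by blast
  qed
  note T = this
  have spanS: "submodule (span A) R L" by (rule submodule_span[OF A(1)])
  show ?thesis
  proof (rule direct_sum_in_class)
    show "small TYPE('v) Idx"
      by (rule small_subset[OF _ small_Sigma[OF small_countable[OF A(2)] J_small]]) (auto simp: Idx_def r_snd)
    show "?D p \<in> \<X>" if "p \<in> Idx" for p using D_class Idx(2)[OF that] .
    show "L\<lparr>carrier := span A\<rparr> \<in> Modules R"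
      using q.cod.left_module_submodule[OF spanS] small_subset[OF submodule_facts(1)[OF spanS]] L_module
      by (simp add: Modules_def)
    show "linear_map R S.S (L\<lparr>carrier := span A\<rparr>) (\<lambda>p. q (\<theta> p))"
      by (rule linear_map.corestrict_submodule[OF q\<theta> spanS]) (use T in blast)
    have "inj_on (\<lambda>p. q (\<theta> p)) (carrier S.S)"
      using linear_map.inj_on_iff_kernel[OF q\<theta>] inj by blast
    then show "bij_betw (\<lambda>p. q (\<theta> p)) (carrier S.S) (carrier (L\<lparr>carrier := span A\<rparr>))"
      using T by (simp add: bij_betw_def)
  qed
qed

text \<open>The spans of countable sets of branches form an \<open>(\<aleph>\<^sub>1, \<X>)\<close>-dense system of submodules.\<close>

lemma L_in_class: "L \<in> \<X>"
proof -
  define \<S> where "\<S> = span ` {A. A \<subseteq> branches \<and> countable A}"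
  have "dense_system aleph1 R \<X> L \<S>"
    unfolding dense_system_def
  proof (intro conjI ballI allI impI)
    show "submodule S R L" if "S \<in> \<S>" for S using that submodule_span by (auto simp: \<S>_def)
    show "\<S> \<noteq> {}" by (auto simp: \<S>_def)
    show "\<exists>T\<in>\<S>. S \<subseteq> T \<and> S' \<subseteq> T" if SS': "S \<in> \<S>" "S' \<in> \<S>" for S S'
    proof -
      obtain A A' where A: "S = span A" "A \<subseteq> branches" "countable A"
        and A': "S' = span A'" "A' \<subseteq> branches" "countable A'" using SS' by (auto simp: \<S>_def)
      then have "A \<union> A' \<subseteq> branches" "countable (A \<union> A')" by auto
      then show ?thesis
        using A A' span_mono[of A "A \<union> A'"] span_mono[of A' "A \<union> A'"]
        by (intro bexI[of _ "span (A \<union> A')"]) (auto simp: \<S>_def)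
    qed
    show "L\<lparr>carrier := S\<rparr> \<in> \<X>" if "S \<in> \<S>" for S using that countable_span_in_class by (auto simp: \<S>_def)
    show "(\<Union>i\<in>Field w. C i) \<in> \<S>"
      if w: "Well_order w \<and> w \<noteq> {} \<and> w <o aleph1 \<and> (\<forall>i\<in>Field w. C i \<in> \<S>) \<and> relChain w C"
      for w :: "nat set rel" and C
    proof -
      have "\<exists>A. C i = span A \<and> A \<subseteq> branches \<and> countable A" if "i \<in> Field w" for i
        using w that unfolding \<S>_def by blast
      then obtain A where A: "\<And>i. i \<in> Field w \<Longrightarrow> C i = span (A i) \<and> A i \<subseteq> branches \<and> countable (A i)"
        by metis
      have "|Field w| <o aleph1"
        using w card_of_least[of "Field w" w] by (auto intro: ordLeq_ordLess_trans)
      then have "countable (Field w)" by (rule countable_if_less_aleph1)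
      then have c: "countable (\<Union>i\<in>Field w. A i)" using A by auto
      have "(\<Union>i\<in>Field w. span (A i)) = span (\<Union>i\<in>Field w. A i)"
      proof (rule span_UN_chain)
        show "Field w \<noteq> {}" using w by (auto simp: Field_def)
        show "A i \<subseteq> branches" if "i \<in> Field w" for i using A[OF that] by blast
        fix i j assume ij: "i \<in> Field w" "j \<in> Field w"
        then have "i = j \<or> (i, j) \<in> w \<or> (j, i) \<in> w"
          using w by (auto simp: order_on_defs total_on_def)
        then have "C i \<subseteq> C j \<or> C j \<subseteq> C i" using w by (auto simp: relChain_def)
        then show "span (A i) \<subseteq> span (A j) \<or> span (A j) \<subseteq> span (A i)" using A ij by simp
      qed
      then have "(\<Union>i\<in>Field w. C i) = span (\<Union>i\<in>Field w. A i)" using A by simp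
      moreover have "(\<Union>i\<in>Field w. A i) \<subseteq> branches" using A by blast
      ultimately show ?thesis using c by (auto simp: \<S>_def)
    qed
    show "\<exists>S\<in>\<S>. X \<subseteq> S" if X: "X \<subseteq> carrier L" "|X| <o aleph1" for X
    proof -
      have "\<exists>A. finite A \<and> A \<subseteq> branches \<and> x \<in> span A" if "x \<in> X" for x
        using in_finite_span X(1) that by (metis subsetD)
      then obtain A where A: "\<And>x. x \<in> X \<Longrightarrow> finite (A x) \<and> A x \<subseteq> branches \<and> x \<in> span (A x)" by metis
      have "countable X" using X(2) by (rule countable_if_less_aleph1)
      then have c: "countable (\<Union>x\<in>X. A x)" using A countable_finite by auto
      have br: "(\<Union>x\<in>X. A x) \<subseteq> branches" using A by blast
      have "X \<subseteq> span (\<Union>x\<in>X. A x)" using A span_mono[OF _ br] by blast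
      then show ?thesis using c br by (auto simp: \<S>_def)
    qed
  qed
  then have "kappa_free aleph1 R \<X> L" using q.cod.left_module_axioms by (auto simp: kappa_free_def)
  then show ?thesis using free L_module by (auto simp: closed_under_aleph1_free_def)
qed

end

section \<open>Extending homomorphisms by counting\<close>

text \<open>
  The sets \<open>U i\<close> are defined by recursion along the well-order: \<open>U i\<close> contains a copy of \<open>W\<close> and a copy \<open>G\<close>
  of the power set of each earlier \<open>U j\<close>. Inaccessibility keeps them small, and the bound on \<open>Pow (U i)\<close>
  holds because every \<open>i\<close> is exceeded by some element of \<open>J\<close>.
\<close>

lemma (in inaccessible_universe) tree_levels:
  fixes J :: "'i set" and W :: "'w set"
  assumes J: "small TYPE('v) J" "well_order_on J r" "\<forall>i\<in>J. \<exists>j\<in>J. (i, j) \<in> r - Id"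
    and nonempty: "J \<noteq> {}" and W: "small TYPE('v) W"
  shows "\<exists>U :: 'i \<Rightarrow> 'v set. (\<forall>i j. (i, j) \<in> r \<longrightarrow> U i \<subseteq> U j) \<and> small TYPE('v) (\<Union>i\<in>J. U i) \<and>
    |W| \<le>o |\<Union>i\<in>J. U i| \<and> (\<forall>i\<in>J. |Pow (U i)| \<le>o |\<Union>i\<in>J. U i| )"
proof -
  have r: "wf (r - Id)" "r \<subseteq> J \<times> J" "trans r" "antisym r"
    using J(2) by (auto simp: order_on_defs)
  obtain w :: "'w \<Rightarrow> 'v" where w: "inj_on w W" using small_injection[OF W] by blast
  define G :: "'v set \<Rightarrow> 'v set" where "G A = (SOME e :: 'v set \<Rightarrow> 'v. inj_on e (Pow A)) ` Pow A" for A
  have G: "|Pow A| \<le>o |G A|" if small_A: "small TYPE('v) A" for A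
  proof -
    obtain e :: "'v set \<Rightarrow> 'v" where "inj_on e (Pow A)"
      using small_injection[OF small_Pow[OF small_A]] by blast
    then have "inj_on (SOME e :: 'v set \<Rightarrow> 'v. inj_on e (Pow A)) (Pow A)"
      by (rule someI[where P = "\<lambda>e. inj_on e (Pow A)"])
    then show ?thesis unfolding G_def by (intro card_of_ordLeqI[of _ "Pow A"]) auto
  qed
  define U :: "'i \<Rightarrow> 'v set" where
    "U = wfrec (r - Id) (\<lambda>U i. w ` W \<union> (\<Union>j\<in>{j. (j, i) \<in> r - Id}. U j \<union> G (U j)))"
  have U: "U i = w ` W \<union> (\<Union>j\<in>{j. (j, i) \<in> r - Id}. U j \<union> G (U j))" for i
    unfolding U_def by (subst wfrec[OF r(1)]) (simp add: cut_apply)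
  have below: "U i \<union> G (U i) \<subseteq> U j" if "(i, j) \<in> r - Id" for i j
    using that by (subst (3) U) blast
  have small_U: "small TYPE('v) (U i)" for i
  proof (induction i rule: wf_induct_rule[OF r(1)])
    case (1 i)
    have "small TYPE('v) {j. (j, i) \<in> r - Id}" by (rule small_subset[OF _ J(1)]) (use r(2) in auto)
    moreover have "small TYPE('v) (U j \<union> G (U j))" if "j \<in> {j. (j, i) \<in> r - Id}" for j
      unfolding G_def using that 1 by (intro small_Un small_image small_Pow) auto
    ultimately have "small TYPE('v) (\<Union>j\<in>{j. (j, i) \<in> r - Id}. U j \<union> G (U j))" by (rule small_UN)
    then show ?case by (subst U) (intro small_Un small_image W)
  qed
  show ?thesis
  proof (intro exI[of _ U] conjI allI ballI impI)
    show "U i \<subseteq> U j" if "(i, j) \<in> r" for i j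
      using below[of i j] that by (cases "i = j") auto
    show "small TYPE('v) (\<Union>i\<in>J. U i)" using small_UN J(1) small_U by blast
    show "|W| \<le>o |\<Union>i\<in>J. U i|"
    proof -
      obtain i where "i \<in> J" using nonempty by blast
      moreover have "w ` W \<subseteq> U i" by (subst U) blast
      ultimately show ?thesis using w by (intro card_of_ordLeqI[of w]) auto
    qed
    show "|Pow (U i)| \<le>o |\<Union>i\<in>J. U i|" if i: "i \<in> J" for i
    proof -
      obtain j where "j \<in> J" "(i, j) \<in> r - Id" using bspec[OF J(3) i] by (rule bexE)
      then have "G (U i) \<subseteq> (\<Union>i\<in>J. U i)" using below[of i j] by auto
      then show ?thesis using ordLeq_transitive[OF G[OF small_U] card_of_mono1] by simp
    qed
  qed
qed

locale limit_tree = chain_limit R J r D f M \<phi> + tree_module R J r D f U \<X> L q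
  for R :: "('r, 'm) ring_scheme" (structure)
    and J :: "'i set" and r :: "'i rel" and D :: "'i \<Rightarrow> ('r, 'v) module"
    and f :: "'i \<Rightarrow> 'i \<Rightarrow> 'v \<Rightarrow> 'v" and M :: "('r, 'b, 'k) module_scheme" and \<phi> :: "'i \<Rightarrow> 'v \<Rightarrow> 'b"
    and U :: "'i \<Rightarrow> 'u set" and \<X> :: "('r, 'v) module set" and L :: "('r, 'v) module"
    and q :: "('u set \<Rightarrow> 'i \<Rightarrow> 'v) \<Rightarrow> 'v"
begin

definition K :: "('i \<Rightarrow> 'v) set" where "K = {b \<in> carrier B. h b = \<zero>\<^bsub>M\<^esub>}"

lemma submodule_K: "submodule K R B"
  unfolding K_def by (rule linear_map.submodule_kernel[OF linear_map_h])

text \<open>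
  Look at the node of \<open>\<eta>\<close> on a level that lies beyond the support of \<open>p \<eta>\<close> and separates \<open>\<eta>\<close> from the other
  branches in the support of \<open>p\<close>. There only \<open>p \<eta>\<close> is seen, and its value represents \<open>h (p \<eta>)\<close>.
\<close>

lemma N_components:
  assumes p: "p \<in> N" and \<eta>: "\<eta> \<in> branches"
  shows "p \<eta> \<in> K"
proof -
  have pP: "p \<in> carrier P" using p by (simp add: N_def)
  have p\<eta>: "p \<eta> \<in> carrier B" by (rule P.in_family[OF pP \<eta>])
  let ?F = "{\<eta> \<in> branches. p \<eta> \<noteq> \<zero>\<^bsub>B\<^esub>}"
  have F: "finite ?F" by (rule P.finite_support[OF pP])
  show ?thesis
  proof (cases "\<eta> \<in> ?F")
    case False
    then show ?thesis using \<eta> submodule_facts(2)[OF submodule_K] by simp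
  next
    case True
    obtain j where j: "j \<in> J" "\<forall>\<eta>'\<in>?F - {\<eta>}. \<eta> \<inter> U j \<noteq> \<eta>' \<inter> U j"
      by (rule separating_level[of "?F - {\<eta>}" \<eta>]) (use F \<eta> in auto)
    obtain l where l: "l \<in> J" "\<And>i. \<lbrakk>i \<in> J; p \<eta> i \<noteq> \<zero>\<^bsub>D i\<^esub>\<rbrakk> \<Longrightarrow> (i, l) \<in> r"
      using bounded_support[OF p\<eta>] by blast
    obtain m where m: "m \<in> J" "(j, m) \<in> r" "(l, m) \<in> r"
      by (rule finite_bounded[of "{j, l}"]) (use j(1) l(1) in auto)
    interpret Dm: left_module R "D m" by (rule modules[OF m(1)])
    have lev: "level m (p \<eta>) \<in> carrier (D m)" using linear_map.closed[OF linear_map_level[OF m(1)] p\<eta>] .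
    have "(if \<eta>' \<inter> U m = \<eta> \<inter> U m then level m else (\<lambda>_. \<zero>\<^bsub>D m\<^esub>)) (p \<eta>') =
        (if \<eta>' = \<eta> then level m (p \<eta>) else \<zero>\<^bsub>D m\<^esub>)" if "\<eta>' \<in> ?F" for \<eta>'
      using j(2) that agree_below[of \<eta> m \<eta>' j] m(2) by auto
    then have "node m (\<eta> \<inter> U m) p = (\<Oplus>\<^bsub>D m\<^esub>\<eta>'\<in>?F. if \<eta>' = \<eta> then level m (p \<eta>) else \<zero>\<^bsub>D m\<^esub>)"
      using pP lev Dm.M.finsum_cong'[of ?F ?F] by (simp add: node_def cotuple_def)
    also have "\<dots> = level m (p \<eta>)"
      using Dm.M.add.finprod_singleton_swap[OF True F, of "\<lambda>_. level m (p \<eta>)"] lev by simp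
    finally have "level m (p \<eta>) = \<zero>\<^bsub>D m\<^esub>" using p m(1) by (simp add: N_def)
    moreover have "\<phi> m (level m (p \<eta>)) = h (p \<eta>)"
      unfolding h_def
      by (rule level_beyond_support[OF p\<eta> _ m(1) limit.left_module_axioms \<phi>_linear \<phi>_compat])
        (use l(2) m(3) r_trans in blast)+
    ultimately have "h (p \<eta>) = \<zero>\<^bsub>M\<^esub>" using linear_map.zero[OF \<phi>_linear[OF m(1)]] by simp
    then show ?thesis using p\<eta> by (simp add: K_def)
  qed
qed

text \<open>
  The partial sums of \<open>k\<close> vanish from some level \<open>j\<close> on, so modulo \<open>N\<close> the element \<open>k\<close> on \<open>\<eta>\<close> depends only
  on \<open>\<eta> \<inter> U j\<close>. That set is a branch as well and serves as the representative \<open>s\<close>.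
\<close>

lemma truncated_branch:
  assumes k: "k \<in> K" and \<eta>: "\<eta> \<in> branches"
  obtains s where "s \<in> (\<Union>j\<in>J. Pow (U j))" "s \<in> branches" "branch \<eta> k \<ominus>\<^bsub>P\<^esub> branch s k \<in> N"
proof -
  have kB: "k \<in> carrier B" "h k = \<zero>\<^bsub>M\<^esub>" using k by (auto simp: K_def)
  obtain j where j: "j \<in> J" "\<And>l. (j, l) \<in> r \<Longrightarrow> level l k = \<zero>\<^bsub>D l\<^esub>" using h_kernel[OF kB] by blast
  let ?s = "\<eta> \<inter> U j"
  have s: "?s \<in> branches" using \<eta> by (auto simp: branches_def)
  have cl: "branch \<eta> k \<in> carrier P" "branch ?s k \<in> carrier P" using P.summand_closed \<eta> s kB(1) by auto
  have "node l t (branch \<eta> k) = node l t (branch ?s k)" if l: "l \<in> J" for l t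
  proof (cases "(j, l) \<in> r")
    case True
    then show ?thesis using j(2)[OF True] \<eta> s l kB(1) by (simp add: node_branch)
  next
    case False
    then have "(l, j) \<in> r" using r_total j(1) l by blast
    then have "\<eta> \<inter> U l = ?s \<inter> U l" using U_mono by blast
    then show ?thesis using \<eta> s l kB(1) by (simp add: node_branch)
  qed
  then have "branch \<eta> k \<ominus>\<^bsub>P\<^esub> branch ?s k \<in> N"
    using cl by (simp add: N_def linear_map.minus[OF linear_map_node]
        left_module.minus_eq_zero_iff[OF modules] linear_map.closed[OF linear_map_node])
  then show thesis using that[of ?s] s j(1) by blast
qed

text \<open>
  By \<open>N_components\<close>, \<open>N\<close> lies in the direct sum of the copies of \<open>K\<close>, on which the map that is \<open>g\<close> on the
  branches in \<open>T\<close> and \<open>0\<close> on the others is defined. Its restriction to \<open>N\<close> extends to a map \<open>\<Phi>\<close> on \<open>P\<close>, as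
  \<open>Ext\<^sup>1(L, C) = 0\<close>. The difference of the two maps vanishes on \<open>N\<close>, so it does not
  distinguish \<open>k\<close> on \<open>\<eta>\<close> from \<open>k\<close> on \<open>s\<close> when these are congruent modulo \<open>N\<close>.
\<close>

lemma indicator_extension:
  assumes C: "trivial_group (Ext1 R L C)" and g: "linear_map R (B\<lparr>carrier := K\<rparr>) C g"
  obtains \<Phi> where "linear_map R P C \<Phi>"
    and "\<And>\<eta> s k. \<lbrakk>k \<in> K; \<eta> \<in> branches; s \<in> branches; branch \<eta> k \<ominus>\<^bsub>P\<^esub> branch s k \<in> N\<rbrakk> \<Longrightarrow>
      \<Phi> (branch \<eta> k) \<ominus>\<^bsub>C\<^esub> (if \<eta> \<in> T then g k else \<zero>\<^bsub>C\<^esub>) =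
      \<Phi> (branch s k) \<ominus>\<^bsub>C\<^esub> (if s \<in> T then g k else \<zero>\<^bsub>C\<^esub>)"
proof -
  let ?BK = "B\<lparr>carrier := K\<rparr>" and ?u = "\<lambda>\<eta>. if \<eta> \<in> T then g else (\<lambda>_. \<zero>\<^bsub>C\<^esub>)"
  interpret g: linear_map R ?BK C g by (rule g)
  interpret PK: cotuple_family R branches "\<lambda>_. ?BK" C ?u
    by (intro cotuple_family.intro cotuple_family_axioms.intro module_family.intro
        module_family_axioms.intro ring_axioms g.dom.left_module_axioms g.cod.left_module_axioms)
      (simp add: g linear_map_zero g.dom.left_module_axioms g.cod.left_module_axioms)
  let ?w = "cotuple R branches (\<lambda>_. ?BK) C ?u"
  have ops: "x \<oplus>\<^bsub>PK.S\<^esub> y = x \<oplus>\<^bsub>P\<^esub> y" "a \<odot>\<^bsub>PK.S\<^esub> x = a \<odot>\<^bsub>P\<^esub> x" for a x y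
    by (simp_all add: direct_sum_def)
  have NPK: "p \<in> carrier PK.S" if p: "p \<in> N" for p
  proof (rule PK.direct_sumI)
    have pP: "p \<in> carrier P" using p by (simp add: N_def)
    show "finite {\<eta> \<in> branches. p \<eta> \<noteq> \<zero>\<^bsub>B\<^esub>}" by (rule P.finite_support[OF pP])
    show "p \<in> extensional branches" using pP by (simp add: direct_sum_simps PiE_def)
  qed (use N_components[OF p] in auto)
  have kerN: "{p \<in> carrier P. q p = \<zero>\<^bsub>L\<^esub>} = N"
    using q_kernel by (auto simp: N_def)
  interpret N: left_module R "P\<lparr>carrier := N\<rparr>" by (rule P.sum.left_module_submodule[OF submodule_N])
  have "linear_map R (P\<lparr>carrier := N\<rparr>) C ?w"
    by unfold_locales (auto simp: NPK PK.add[unfolded ops] PK.smult[unfolded ops])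
  then obtain \<Phi> where \<Phi>: "linear_map R P C \<Phi>" and \<Phi>w: "\<And>p. p \<in> N \<Longrightarrow> \<Phi> p = ?w p"
    using left_module.extend_from_kernel[OF q.cod.left_module_axioms C q_linear q_surj, unfolded kerN, of ?w]
      q_kernel unfolding N_def by (metis (no_types, lifting) mem_Collect_eq)
  interpret \<Phi>: linear_map R P C \<Phi> by (rule \<Phi>)
  show thesis
  proof
    show "linear_map R P C \<Phi>" by (rule \<Phi>)
    fix \<eta> s k assume k: "k \<in> K" and \<eta>: "\<eta> \<in> branches" and s: "s \<in> branches"
      and N: "branch \<eta> k \<ominus>\<^bsub>P\<^esub> branch s k \<in> N"
    have kB: "k \<in> carrier B" using k by (simp add: K_def)
    have cl: "branch \<eta> k \<in> carrier P" "branch s k \<in> carrier P" using P.summand_closed \<eta> s kB by auto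
    have br: "branch \<eta> k = summand branches (\<lambda>_. ?BK) \<eta> k" for \<eta>
    proof -
      have "\<zero>\<^bsub>?BK\<^esub> = \<zero>\<^bsub>B\<^esub>" by simp
      then show ?thesis unfolding summand_def by (simp only:)
    qed
    have clK: "branch \<eta> k \<in> carrier PK.S" "branch s k \<in> carrier PK.S"
      unfolding br using PK.summand_closed \<eta> s k by auto
    have w: "?w (branch \<eta> k) = ?u \<eta> k" if "\<eta> \<in> branches" for \<eta>
      unfolding br using PK.cotuple_summand[OF that] k by simp
    have u: "?u \<eta> k \<in> carrier C" for \<eta> using k by auto
    have "branch \<eta> k = (branch \<eta> k \<ominus>\<^bsub>P\<^esub> branch s k) \<oplus>\<^bsub>P\<^esub> branch s k"
      using cl by (simp add: a_minus_def P.sum.M.a_assoc P.sum.M.l_neg)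
    then have "?w (branch \<eta> k) = ?w (branch \<eta> k \<ominus>\<^bsub>P\<^esub> branch s k) \<oplus>\<^bsub>C\<^esub> ?w (branch s k)"
      using PK.add[unfolded ops, OF NPK[OF N] clK(2)] by simp
    moreover have "?w (branch \<eta> k \<ominus>\<^bsub>P\<^esub> branch s k) = \<Phi> (branch \<eta> k) \<ominus>\<^bsub>C\<^esub> \<Phi> (branch s k)"
      using \<Phi>w[OF N] \<Phi>.minus[OF cl] by simp
    ultimately have eq: "?u \<eta> k = (\<Phi> (branch \<eta> k) \<ominus>\<^bsub>C\<^esub> \<Phi> (branch s k)) \<oplus>\<^bsub>C\<^esub> ?u s k"
      using w \<eta> s by simp
    have "\<Phi> (branch \<eta> k) \<ominus>\<^bsub>C\<^esub> ?u \<eta> k = \<Phi> (branch s k) \<ominus>\<^bsub>C\<^esub> ?u s k"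
      using \<Phi>.closed[OF cl(1)] \<Phi>.closed[OF cl(2)] u[of s]
      by (simp add: eq a_minus_def g.cod.M.minus_add g.cod.M.a_assoc g.cod.M.r_neg2)
    then show "\<Phi> (branch \<eta> k) \<ominus>\<^bsub>C\<^esub> (if \<eta> \<in> T then g k else \<zero>\<^bsub>C\<^esub>) =
      \<Phi> (branch s k) \<ominus>\<^bsub>C\<^esub> (if s \<in> T then g k else \<zero>\<^bsub>C\<^esub>)"
      by (auto split: if_splits)
  qed
qed

text \<open>
  By \<open>truncated_branch\<close> the difference \<open>\<psi> T\<close> attached to a set \<open>T\<close> of branches is determined by its values
  on the bounded branches \<open>s \<in> Pow (U j)\<close>, which are recorded in \<open>code T\<close>. There are too few codes to
  distinguish all sets \<open>T\<close>, and two sets with the same code yield the extension.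
\<close>

lemma extension_by_counting:
  assumes C: "trivial_group (Ext1 R L C)" and g: "linear_map R (B\<lparr>carrier := K\<rparr>) C g"
    and card: "|carrier B \<times> (\<Union>j\<in>J. Pow (U j)) \<times> carrier C| \<le>o |\<Union>j\<in>J. U j|"
  shows "\<exists>g'. linear_map R B C g' \<and> (\<forall>k\<in>K. g' k = g k)"
proof -
  let ?W = "carrier B \<times> (\<Union>j\<in>J. Pow (U j)) \<times> carrier C"
  interpret g: linear_map R "B\<lparr>carrier := K\<rparr>" C g by (rule g)
  let ?good = "\<lambda>T \<Phi>. linear_map R P C \<Phi> \<and> (\<forall>\<eta> s k. k \<in> K \<and> \<eta> \<in> branches \<and> s \<in> branches \<and>
      branch \<eta> k \<ominus>\<^bsub>P\<^esub> branch s k \<in> N \<longrightarrow>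
      \<Phi> (branch \<eta> k) \<ominus>\<^bsub>C\<^esub> (if \<eta> \<in> T then g k else \<zero>\<^bsub>C\<^esub>) =
      \<Phi> (branch s k) \<ominus>\<^bsub>C\<^esub> (if s \<in> T then g k else \<zero>\<^bsub>C\<^esub>))"
  have "\<exists>\<Phi>. ?good T \<Phi>" for T
    by (rule indicator_extension[OF C g, of T]) blast
  then obtain \<Phi> where \<Phi>: "\<And>T. ?good T (\<Phi> T)" by metis
  define \<psi> where "\<psi> T \<eta> k = \<Phi> T (branch \<eta> k) \<ominus>\<^bsub>C\<^esub> (if \<eta> \<in> T then g k else \<zero>\<^bsub>C\<^esub>)" for T \<eta> k
  have \<Phi>_lin: "linear_map R P C (\<Phi> T)" for T using \<Phi> by blast
  have \<psi>: "\<psi> T \<eta> k = \<psi> T s k"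
    if "k \<in> K" "\<eta> \<in> branches" "s \<in> branches" "branch \<eta> k \<ominus>\<^bsub>P\<^esub> branch s k \<in> N" for T \<eta> s k
    using \<Phi>[of T] that unfolding \<psi>_def by blast
  have KB: "K \<subseteq> carrier B" by (auto simp: K_def)
  have br: "(\<Union>j\<in>J. Pow (U j)) \<subseteq> branches" by (auto simp: branches_def)
  have \<psi>C: "\<psi> T \<eta> k \<in> carrier C" if "k \<in> K" "\<eta> \<in> branches" for T \<eta> k
    using that KB linear_map.closed[OF \<Phi>_lin P.summand_closed, of \<eta> k T] g.closed[of k]
    by (auto simp: \<psi>_def)
  define code where "code T = {(k, s, \<psi> T s k) | k s. k \<in> K \<and> s \<in> (\<Union>j\<in>J. Pow (U j))}" for T
  have "\<not> inj_on code (Pow branches)"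
  proof
    assume "inj_on code (Pow branches)"
    moreover have "code ` Pow branches \<subseteq> Pow ?W"
      using KB br \<psi>C unfolding code_def by blast
    ultimately have "|Pow branches| \<le>o |Pow ?W|" by (intro card_of_ordLeqI[of code]) auto
    moreover have "|Pow ?W| \<le>o |branches|"
    proof -
      obtain e where e: "inj_on e ?W" "e ` ?W \<subseteq> (\<Union>j\<in>J. U j)" using card card_of_ordLeq by metis
      then show ?thesis
        unfolding branches_def by (intro card_of_ordLeqI[of "image e"] inj_on_image_Pow) auto
    qed
    ultimately have "|Pow branches| \<le>o |branches|" by (rule ordLeq_transitive)
    then show False using card_of_Pow[of branches] not_ordLess_ordLeq by blast
  qed
  then obtain T T' where TT': "T \<subseteq> branches" "T' \<subseteq> branches" "code T = code T'" "T \<noteq> T'"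
    by (auto simp: inj_on_def)
  have "\<exists>T T' \<eta>. code T = code T' \<and> \<eta> \<in> branches \<and> \<eta> \<in> T \<and> \<eta> \<notin> T'"
    using TT' by (metis subset_antisym subset_iff)
  then obtain T T' \<eta> where T: "code T = code T'" "\<eta> \<in> branches" "\<eta> \<in> T" "\<eta> \<notin> T'" by blast
  show ?thesis
  proof (intro exI conjI ballI)
    show "linear_map R B C (\<lambda>b. \<Phi> T (branch \<eta> b) \<ominus>\<^bsub>C\<^esub> \<Phi> T' (branch \<eta> b))"
      by (intro linear_map_minus linear_map_comp[OF P.linear_map_summand[OF T(2)] \<Phi>_lin])
    show "\<Phi> T (branch \<eta> k) \<ominus>\<^bsub>C\<^esub> \<Phi> T' (branch \<eta> k) = g k" if k: "k \<in> K" for k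
    proof -
      obtain s where s: "s \<in> (\<Union>j\<in>J. Pow (U j))" "s \<in> branches" "branch \<eta> k \<ominus>\<^bsub>P\<^esub> branch s k \<in> N"
        using truncated_branch[OF k T(2)] by blast
      have "(k, s, \<psi> T s k) \<in> code T'" using k s(1) T(1)[symmetric] by (auto simp: code_def)
      then have "\<psi> T s k = \<psi> T' s k" by (auto simp: code_def)
      then have "\<psi> T \<eta> k = \<psi> T' \<eta> k" using \<psi>[OF k T(2) s(2,3)] by simp
      moreover have "branch \<eta> k \<in> carrier P" using P.summand_closed T(2) k KB by blast
      then have cl: "\<Phi> T (branch \<eta> k) \<in> carrier C" "\<Phi> T' (branch \<eta> k) \<in> carrier C" "g k \<in> carrier C"
        using linear_map.closed[OF \<Phi>_lin] g.closed[of k] k by auto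
      ultimately have eq: "\<Phi> T' (branch \<eta> k) = \<Phi> T (branch \<eta> k) \<ominus>\<^bsub>C\<^esub> g k"
        using T(3,4) g.cod.M.minus_equality[of "\<zero>\<^bsub>C\<^esub>" "\<zero>\<^bsub>C\<^esub>"] by (simp add: \<psi>_def a_minus_def)
      show ?thesis
        using cl by (simp add: eq a_minus_def g.cod.M.minus_add g.cod.M.add.m_ac
            g.cod.M.r_neg1 g.cod.M.r_neg2 g.cod.M.r_neg)
    qed
  qed
qed

end

theorem theorem2p4:
  fixes R :: "('r, 'm) ring_scheme"
    and \<X> :: "('r, 'v) module set"
  assumes universe: "strongly_inaccessible |UNIV :: 'v set|"
    and R: "ring R" "small TYPE('v) (carrier R)"
    and \<X>: "\<X> \<subseteq> Modules R"
    and sums: "closed_under_direct_sums R \<X>"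
    and free: "closed_under_aleph1_free R \<X>"
  shows "tot_ord_direct_limits R \<X> \<subseteq> left_perp R (right_perp R \<X>)"
proof
  interpret ring R by (rule R(1))
  interpret closed_class R \<X>
    by unfold_locales (fact universe \<X> sums free)+
  fix M assume "M \<in> tot_ord_direct_limits R \<X>"
  then obtain I :: "'v set" and r D f where I: "small TYPE('v) I" "linear_order_on I r" "direct_system R I r D f"
    and D: "\<And>i. i \<in> I \<Longrightarrow> D i \<in> \<X>" and lim: "is_direct_limit R I r D f M"
    unfolding tot_ord_direct_limits_def by blast
  obtain J \<phi> where J: "J \<subseteq> I" and cl: "chain_limit R J (Restr r J) D f M \<phi>" and M: "M \<in> Modules R"
    using direct_limit_chain[OF R(1) I lim] by blast
  interpret chain_limit R J "Restr r J" D f M \<phi> by (rule cl)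
  have DJ: "D i \<in> \<X>" if "i \<in> J" for i using D J that by blast
  have smallJ: "small TYPE('v) J" using small_subset[OF J I(1)] .
  have smallB: "small TYPE('v) (carrier B)" using small_direct_sum[OF smallJ] small_class[OF DJ] by blast
  show "M \<in> left_perp R (right_perp R \<X>)"
    unfolding left_perp_def
  proof (intro CollectI conjI ballI M)
    fix C assume "C \<in> right_perp R \<X>"
    then have C: "left_module R C" "small TYPE('v) (carrier C)"
      and triv: "\<And>X. X \<in> \<X> \<Longrightarrow> trivial_group (Ext1 R X C)"
      by (auto simp: right_perp_def Modules_def)
    show "trivial_group (Ext1 R M C)"
    proof (cases "\<exists>m\<in>J. \<forall>i\<in>J. (i, m) \<in> Restr r J")
      case True
      then obtain m where m: "m \<in> J" "\<And>i. i \<in> J \<Longrightarrow> (i, m) \<in> Restr r J" by blast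
      then have "M \<in> \<X>"
        using isomorphic_in_class[OF DJ M \<phi>_linear bijective_last] by blast
      then show ?thesis by (rule triv)
    next
      case False
      then have unbounded: "\<forall>i\<in>J. \<exists>j\<in>J. (i, j) \<in> Restr r J - Id"
        using r_total by blast
      \<comment> \<open>A bound for everything that has to be at most as large as the tree; \<open>nat\<close> makes the tree infinite.\<close>
      let ?W = "carrier B <+> carrier C <+> J <+> (UNIV :: nat set)"
      have smallW: "small TYPE('v) ?W"
        by (intro small_Plus smallB C(2) smallJ small_countable) simp
      obtain U :: "'v \<Rightarrow> 'v set" where U: "\<And>i j. (i, j) \<in> Restr r J \<Longrightarrow> U i \<subseteq> U j"
        and small_U: "small TYPE('v) (\<Union>i\<in>J. U i)" and W_U: "|?W| \<le>o |\<Union>i\<in>J. U i|"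
        and Pow_U: "\<forall>i\<in>J. |Pow (U i)| \<le>o |\<Union>i\<in>J. U i|"
        using tree_levels[OF smallJ well_order unbounded nonempty smallW] by blast
      interpret tree R J "Restr r J" D f U by unfold_locales (use U in blast)
      have "small TYPE('v) branches" unfolding branches_def by (rule small_Pow[OF small_U])
      then have smallP: "small TYPE('v) (carrier P)" using smallB by (rule small_direct_sum)
      obtain L :: "('r, 'v) module" and q where "L \<in> Modules R" "linear_map R P L q"
        "q ` carrier P = carrier L" "\<forall>x\<in>carrier P. q x = \<zero>\<^bsub>L\<^esub> \<longleftrightarrow> x \<in> N"
        using quotient_in_universe[OF P.left_module_direct_sum submodule_N smallP] by blast
      then interpret tree_module R J "Restr r J" D f U \<X> L q
        by (intro tree_module.intro tree_module_axioms.intro tree_axioms closed_class_axioms)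
          (simp_all add: smallJ DJ)
      interpret limit_tree R J "Restr r J" D f M \<phi> U \<X> L q ..

      let ?\<Omega> = "\<Union>i\<in>J. U i"
      have le: "|carrier B| \<le>o |?\<Omega>|" "|carrier C| \<le>o |?\<Omega>|" "|J| \<le>o |?\<Omega>|" "|UNIV :: nat set| \<le>o |?\<Omega>|"
        using W_U card_of_Plus1 card_of_Plus2 ordLeq_transitive by metis+
      have inf: "infinite ?\<Omega>" using le(4) infinite_iff_card_of_nat by blast
      have "|\<Union>j\<in>J. Pow (U j)| \<le>o |?\<Omega>|"
        using Pow_U by (rule card_of_UNION_ordLeq_infinite[OF inf le(3)])
      then have card: "|carrier B \<times> (\<Union>j\<in>J. Pow (U j)) \<times> carrier C| \<le>o |?\<Omega>|"
        using le inf by (intro card_of_Sigma_ordLeq_infinite ballI)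

      have zeroB: "submodule {\<zero>\<^bsub>B\<^esub>} R B" by (rule B.sum.submoduleI') auto
      obtain Z :: "('r, 'v) module" and t where Z: "Z \<in> Modules R" and t: "linear_map R B Z t"
        and t_surj: "t ` carrier B = carrier Z" and t0: "\<forall>x\<in>carrier B. t x = \<zero>\<^bsub>Z\<^esub> \<longleftrightarrow> x \<in> {\<zero>\<^bsub>B\<^esub>}"
        using quotient_in_universe[OF B.left_module_direct_sum zeroB smallB] by blast
      have t_bij: "bij_betw t (carrier B) (carrier Z)"
        using linear_map.inj_on_iff_kernel[OF t] t0 t_surj by (simp add: bij_betw_def)
      have "Z \<in> \<X>" by (rule direct_sum_in_class[OF smallJ DJ Z t t_bij])
      then show ?thesis
      proof (rule left_module.Ext1_trivial_if_extends_from_kernel[OF limit.left_module_axioms C(1)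
            linear_map_h h_surj t t_bij triv])
        fix g assume "linear_map R (B\<lparr>carrier := {b \<in> carrier B. h b = \<zero>\<^bsub>M\<^esub>}\<rparr>) C g"
        then show "\<exists>g'. linear_map R B C g' \<and> (\<forall>b\<in>carrier B. h b = \<zero>\<^bsub>M\<^esub> \<longrightarrow> g' b = g b)"
          using extension_by_counting[OF triv[OF L_in_class] _ card, of g]
          by (simp add: K_def Ball_def imp_conjL)
      qed
    qed
  qed
qed

end
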